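(* For $n>4$, $L^{n/2}(\mathbb{R}^n)\subset\mathcal{W}_2$.
   Context: For $V\in L^1_{loc}(\mathbb{R}^n)$ complex-valued, $|V|-\Delta$ denotes the non-negative self-adjoint operator on $L^2(\mathbb{R}^n)$ associated with the form $\int\nabla u\cdot\overline{\nabla v}+\int|V|u\overline v$ on $\{u\in H^1(\mathbb{R}^n):|V|^{1/2}u\in L^2(\mathbb{R}^n)\}$. $\mathcal{W}_2$ is the class of all $V\in L^1_{loc}(\mathbb{R}^n)$ for which $$[V]_2:=\sup_{0\neq u\in D(|V|-\Delta)}\frac{\||V|u\|_2+\|(-\Delta)u\|_2}{\|(|V|-\Delta)u\|_2}<\infty,$$ where a norm in the numerator is read as $+\infty$ if $u$ is not in the domain of the corresponding operator. $L^{n/2}(\mathbb{R}^n)$ consists of complex-valued functions. *)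

theory Defs
  imports "HOL-Analysis.Analysis"
begin

text \<open>
  Elements of Lebesgue and Sobolev spaces are represented by functions. All notions below
  are invariant under changes on a null set, and \<open>u = 0\<close> is read almost everywhere.
\<close>

definition Lp :: "real \<Rightarrow> ('a::euclidean_space \<Rightarrow> complex) set" where
  "Lp p = {u. u \<in> borel_measurable lebesgue \<and> integrable lebesgue (\<lambda>x. norm (u x) powr p)}"

definition Lp_norm :: "real \<Rightarrow> ('a::euclidean_space \<Rightarrow> complex) \<Rightarrow> real" where
  "Lp_norm p u = (LINT x|lebesgue. norm (u x) powr p) powr (1 / p)"

definition L1_loc :: "('a::euclidean_space \<Rightarrow> complex) set" where
  "L1_loc = {V. V \<in> borel_measurable lebesgue \<and> (\<forall>K. compact K \<longrightarrow> set_integrable lebesgue K V)}"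

definition partial_deriv :: "'a::euclidean_space \<Rightarrow> ('a \<Rightarrow> complex) \<Rightarrow> 'a \<Rightarrow> complex" where
  "partial_deriv b f x = frechet_derivative f (at x) b"

primrec Ck :: "nat \<Rightarrow> ('a::euclidean_space \<Rightarrow> complex) \<Rightarrow> bool" where
  "Ck 0 f \<longleftrightarrow> continuous_on UNIV f"
| "Ck (Suc k) f \<longleftrightarrow> (\<forall>x. f differentiable (at x)) \<and> (\<forall>b\<in>Basis. Ck k (partial_deriv b f))"

definition test_functions :: "('a::euclidean_space \<Rightarrow> complex) set" where
  "test_functions = {\<phi>. (\<forall>k. Ck k \<phi>) \<and> compact (closure {x. \<phi> x \<noteq> 0})}"

definition is_weak_partial ::
    "'a::euclidean_space \<Rightarrow> ('a \<Rightarrow> complex) \<Rightarrow> ('a \<Rightarrow> complex) \<Rightarrow> bool" where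
  "is_weak_partial b u g \<longleftrightarrow>
     (\<forall>\<phi>\<in>test_functions.
        (LINT x|lebesgue. u x * partial_deriv b \<phi> x) = - (LINT x|lebesgue. g x * \<phi> x))"

definition H1 :: "('a::euclidean_space \<Rightarrow> complex) set" where
  "H1 = {u \<in> Lp 2. \<forall>b\<in>Basis. \<exists>g\<in>Lp 2. is_weak_partial b u g}"

text \<open>For \<open>u\<close> in \<open>H1\<close> the choice is unique up to null sets.\<close>

definition weak_partial :: "'a::euclidean_space \<Rightarrow> ('a \<Rightarrow> complex) \<Rightarrow> 'a \<Rightarrow> complex" where
  "weak_partial b u = (SOME g. g \<in> Lp 2 \<and> is_weak_partial b u g)"

definition form_domain :: "('a::euclidean_space \<Rightarrow> complex) \<Rightarrow> ('a \<Rightarrow> complex) set" where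
  "form_domain V = {u \<in> H1. (\<lambda>x. complex_of_real (sqrt (norm (V x))) * u x) \<in> Lp 2}"

definition schroedinger_form ::
    "('a::euclidean_space \<Rightarrow> complex) \<Rightarrow> ('a \<Rightarrow> complex) \<Rightarrow> ('a \<Rightarrow> complex) \<Rightarrow> complex" where
  "schroedinger_form V u v =
     (LINT x|lebesgue. (\<Sum>b\<in>Basis. weak_partial b u x * cnj (weak_partial b v x)))
     + (LINT x|lebesgue. complex_of_real (norm (V x)) * u x * cnj (v x))"

text \<open>
  The operator \<open>|V| - \<Delta>\<close> associated with the form, first as its graph: \<open>u\<close> in the form domain
  is mapped to the \<open>f\<close> in \<open>L\<^sup>2\<close> with \<open>q(u,v) = \<langle>f,v\<rangle>\<close> for all \<open>v\<close> in the form domain. For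
  \<open>V\<close> in \<open>L1_loc\<close> the form domain is dense in \<open>L\<^sup>2\<close>, so \<open>f\<close> is unique up to null sets.
\<close>

definition schroedinger_graph ::
    "('a::euclidean_space \<Rightarrow> complex) \<Rightarrow> ('a \<Rightarrow> complex) \<Rightarrow> ('a \<Rightarrow> complex) \<Rightarrow> bool" where
  "schroedinger_graph V u f \<longleftrightarrow>
     u \<in> form_domain V \<and> f \<in> Lp 2 \<and>
     (\<forall>v\<in>form_domain V. schroedinger_form V u v = (LINT x|lebesgue. f x * cnj (v x)))"

definition schroedinger_domain :: "('a::euclidean_space \<Rightarrow> complex) \<Rightarrow> ('a \<Rightarrow> complex) set" where
  "schroedinger_domain V = {u. \<exists>f. schroedinger_graph V u f}"

definition schroedinger_op ::
    "('a::euclidean_space \<Rightarrow> complex) \<Rightarrow> ('a \<Rightarrow> complex) \<Rightarrow> 'a \<Rightarrow> complex" where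
  "schroedinger_op V u = (SOME f. schroedinger_graph V u f)"

definition abs_mult :: "('a \<Rightarrow> complex) \<Rightarrow> ('a \<Rightarrow> complex) \<Rightarrow> 'a \<Rightarrow> complex" where
  "abs_mult V u = (\<lambda>x. complex_of_real (norm (V x)) * u x)"

definition abs_mult_domain :: "('a::euclidean_space \<Rightarrow> complex) \<Rightarrow> ('a \<Rightarrow> complex) set" where
  "abs_mult_domain V = {u \<in> Lp 2. abs_mult V u \<in> Lp 2}"

text \<open>The self-adjoint operator \<open>-\<Delta>\<close> is \<open>|V| - \<Delta>\<close> for \<open>V = 0\<close>.\<close>

abbreviation neg_laplacian_domain :: "('a::euclidean_space \<Rightarrow> complex) set" where
  "neg_laplacian_domain \<equiv> schroedinger_domain (\<lambda>_. 0)"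

abbreviation neg_laplacian :: "('a::euclidean_space \<Rightarrow> complex) \<Rightarrow> 'a \<Rightarrow> complex" where
  "neg_laplacian \<equiv> schroedinger_op (\<lambda>_. 0)"

text \<open>
  The operator \<open>|V| - \<Delta>\<close> is injective, so the denominator below is nonzero.
\<close>

definition W2_const :: "('a::euclidean_space \<Rightarrow> complex) \<Rightarrow> ennreal" where
  "W2_const V =
     (SUP u \<in> {u \<in> schroedinger_domain V. \<not> (AE x in lebesgue. u x = 0)}.
        ((if u \<in> abs_mult_domain V then ennreal (Lp_norm 2 (abs_mult V u)) else \<infinity>)
         + (if u \<in> neg_laplacian_domain then ennreal (Lp_norm 2 (neg_laplacian u)) else \<infinity>))
        / ennreal (Lp_norm 2 (schroedinger_op V u)))"

definition W2 :: "('a::euclidean_space \<Rightarrow> complex) set" where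
  "W2 = {V \<in> L1_loc. W2_const V < \<infinity>}"

end

theory Submission
  imports Defs
begin

text \<open>
  Write \<open>f = (|V| - \<Delta>) u\<close>. Testing the equation with truncations of \<open>u |u|\<^sup>2\<^sup>\<beta>\<close>,
  \<open>\<beta> = 2 / (n - 4)\<close>, the potential contributes a nonnegative term, and the Sobolev inequality
  applied to \<open>u |u|\<^sup>\<beta>\<close> gives \<open>\<parallel>u\<parallel>\<^sub>q \<le> C \<parallel>f\<parallel>\<^sub>2\<close> with \<open>q = 2 n / (n - 4)\<close> and \<open>C\<close> depending only on
  \<open>n\<close>. Since \<open>2 / n + 1 / q = 1 / 2\<close>, it follows that \<open>\<parallel>V u\<parallel>\<^sub>2\<close> is bounded by a multiple of
  \<open>\<parallel>f\<parallel>\<^sub>2\<close>, and then so is \<open>-\<Delta> u = f - |V| u\<close>. Weak derivatives are handled through the fundamental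
  theorem of calculus on almost every segment parallel to an axis, which replaces mollification
  both in the chain rule and in Gagliardo's proof of the Sobolev inequality.
\<close>

text \<open>The exponent \<beta> solves 2 (2 \<beta> + 1) = (\<beta> + 1) N with N = 2 n / (n - 2):
  the square of the test function and the N-th power of u |u|^\<beta> are then the same power of
  |u|. If A is the integral of the latter and F the L^2 norm of f, Sobolev and Cauchy-Schwarz give A
  <= (K sqrt (F sqrt A))^N. So A returns with the power N / 4, which is below 1 exactly for n > 4,
  and it can be divided out provided that A is finite beforehand. That is the obstacle: u |u|^(2
  \<beta>) need not lie in the form domain, nor need A be finite. Hence the factor |u|^2 is replaced
  by |u|^2 / (1 + e |u|^2). This cut-off is differentiable everywhere and yields Lipschitz functions
  of u, so truncations stay in H^1 and the chain rule never meets a kink; the final bound does not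
  depend on e, and Fatou's lemma removes it. The Sobolev inequality is obtained from Gagliardo's L^1
  bound by the same device. Since V lies in L^(n/2), the form domain is all of H^1, so every
  truncation is admissible.\<close>

section \<open>Test functions and the fundamental lemma of the calculus of variations\<close>

lemma partial_deriv_eq:
  "(f has_derivative D) (at x) \<Longrightarrow> partial_deriv b f x = D b"
  unfolding partial_deriv_def using frechet_derivative_at by metis

lemma Ck_Suc_imp_Ck: "Ck (Suc k) f \<Longrightarrow> Ck k f"
proof (induction k arbitrary: f)
  case 0
  then show ?case
    by (auto simp: continuous_on_eq_continuous_at differentiable_imp_continuous_within)
next
  case (Suc k)
  then show ?case by simp
qed

lemma Ck_const: "Ck k (\<lambda>_. c)"
proof (induction k arbitrary: c)
  case (Suc k)
  have "partial_deriv b (\<lambda>_. c) = (\<lambda>_. 0)" for b :: 'a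
    by (auto intro!: partial_deriv_eq[where D = "\<lambda>_. 0", simplified] derivative_eq_intros)
  with Suc show ?case by simp
qed simp

lemma Ck_add: "Ck k f \<Longrightarrow> Ck k g \<Longrightarrow> Ck k (\<lambda>x. f x + g x)"
proof (induction k arbitrary: f g)
  case 0
  then show ?case by (simp add: continuous_intros)
next
  case (Suc k)
  have "partial_deriv b (\<lambda>x. f x + g x) = (\<lambda>x. partial_deriv b f x + partial_deriv b g x)" for b
  proof
    fix x
    have "((\<lambda>x. f x + g x) has_derivative
        (\<lambda>h. frechet_derivative f (at x) h + frechet_derivative g (at x) h)) (at x)"
      using Suc.prems by (intro derivative_intros) (auto simp: frechet_derivative_works[symmetric])
    from partial_deriv_eq[OF this]
    show "partial_deriv b (\<lambda>x. f x + g x) x = partial_deriv b f x + partial_deriv b g x"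
      by (simp add: partial_deriv_def)
  qed
  with Suc show ?case by auto
qed

lemma Ck_mult: "Ck k f \<Longrightarrow> Ck k g \<Longrightarrow> Ck k (\<lambda>x. f x * g x)"
proof (induction k arbitrary: f g)
  case 0
  then show ?case by (simp add: continuous_intros)
next
  case (Suc k)
  have "partial_deriv b (\<lambda>x. f x * g x) = (\<lambda>x. f x * partial_deriv b g x + partial_deriv b f x * g x)" for b
  proof
    fix x
    have "((\<lambda>x. f x * g x) has_derivative
        (\<lambda>h. f x * frechet_derivative g (at x) h + frechet_derivative f (at x) h * g x)) (at x)"
      using Suc.prems by (intro derivative_intros) (auto simp: frechet_derivative_works[symmetric])
    from partial_deriv_eq[OF this]
    show "partial_deriv b (\<lambda>x. f x * g x) x = f x * partial_deriv b g x + partial_deriv b f x * g x"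
      by (simp add: partial_deriv_def)
  qed
  moreover have "Ck k f" "Ck k g"
    using Suc.prems Ck_Suc_imp_Ck by blast+
  ultimately show ?case using Suc by (auto intro!: Ck_add)
qed

lemma Ck_prod: "finite I \<Longrightarrow> (\<And>i. i \<in> I \<Longrightarrow> Ck k (f i)) \<Longrightarrow> Ck k (\<lambda>x. \<Prod>i\<in>I. f i x)"
  by (induction I rule: finite_induct) (auto intro: Ck_const Ck_mult)

section \<open>A smooth function vanishing on a half-line\<close>

lemma has_derivative_zero_at_zero:
  assumes "\<And>x. norm (F x) \<le> norm x * G x" and "(G \<longlongrightarrow> 0) (at 0)"
  shows "(F has_derivative (\<lambda>_. 0)) (at 0)"
proof -
  have F0: "F 0 = 0" using assms(1)[of 0] by simp
  have "((\<lambda>h. norm (F h) / norm h) \<longlongrightarrow> 0) (at 0)"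
  proof (rule tendsto_sandwich[OF _ _ tendsto_const assms(2)])
    show "\<forall>\<^sub>F h in at 0. norm (F h) / norm h \<le> G h"
      using assms(1) by (auto simp: eventually_at_filter field_simps)
  qed auto
  then show ?thesis
    by (simp add: has_derivative_at F0)
qed

text \<open>The index \<open>j\<close> closes the family under differentiation up to linear
  combinations, so smoothness of \<open>bump 0\<close> is one induction over all \<open>j\<close>
  together.\<close>

definition bump :: "nat \<Rightarrow> real \<Rightarrow> real" where
  "bump j t = (if t > 0 then exp (- (1 / t)) / t ^ j else 0)"

lemma bump_nonneg: "0 \<le> bump j t"
  by (simp add: bump_def)

text \<open>The term of order \<open>j + 2\<close> in the series of \<open>exp (1 / t)\<close> beats
  \<open>t ^ j\<close> and leaves two powers of \<open>t\<close>: one for continuity at the origin,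
  one more for the derivative zero there.\<close>

lemma bump_le_quadratic: "\<bar>bump j t\<bar> \<le> fact (j + 2) * t\<^sup>2"
proof (cases "t > 0")
  case True
  have "(1 / t) ^ (j + 2) / fact (j + 2) \<le> exp (1 / t)"
    using sum_le_suminf[OF summable_exp_generic[of "1 / t"], of "{j + 2}"] True
    by (simp add: exp_def scaleR_conv_of_real divide_inverse mult_ac)
  then have "exp (- (1 / t)) \<le> fact (j + 2) * t ^ (j + 2)"
    using True by (simp add: exp_minus power_divide divide_simps mult.commute del: fact_Suc add_2_eq_Suc')
  then show ?thesis
    using True by (simp add: bump_def divide_simps power_add mult_ac del: fact_Suc add_2_eq_Suc')
qed (simp add: bump_def)

lemma bump_has_derivative:
  "(bump j has_real_derivative bump (j + 2) t - real j * bump (j + 1) t) (at t)"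
proof -
  consider "t > 0" | "t < 0" | "t = 0" by linarith
  then show ?thesis
  proof cases
    case 1
    have "((\<lambda>t. exp (- (1 / t)) / t ^ j) has_real_derivative
       bump (j + 2) t - real j * bump (j + 1) t) (at t)"
      using 1 
      apply (auto intro!: derivative_eq_intros simp: bump_def)
      \<comment> \<open>The power rule produces the exponent \<open>j - 1\<close>, which is
        truncated at \<open>j = 0\<close>.\<close>
      apply (cases j) 
      apply (auto simp: field_simps power2_eq_square)
      done
    moreover have "\<forall>\<^sub>F s in nhds t. exp (- (1 / s)) / s ^ j = bump j s"
      using eventually_nhds_in_open[of "{0<..}" t] 1
      by (auto elim!: eventually_mono simp: bump_def)
    ultimately show ?thesis
      by (subst DERIV_cong_ev[OF refl _ refl, of _ "\<lambda>t. exp (- (1 / t)) / t ^ j"])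
         (auto elim: eventually_mono)
  next
    case 2
    have "\<forall>\<^sub>F s in nhds t. bump j s = 0"
      using eventually_nhds_in_open[of "{..<0}" t] 2
      by (auto elim!: eventually_mono simp: bump_def)
    with 2 show ?thesis
      by (subst DERIV_cong_ev[OF refl _ refl, of _ "\<lambda>_. 0"]) (auto simp: bump_def)
  next
    case 3
    have "(bump j has_derivative (\<lambda>_. 0)) (at 0)"
    proof (rule has_derivative_zero_at_zero)
      show "norm (bump j x) \<le> norm x * (fact (j + 2) * \<bar>x\<bar>)" for x
        using bump_le_quadratic[of j x]
      by (simp add: power2_eq_square mult.left_commute[of "\<bar>x\<bar>"] del: fact_Suc add_2_eq_Suc' flip: abs_mult)
      show "((\<lambda>x::real. fact (j + 2) * \<bar>x\<bar>) \<longlongrightarrow> 0) (at 0)"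
        by (auto intro!: tendsto_eq_intros)
    qed
    then show ?thesis using 3
      by (simp add: has_field_derivative_def bump_def lambda_zero)
  qed
qed

lemma Ck_bump: "Ck k (\<lambda>x. complex_of_real (bump j (m * (x \<bullet> b) + c)))"
proof (induction k arbitrary: j)
  case 0
  have "continuous_on UNIV (bump j)"
    using bump_has_derivative by (auto simp: continuous_on_eq_continuous_at intro: DERIV_isCont)
  then have "continuous_on UNIV (\<lambda>x. bump j (m * (x \<bullet> b) + c))"
    by (rule continuous_on_compose2) (auto intro!: continuous_intros)
  then show ?case by (simp add: continuous_intros)
next
  case (Suc k)
  let ?f = "\<lambda>j x. complex_of_real (bump j (m * (x \<bullet> b) + c))"
  have D: "(?f j has_derivative
      (\<lambda>h. complex_of_real ((m * (h \<bullet> b)) * (bump (j + 2) (m * (x \<bullet> b) + c) - real j * bump (j + 1) (m * (x \<bullet> b) + c))))) (at x)" for x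
    by (auto intro!: derivative_eq_intros has_derivative_compose[OF _ bump_has_derivative[unfolded has_field_derivative_def]]
       simp: mult_ac)
  have "partial_deriv d (?f j) = (\<lambda>x. of_real (m * (d \<bullet> b)) * ?f (Suc (Suc j)) x + of_real (- m * (d \<bullet> b) * j) * ?f (Suc j) x)" for d
    by (rule ext, subst partial_deriv_eq[OF D]) (simp add: algebra_simps)
  moreover have "Ck k (\<lambda>x. of_real (m * (d \<bullet> b)) * ?f (Suc (Suc j)) x + of_real (- m * (d \<bullet> b) * j) * ?f (Suc j) x)" for d
    by (intro Ck_add Ck_mult Ck_const Suc.IH)
  ultimately show ?case
    using D by (auto simp: differentiable_def simp del: of_real_mult)
qed

section \<open>Support, bounds, derivatives and translates of test functions\<close>

lemma test_function_continuous:
  assumes "\<phi> \<in> test_functions"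
  shows "continuous_on UNIV \<phi>"
proof -
  have "Ck 0 \<phi>" using assms by (simp only: test_functions_def mem_Collect_eq)
  then show ?thesis by (simp only: Ck.simps)
qed

lemma test_function_measurable: "\<phi> \<in> test_functions \<Longrightarrow> \<phi> \<in> borel_measurable borel"
  by (intro borel_measurable_continuous_onI test_function_continuous)

lemma test_function_has_derivative:
  assumes "\<phi> \<in> test_functions"
  shows "(\<phi> has_derivative frechet_derivative \<phi> (at x)) (at x)"
proof -
  have "Ck (Suc 0) \<phi>" using assms by (simp only: test_functions_def mem_Collect_eq)
  then show ?thesis by (simp add: frechet_derivative_works[symmetric])
qed

lemma test_function_support:
  assumes "\<phi> \<in> test_functions"
  obtains R where "R > 0" "\<And>x. norm x \<ge> R \<Longrightarrow> \<phi> x = 0"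
proof -
  have "bounded (closure {x. \<phi> x \<noteq> 0})"
    using assms by (auto simp: test_functions_def compact_imp_bounded)
  then have "bounded {x. \<phi> x \<noteq> 0}"
    by (rule bounded_subset) (rule closure_subset)
  then obtain R where R: "R > 0" "\<And>x. \<phi> x \<noteq> 0 \<Longrightarrow> norm x < R"
    unfolding bounded_pos_less by blast
  show ?thesis
    by (rule that[of R]) (use R in \<open>auto simp: not_less[symmetric]\<close>)
qed

lemma test_function_bounded:
  assumes "\<phi> \<in> test_functions"
  obtains M where "M > 0" "\<And>x. norm (\<phi> x) \<le> M"
proof -
  obtain R where R: "\<And>x. norm x \<ge> R \<Longrightarrow> \<phi> x = 0"
    using test_function_support[OF assms] by blast
  have "bounded (\<phi> ` cball 0 R)"
    using test_function_continuous[OF assms] continuous_on_subset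
    by (intro compact_imp_bounded compact_continuous_image) auto
  then obtain M where "M > 0" "\<And>x. norm x \<le> R \<Longrightarrow> norm (\<phi> x) \<le> M"
    by (auto simp: bounded_pos)
  moreover have "norm (\<phi> x) \<le> M" for x
    using calculation R[of x] by (cases "norm x \<le> R") auto
  ultimately show ?thesis using that by blast
qed

lemma test_function_partial_deriv:
  assumes "\<phi> \<in> test_functions" "b \<in> Basis"
  shows "partial_deriv b \<phi> \<in> test_functions"
proof -
  have "Ck (Suc k) \<phi>" for k using assms(1) by (simp only: test_functions_def mem_Collect_eq)
  then have C: "Ck k (partial_deriv b \<phi>)" for k using assms(2) by simp
  have "{x. partial_deriv b \<phi> x \<noteq> 0} \<subseteq> closure {x. \<phi> x \<noteq> 0}"
  proof (rule subsetI, rule ccontr)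
    fix x assume *: "x \<in> {x. partial_deriv b \<phi> x \<noteq> 0}" and **: "x \<notin> closure {x. \<phi> x \<noteq> 0}"
    have "((\<lambda>_. 0::complex) has_derivative (\<lambda>_. 0)) (at x)" by simp
    then have "(\<phi> has_derivative (\<lambda>_. 0)) (at x)"
    proof (rule has_derivative_transform_within_open)
      show "open (- closure {x. \<phi> x \<noteq> 0})" "x \<in> - closure {x. \<phi> x \<noteq> 0}"
        using ** by auto
      show "0 = \<phi> y" if "y \<in> - closure {x. \<phi> x \<noteq> 0}" for y
        using that closure_subset[of "{x. \<phi> x \<noteq> 0}"] by auto
    qed
    then have "partial_deriv b \<phi> x = 0"
      by (rule partial_deriv_eq)
    with * show False by simp
  qed
  then have "closure {x. partial_deriv b \<phi> x \<noteq> 0} \<subseteq> closure {x. \<phi> x \<noteq> 0}"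
    by (rule closure_minimal) simp
  moreover have "compact (closure {x. \<phi> x \<noteq> 0})"
    using assms(1) by (simp add: test_functions_def)
  ultimately have "compact (closure {x. partial_deriv b \<phi> x \<noteq> 0})"
    using compact_Int_closed[of "closure {x. \<phi> x \<noteq> 0}" "closure {x. partial_deriv b \<phi> x \<noteq> 0}"]
    by (simp only: closed_closure inf.absorb2)
  with C show ?thesis by (simp add: test_functions_def)
qed

lemma Ck_translate: "Ck k f \<Longrightarrow> Ck k (\<lambda>x. f (x - a))"
proof (induction k arbitrary: f)
  case 0
  then show ?case
    by (auto intro!: continuous_on_compose2[of UNIV f] continuous_intros)
next
  case (Suc k)
  have D: "((\<lambda>x. f (x - a)) has_derivative frechet_derivative f (at (x - a))) (at x)" for x
    using Suc.prems
    by (intro has_derivative_compose[of "\<lambda>x. x - a" "\<lambda>h. h" x UNIV f])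
       (auto simp: frechet_derivative_works[symmetric] intro!: derivative_eq_intros)
  have "partial_deriv b (\<lambda>x. f (x - a)) = (\<lambda>x. partial_deriv b f (x - a))" for b
    using partial_deriv_eq[OF D] by (auto simp: partial_deriv_def[of _ f])
  with Suc D show ?case by (auto simp: differentiable_def)
qed

lemma test_function_translate:
  assumes "\<phi> \<in> test_functions"
  shows "(\<lambda>x. \<phi> (x - a)) \<in> test_functions"
    and "partial_deriv b (\<lambda>x. \<phi> (x - a)) = (\<lambda>x. partial_deriv b \<phi> (x - a))"
proof -
  obtain R where R: "\<And>x. norm x \<ge> R \<Longrightarrow> \<phi> x = 0"
    using test_function_support[OF assms] by blast
  have "{x. \<phi> (x - a) \<noteq> 0} \<subseteq> cball a R"
    using R by (force simp: dist_norm norm_minus_commute)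
  then have "bounded {x. \<phi> (x - a) \<noteq> 0}"
    using bounded_cball bounded_subset by blast
  then show "(\<lambda>x. \<phi> (x - a)) \<in> test_functions"
    using assms by (auto simp: test_functions_def Ck_translate)
  have D: "((\<lambda>x. \<phi> (x - a)) has_derivative frechet_derivative \<phi> (at (x - a))) (at x)" for x
    by (intro has_derivative_compose[of "\<lambda>x. x - a" "\<lambda>h. h" x UNIV \<phi>]
        test_function_has_derivative[OF assms]) (auto intro!: derivative_eq_intros)
  show "partial_deriv b (\<lambda>x. \<phi> (x - a)) = (\<lambda>x. partial_deriv b \<phi> (x - a))"
    using partial_deriv_eq[OF D] by (auto simp: partial_deriv_def[of _ \<phi>])
qed

text \<open>Each coordinate carries one bump per face of the box. For y > 0,
  \<open>bump 0 (m * y)\<close> tends to 1 as \<open>m\<close> grows, so these test functions tend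
  to the indicator of the open box, and boxes are reached without convolution. The arguments are
  spelled so as to match \<open>Ck_bump\<close>.\<close>

definition box_bump :: "'a::euclidean_space \<Rightarrow> 'a \<Rightarrow> real \<Rightarrow> 'a \<Rightarrow> complex" where
  "box_bump a c m x = (\<Prod>b\<in>Basis. complex_of_real (bump 0 (m * (x \<bullet> b) + - m * (a \<bullet> b)))
     * complex_of_real (bump 0 (- m * (x \<bullet> b) + m * (c \<bullet> b))))"

lemma box_bump_eq_0: "m > 0 \<Longrightarrow> x \<notin> box a c \<Longrightarrow> box_bump a c m x = 0"
  by (fastforce simp: box_bump_def box_def bump_def prod_zero_iff)

lemma box_bump_test_function: "m > 0 \<Longrightarrow> box_bump a c m \<in> test_functions"
proof -
  assume m: "m > 0"
  have "Ck k (box_bump a c m)" for k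
    unfolding box_bump_def by (intro Ck_prod Ck_mult Ck_bump) auto
  moreover have "{x. box_bump a c m x \<noteq> 0} \<subseteq> box a c"
    using box_bump_eq_0[OF m] by blast
  ultimately show ?thesis
    using bounded_subset[OF bounded_box] by (auto simp: test_functions_def)
qed

lemma box_bump_real: "box_bump a c m x \<in> \<real>"
  by (auto simp: box_bump_def intro!: prod_in_Reals)

lemma norm_box_bump_le: "norm (box_bump a c m x) \<le> 1"
proof -
  have "bump 0 t \<le> 1" for t by (simp add: bump_def)
  then show ?thesis
    unfolding box_bump_def prod_norm[symmetric] norm_mult
    by (intro prod_le_1) (auto simp: bump_nonneg intro!: mult_le_one)
qed

lemma box_bump_tendsto: "(\<lambda>k. box_bump a c (real (Suc k)) x) \<longlonglongrightarrow> indicator (box a c) x"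
proof (cases "x \<in> box a c")
  case True
  have *: "(\<lambda>k. complex_of_real (bump 0 (real (Suc k) * y))) \<longlonglongrightarrow> 1" if "y > 0" for y
  proof -
    have "(\<lambda>k. exp (- (1 / y) * (1 / real (Suc k)))) \<longlonglongrightarrow> exp (- (1 / y) * 0)"
      by (intro tendsto_intros LIMSEQ_Suc lim_1_over_n)
    also have "(\<lambda>k. exp (- (1 / y) * (1 / real (Suc k)))) = (\<lambda>k. bump 0 (real (Suc k) * y))"
      using that by (simp add: bump_def fun_eq_iff divide_simps add_pos_nonneg)
    finally show ?thesis
      using tendsto_of_real by fastforce
  qed
  have "(\<lambda>k. \<Prod>b\<in>Basis. complex_of_real (bump 0 (real (Suc k) * (x \<bullet> b - a \<bullet> b)))
     * complex_of_real (bump 0 (real (Suc k) * (c \<bullet> b - x \<bullet> b)))) \<longlonglongrightarrow> (\<Prod>b\<in>(Basis::'a set). 1 * 1)"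
    using True by (intro tendsto_intros *) (auto simp: box_def)
  with True show ?thesis by (simp add: box_bump_def right_diff_distrib algebra_simps)
next
  case False
  then show ?thesis by (simp add: box_bump_eq_0)
qed

text \<open>Borel measurability is required, rather than Lebesgue measurability, so that
  \<open>g (x + s *\<^sub>R b)\<close> is jointly measurable in \<open>x\<close> and
  \<open>s\<close> and Fubini's theorem applies.\<close>

definition locally_integrable :: "('a::euclidean_space \<Rightarrow> complex) \<Rightarrow> bool" where
  "locally_integrable f \<longleftrightarrow> f \<in> borel_measurable borel \<and>
     (\<forall>R. integrable lborel (\<lambda>x. indicator (cball 0 R) x *\<^sub>R f x))"

lemma locally_integrable_mult:
  assumes f: "locally_integrable f" and [measurable]: "\<phi> \<in> borel_measurable borel"
    and M: "\<And>x. norm (\<phi> x) \<le> M" and R: "\<And>x. norm x \<ge> R \<Longrightarrow> \<phi> x = 0"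
  shows "integrable lborel (\<lambda>x. f x * \<phi> x)"
proof (rule Bochner_Integration.integrable_bound)
  show "integrable lborel (\<lambda>x. M *\<^sub>R (indicator (cball 0 R) x *\<^sub>R f x))"
    using f by (intro integrable_scaleR_right) (auto simp: locally_integrable_def)
  show "(\<lambda>x. f x * \<phi> x) \<in> borel_measurable lborel"
    using f by (auto simp: locally_integrable_def)
  have "M \<ge> 0" using M[of 0] norm_ge_zero order_trans by blast
  then have "norm (f x * \<phi> x) \<le> norm (M *\<^sub>R (indicator (cball 0 R) x *\<^sub>R f x))" for x
    using M[of x] R[of x] by (cases "norm x \<le> R") (auto simp: norm_mult mult.commute[of "cmod (f x)"] intro: mult_right_mono)
  then show "AE x in lborel. norm (f x * \<phi> x) \<le> norm (M *\<^sub>R (indicator (cball 0 R) x *\<^sub>R f x))"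
    by simp
qed

lemma integral_box_eq_0:
  assumes f: "locally_integrable f"
    and 0: "\<And>\<phi>. \<phi> \<in> test_functions \<Longrightarrow> (\<And>x. \<phi> x \<in> \<real>) \<Longrightarrow> (LINT x|lborel. f x * \<phi> x) = 0"
  shows "(LINT x|lborel. f x * indicator (box a c) x) = 0"
proof -
  have [measurable]: "f \<in> borel_measurable borel" using f by (simp add: locally_integrable_def)
  obtain R where R: "box a c \<subseteq> cball 0 R"
    using bounded_iff[of "box a c"] bounded_box by (fastforce simp: subset_eq)
  have "(\<lambda>k. LINT x|lborel. f x * box_bump a c (real (Suc k)) x) \<longlonglongrightarrow> (LINT x|lborel. f x * indicator (box a c) x)"
  proof (rule integral_dominated_convergence)
    show "integrable lborel (\<lambda>x. norm (indicator (cball 0 R) x *\<^sub>R f x))"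
      using f by (intro integrable_norm) (simp add: locally_integrable_def)
    show "AE x in lborel. (\<lambda>k. f x * box_bump a c (real (Suc k)) x) \<longlonglongrightarrow> f x * indicator (box a c) x"
      by (intro AE_I2 tendsto_mult_left box_bump_tendsto)
    show "AE x in lborel. norm (f x * box_bump a c (real (Suc k)) x) \<le> norm (indicator (cball 0 R) x *\<^sub>R f x)" for k
    proof (rule AE_I2)
      fix x show "norm (f x * box_bump a c (real (Suc k)) x) \<le> norm (indicator (cball 0 R) x *\<^sub>R f x)"
        using norm_box_bump_le[of a c "real (Suc k)" x] box_bump_eq_0[of "real (Suc k)" x a c] R
        by (cases "x \<in> box a c") (auto simp: norm_mult mult_left_le indicator_def)
    qed
    show "(\<lambda>x. f x * box_bump a c (real (Suc k)) x) \<in> borel_measurable lborel" for k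
      using test_function_measurable[OF box_bump_test_function[of "real (Suc k)" a c]] by measurable
  qed measurable
  moreover have "(LINT x|lborel. f x * box_bump a c (real (Suc k)) x) = 0" for k
    by (intro 0 box_bump_test_function box_bump_real) simp
  ultimately show ?thesis by (simp add: LIMSEQ_const_iff)
qed

text \<open>Boxes are an intersection-stable generator of the Borel sets. The integral of
  \<open>f\<close> vanishes over every box by \<open>integral_box_eq_0\<close>, hence over every
  bounded Borel set by Dynkin's argument. Asking only for real test functions lets the lemma serve
  pairings with a complex conjugate as well.\<close>

lemma fundamental_lemma:
  fixes f :: "'a::euclidean_space \<Rightarrow> complex"
  assumes f: "locally_integrable f"
    and 0: "\<And>\<phi>. \<phi> \<in> test_functions \<Longrightarrow> (\<And>x. \<phi> x \<in> \<real>) \<Longrightarrow> (LINT x|lborel. f x * \<phi> x) = 0"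
  shows "AE x in lborel. f x = 0"
proof -
  have [measurable]: "f \<in> borel_measurable borel" using f by (simp add: locally_integrable_def)
  have ind: "indicator A x *\<^sub>R z = z * (indicator A x :: complex)" for A :: "'a set" and x z
    by (simp add: indicator_def)
  \<comment> \<open>The cut-off makes \<open>f\<close> integrable on the whole space, as the
    complement and union steps require, and it is compatible with the generator because boxes
    intersect in boxes.\<close>
  define B where "B k = box (- (real k *\<^sub>R One)) (real k *\<^sub>R One :: 'a)" for k
  have [measurable]: "B k \<in> sets borel" for k by (simp add: B_def)
  have Int: "Int_stable (range (\<lambda>(a, b). box a b :: 'a set))"
    by (auto simp: Int_stable_def box_Int_box)
  have sig: "sets borel = sigma_sets UNIV (range (\<lambda>(a, b). box a b :: 'a set))"
    by (subst borel_eq_box) simp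
  have "AE x in lborel. f x * indicator (B k) x = 0" for k
  proof (rule sigma_finite_measure.density_zero[OF sigma_finite_lborel])
    obtain R where R: "B k \<subseteq> cball 0 R"
      using bounded_iff[of "B k"] bounded_box by (fastforce simp: subset_eq B_def)
    show int: "integrable lborel (\<lambda>x. f x * indicator (B k) x)"
      by (rule locally_integrable_mult[OF f, where R = "R + 1" and M = 1])
         (use R in \<open>auto simp: indicator_def\<close>)
    have intA: "integrable lborel (\<lambda>x. f x * indicator (B k) x * indicator A x)" if "A \<in> sets borel" for A
      using that by (intro Bochner_Integration.integrable_bound[OF int]) (auto simp: indicator_def)
    fix A :: "'a set" assume "A \<in> sets lborel"
    then have A: "A \<in> sigma_sets UNIV (range (\<lambda>(a, b). box a b :: 'a set))" by (simp add: sig)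
    have "range (\<lambda>(a, b). box a b :: 'a set) \<subseteq> Pow UNIV" by simp
    from Int this A have "(LINT x|lborel. f x * indicator (B k) x * indicator A x) = 0"
    proof (induction A rule: sigma_sets_induct_disjoint)
      case (basic A)
      then obtain a b where "A = box a b" by auto
      moreover obtain c d where "B k \<inter> box a b = box c d"
        unfolding B_def box_Int_box by blast
      ultimately have "indicator (B k) x * indicator A x = (indicator (box c d) x :: complex)" for x
        by (metis indicator_inter_arith)
      then show ?case
        using integral_box_eq_0[OF f 0, of c d] by (simp add: mult.assoc)
    next
      case (compl A)
      have "(LINT x|lborel. f x * indicator (B k) x * indicator (UNIV - A) x)
         = (LINT x|lborel. f x * indicator (B k) x - f x * indicator (B k) x * indicator A x)"
        by (intro Bochner_Integration.integral_cong) (auto simp: indicator_def)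
      also have "\<dots> = (LINT x|lborel. f x * indicator (B k) x)"
        using compl intA int by (subst Bochner_Integration.integral_diff) (auto simp: sig)
      finally show ?case
        using integral_box_eq_0[OF f 0] by (simp add: B_def)
    next
      case (union A)
      have A: "A i \<in> sets lborel" for i using union by (auto simp: sig)
      have "(LINT x:(\<Union>i. A i)|lborel. f x * indicator (B k) x) = (\<Sum>i. (LINT x:A i|lborel. f x * indicator (B k) x))"
        using union A intA[of "\<Union>i. A i"]
        by (intro lebesgue_integral_countable_add)
           (auto simp: disjoint_family_on_def set_integrable_def ind sets.countable_UN)
      also have "\<dots> = 0"
        using union by (simp add: set_lebesgue_integral_def ind)
      finally show ?case
        by (simp add: set_lebesgue_integral_def ind)
    qed auto
    then show "(LINT x:A|lborel. f x * indicator (B k) x) = 0"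
      by (simp add: set_lebesgue_integral_def ind)
  qed
  then have "AE x in lborel. \<forall>k. f x * indicator (B k) x = 0"
    by (intro AE_all_countable[THEN iffD2] allI)
  then show ?thesis
  proof eventually_elim
    case (elim x)
    have "x \<in> (\<Union>k. B k)"
      unfolding B_def by (simp only: UN_box_eq_UNIV UNIV_I)
    then obtain k where "x \<in> B k" by blast
    with elim[rule_format, of k] show ?case by simp
  qed
qed

section \<open>Weak derivatives on segments\<close>

lemma cball_in_borel [measurable]: "cball a R \<in> sets borel"
  by simp

lemma nn_integral_lborel_translate:
  assumes [measurable]: "f \<in> borel_measurable borel"
  shows "(\<integral>\<^sup>+x. f (x + a) \<partial>lborel) = (\<integral>\<^sup>+x. f (x :: 'a::euclidean_space) \<partial>lborel)"
  by (subst lborel_distr_plus[of a, symmetric]) (simp add: nn_integral_distr add.commute)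

lemma integral_lborel_translate:
  fixes f :: "'a::euclidean_space \<Rightarrow> 'b::{banach, second_countable_topology}"
  assumes [measurable]: "f \<in> borel_measurable borel"
  shows "(LINT x|lborel. f (x + a)) = (LINT x|lborel. f x)"
  by (subst (2) lborel_distr_plus[of a, symmetric]) (simp add: integral_distr add.commute)

lemma integrable_lborel_translate:
  fixes f :: "'a::euclidean_space \<Rightarrow> 'b::{banach, second_countable_topology}"
  assumes "integrable lborel f"
  shows "integrable lborel (\<lambda>x. f (x + a))"
proof -
  have [measurable]: "f \<in> borel_measurable borel" using assms by auto
  have "integrable (distr lborel borel ((+) a)) f" using assms by (simp add: lborel_distr_plus)
  then show ?thesis by (simp add: integrable_distr_eq add.commute)
qed

lemma locally_integrable_measurable [measurable_dest]:
  "locally_integrable f \<Longrightarrow> f \<in> borel_measurable borel"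
  by (simp add: locally_integrable_def)

lemma locally_integrable_integrable:
  "locally_integrable f \<Longrightarrow> integrable lborel (\<lambda>x. indicator (cball 0 R) x *\<^sub>R f x)"
  by (simp add: locally_integrable_def)

lemma locally_integrable_diff:
  "locally_integrable f \<Longrightarrow> locally_integrable g \<Longrightarrow> locally_integrable (\<lambda>x. f x - g x)"
  by (auto simp: locally_integrable_def scaleR_right_diff_distrib)

lemma locally_integrable_translate:
  assumes "locally_integrable f"
  shows "locally_integrable (\<lambda>x. f (x + a))"
  unfolding locally_integrable_def
proof safe
  note [measurable] = locally_integrable_measurable[OF assms]
  show "(\<lambda>x. f (x + a)) \<in> borel_measurable borel" by measurable
  fix R
  show "integrable lborel (\<lambda>x. indicator (cball 0 R) x *\<^sub>R f (x + a))"
  proof (rule Bochner_Integration.integrable_bound)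
    show "integrable lborel (\<lambda>x. indicator (cball 0 (R + norm a)) (x + a) *\<^sub>R f (x + a))"
      by (intro integrable_lborel_translate locally_integrable_integrable assms)
    have "norm (x + a) \<le> R + norm a" if "norm x \<le> R" for x
      using norm_triangle_ineq[of x a] that by linarith
    then show "AE x in lborel. norm (indicator (cball 0 R) x *\<^sub>R f (x + a))
        \<le> norm (indicator (cball 0 (R + norm a)) (x + a) *\<^sub>R f (x + a))"
      by (auto simp: indicator_def)
  qed measurable
qed

text \<open>Integrate in \<open>x\<close> first: for fixed \<open>s\<close>, translation bounds the
  slice by the integral of |g| over the ball of radius \<open>R + h\<close>, because the shift has
  length at most \<open>h\<close>.\<close>

lemma integrable_segments:
  fixes g :: "'a::euclidean_space \<Rightarrow> complex"
  assumes g: "locally_integrable g" and b: "norm b \<le> 1" and h: "h \<ge> 0"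
  shows "integrable (lborel \<Otimes>\<^sub>M lborel)
    (\<lambda>(x, s). indicator (cball 0 R) x *\<^sub>R indicator {0..h} s *\<^sub>R g (x + s *\<^sub>R b))"
proof (rule integrableI_bounded)
  note [measurable] = locally_integrable_measurable[OF g]
  show "(\<lambda>(x, s). indicator (cball 0 R) x *\<^sub>R indicator {0..h} s *\<^sub>R g (x + s *\<^sub>R b))
      \<in> borel_measurable (lborel \<Otimes>\<^sub>M lborel)" by measurable
  define C where "C = (\<integral>\<^sup>+x. norm (indicator (cball 0 (R + h)) x *\<^sub>R g x) \<partial>lborel)"
  have C: "C < \<infinity>"
    using locally_integrable_integrable[OF g, of "R + h"] unfolding C_def integrable_iff_bounded by blast
  have *: "(\<integral>\<^sup>+x. norm (indicator (cball 0 R) x *\<^sub>R indicator {0..h} s *\<^sub>R g (x + s *\<^sub>R b)) \<partial>lborel)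
    \<le> C * indicator {0..h} s" for s
  proof (cases "s \<in> {0..h}")
    case True
    have "norm (x + s *\<^sub>R b) \<le> R + h" if "norm x \<le> R" for x
    proof -
      have "norm (x + s *\<^sub>R b) \<le> norm x + s * norm b"
        using norm_triangle_ineq[of x "s *\<^sub>R b"] True by simp
      also have "s * norm b \<le> h * 1" using True b h by (intro mult_mono) auto
      finally show ?thesis using that by simp
    qed
    then have "(\<integral>\<^sup>+x. norm (indicator (cball 0 R) x *\<^sub>R indicator {0..h} s *\<^sub>R g (x + s *\<^sub>R b)) \<partial>lborel)
      \<le> (\<integral>\<^sup>+x. norm (indicator (cball 0 (R + h)) (x + s *\<^sub>R b) *\<^sub>R g (x + s *\<^sub>R b)) \<partial>lborel)"
      using True by (intro nn_integral_mono) (auto simp: indicator_def)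
    also have "\<dots> = C"
      unfolding C_def by (subst nn_integral_lborel_translate[of "\<lambda>x. ennreal (norm (indicator (cball 0 (R + h)) x *\<^sub>R g x))"]) auto
    finally show ?thesis using True by simp
  qed simp
  have "(\<integral>\<^sup>+z. norm (case z of (x, s) \<Rightarrow> indicator (cball 0 R) x *\<^sub>R indicator {0..h} s *\<^sub>R g (x + s *\<^sub>R b))
      \<partial>(lborel \<Otimes>\<^sub>M lborel))
    = (\<integral>\<^sup>+s. \<integral>\<^sup>+x. norm (indicator (cball 0 R) x *\<^sub>R indicator {0..h} s *\<^sub>R g (x + s *\<^sub>R b)) \<partial>lborel \<partial>lborel)"
    by (subst lborel_pair.nn_integral_snd[symmetric]) (auto simp: case_prod_beta)
  also have "\<dots> \<le> (\<integral>\<^sup>+s. C * indicator {0..h} s \<partial>lborel)"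
    by (intro nn_integral_mono *)
  also have "\<dots> = C * h" using h by (simp add: nn_integral_cmult)
  also have "\<dots> < \<infinity>" using C by (simp add: ennreal_mult_less_top)
  finally show "(\<integral>\<^sup>+z. norm (case z of (x, s) \<Rightarrow> indicator (cball 0 R) x *\<^sub>R indicator {0..h} s *\<^sub>R g (x + s *\<^sub>R b))
      \<partial>(lborel \<Otimes>\<^sub>M lborel)) < \<infinity>" .
qed

definition segment_integral :: "real \<Rightarrow> 'a::euclidean_space \<Rightarrow> ('a \<Rightarrow> complex) \<Rightarrow> 'a \<Rightarrow> complex" where
  "segment_integral h b g x = (LINT s|lborel. indicator {0..h} s *\<^sub>R g (x + s *\<^sub>R b))"

lemma segment_integral_measurable [measurable]:
  assumes [measurable]: "g \<in> borel_measurable borel"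
  shows "segment_integral h b g \<in> borel_measurable borel"
  unfolding segment_integral_def by measurable

lemma locally_integrable_segment_integral:
  assumes g: "locally_integrable g" and b: "norm b \<le> 1" and h: "h \<ge> 0"
  shows "locally_integrable (segment_integral h b g)"
  unfolding locally_integrable_def
proof safe
  note [measurable] = locally_integrable_measurable[OF g]
  show "segment_integral h b g \<in> borel_measurable borel" by measurable
  fix R
  have "integrable lborel (\<lambda>x. LINT s|lborel. indicator (cball 0 R) x *\<^sub>R indicator {0..h} s *\<^sub>R g (x + s *\<^sub>R b))"
    using lborel_pair.integrable_fst'[OF integrable_segments[OF assms]] by simp
  then show "integrable lborel (\<lambda>x. indicator (cball 0 R) x *\<^sub>R segment_integral h b g x)"
    by (simp add: segment_integral_def flip: scaleR_scaleR)
qed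

lemma AE_integrable_segment:
  assumes g: "locally_integrable g" and b: "norm b \<le> 1" and h: "h \<ge> 0"
  shows "AE x in lborel. integrable lborel (\<lambda>s. indicator {0..h} s *\<^sub>R g (x + s *\<^sub>R b))"
proof -
  have "AE x in lborel. \<forall>k::nat. integrable lborel
      (\<lambda>s. indicator (cball 0 (real k)) x *\<^sub>R indicator {0..h} s *\<^sub>R g (x + s *\<^sub>R b))"
    unfolding AE_all_countable
    using lborel_pair.AE_integrable_fst'[OF integrable_segments[OF assms]] by simp
  then show ?thesis
  proof eventually_elim
    case (elim x)
    obtain k :: nat where "norm x \<le> real k" using real_arch_simple by blast
    with elim[rule_format, of k] show ?case by simp
  qed
qed

text \<open>The counterpart of \<open>is_weak_partial\<close> for Borel representatives and
  \<open>lborel\<close>; \<open>is_weak_partial_iff\<close> translates between the two.\<close>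

definition has_weak_partial ::
    "'a::euclidean_space \<Rightarrow> ('a \<Rightarrow> complex) \<Rightarrow> ('a \<Rightarrow> complex) \<Rightarrow> bool" where
  "has_weak_partial b u g \<longleftrightarrow>
     (\<forall>\<phi>\<in>test_functions.
        (LINT x|lborel. u x * partial_deriv b \<phi> x) = - (LINT x|lborel. g x * \<phi> x))"

lemma integrable_test_function:
  assumes "locally_integrable f" "\<phi> \<in> test_functions"
  shows "integrable lborel (\<lambda>x. f x * \<phi> x)"
proof -
  obtain R where "\<And>x. norm x \<ge> R \<Longrightarrow> \<phi> x = 0"
    using test_function_support[OF assms(2)] by blast
  moreover obtain M where "\<And>x. norm (\<phi> x) \<le> M"
    using test_function_bounded[OF assms(2)] by blast
  ultimately show ?thesis
    using locally_integrable_mult[OF assms(1) test_function_measurable[OF assms(2)]] by blast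
qed

lemma test_function_has_vector_derivative:
  assumes \<phi>: "\<phi> \<in> test_functions"
  shows "((\<lambda>s. \<phi> (x - s *\<^sub>R b)) has_vector_derivative - partial_deriv b \<phi> (x - s *\<^sub>R b)) (at s within S)"
proof -
  have "((\<lambda>s. \<phi> (x - s *\<^sub>R b)) has_derivative
     (\<lambda>t. frechet_derivative \<phi> (at (x - s *\<^sub>R b)) (- (t *\<^sub>R b)))) (at s within S)"
    by (rule has_derivative_compose[OF _ test_function_has_derivative[OF \<phi>]])
       (auto intro!: derivative_eq_intros)
  moreover have "frechet_derivative \<phi> (at (x - s *\<^sub>R b)) (- (t *\<^sub>R b))
     = t *\<^sub>R (- partial_deriv b \<phi> (x - s *\<^sub>R b))" for t
    using has_derivative_linear[OF test_function_has_derivative[OF \<phi>, of "x - s *\<^sub>R b"]]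
    by (simp add: linear_neg linear_scale partial_deriv_def)
  ultimately show ?thesis by (simp add: has_vector_derivative_def)
qed

lemma test_function_segment:
  assumes \<phi>: "\<phi> \<in> test_functions" and b: "b \<in> Basis" and h: "h \<ge> 0"
  shows "\<phi> (x - h *\<^sub>R b) - \<phi> x = - (LINT s|lborel. indicator {0..h} s *\<^sub>R partial_deriv b \<phi> (x - s *\<^sub>R b))"
proof -
  have D: "((\<lambda>s. \<phi> (x - s *\<^sub>R b)) has_vector_derivative - partial_deriv b \<phi> (x - s *\<^sub>R b)) (at s within S)" for s S
    by (rule test_function_has_vector_derivative[OF \<phi>])
  have C: "continuous_on {0..h} (\<lambda>s. - partial_deriv b \<phi> (x - s *\<^sub>R b))"
    by (intro continuous_on_minus continuous_intros
        continuous_on_compose2[OF test_function_continuous[OF test_function_partial_deriv[OF \<phi> b]]]) simp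
  have "(LINT s|lborel. indicator {0..h} s *\<^sub>R - partial_deriv b \<phi> (x - s *\<^sub>R b))
      = \<phi> (x - h *\<^sub>R b) - \<phi> (x - 0 *\<^sub>R b)"
    by (rule integral_FTC_Icc[OF h D C])
  then show ?thesis
    by (simp only: scaleR_minus_right Bochner_Integration.integral_minus scaleR_zero_left diff_zero)
qed

text \<open>Against a test function, the shift of \<open>u\<close> moves to \<phi>; the difference
  of \<phi> and its translate is a segment integral of its classical derivative; Fubini isolates
  each \<open>s\<close>, where the weak derivative is tested with a translate of \<phi>; shifting
  back gives \<open>segment_integral\<close>. The exceptional null set may depend on
  \<open>h\<close>.\<close>

lemma weak_partial_segment:
  assumes u: "locally_integrable u" and g: "locally_integrable g" and b: "b \<in> Basis"
    and wp: "has_weak_partial b u g" and h: "h \<ge> 0"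
  shows "AE x in lborel. u (x + h *\<^sub>R b) - u x = segment_integral h b g x"
proof -
  note [measurable] = locally_integrable_measurable[OF u] locally_integrable_measurable[OF g]
  have b1: "norm b \<le> 1" using b by simp
  let ?f = "\<lambda>x. (u (x + h *\<^sub>R b) - u x) - segment_integral h b g x"
  have "AE x in lborel. ?f x = 0"
  proof (rule fundamental_lemma)
    show "locally_integrable ?f"
      by (intro locally_integrable_diff locally_integrable_translate locally_integrable_segment_integral u g b1 h)
    fix \<phi> :: "'a \<Rightarrow> complex" assume \<phi>: "\<phi> \<in> test_functions"
    let ?d = "partial_deriv b \<phi>"
    have d: "?d \<in> test_functions" using test_function_partial_deriv[OF \<phi> b] .
    note [measurable] = test_function_measurable[OF \<phi>] test_function_measurable[OF d]
    obtain R where R: "R > 0" "\<And>x. norm x \<ge> R \<Longrightarrow> \<phi> x = 0" "\<And>x. norm x \<ge> R \<Longrightarrow> ?d x = 0"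
    proof -
      obtain R1 R2 where "R1 > 0" "\<And>x. norm x \<ge> R1 \<Longrightarrow> \<phi> x = 0" "\<And>x. norm x \<ge> R2 \<Longrightarrow> ?d x = 0"
        using test_function_support[OF \<phi>] test_function_support[OF d] by metis
      then show ?thesis by (intro that[of "max R1 R2"]) auto
    qed
    obtain M where M: "M > 0" "\<And>x. norm (\<phi> x) \<le> M" "\<And>x. norm (?d x) \<le> M"
    proof -
      obtain M1 M2 where "M1 > 0" "\<And>x. norm (\<phi> x) \<le> M1" "\<And>x. norm (?d x) \<le> M2"
        using test_function_bounded[OF \<phi>] test_function_bounded[OF d] by metis
      then show ?thesis by (intro that[of "max M1 M2"]) (auto simp: le_max_iff_disj)
    qed
    have int1: "integrable (lborel \<Otimes>\<^sub>M lborel) (\<lambda>(x, s). indicator {0..h} s *\<^sub>R (u x * ?d (x - s *\<^sub>R b)))"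
    proof (rule Bochner_Integration.integrable_bound)
      show "integrable (lborel \<Otimes>\<^sub>M lborel)
          (\<lambda>z. M *\<^sub>R (\<lambda>(x, s). indicator (cball 0 (R + h)) x *\<^sub>R indicator {0..h} s *\<^sub>R u (x + s *\<^sub>R 0)) z)"
        by (intro integrable_scaleR_right integrable_segments u h) simp
      have bd: "norm (indicator {0..h} s *\<^sub>R (u x * ?d (x - s *\<^sub>R b)))
         \<le> norm (M *\<^sub>R indicator (cball 0 (R + h)) x *\<^sub>R indicator {0..h} s *\<^sub>R u x)" for x s
      proof (cases "s \<in> {0..h} \<and> norm (x - s *\<^sub>R b) < R")
        case True
        then have "norm x < R + h"
          using norm_triangle_ineq[of "x - s *\<^sub>R b" "s *\<^sub>R b"] b by simp
        with True M show ?thesis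
          by (simp add: norm_mult mult.commute[of "norm (u x)"] mult_right_mono)
      next
        case False
        then show ?thesis using R(3)[of "x - s *\<^sub>R b"] by (auto simp: not_less)
      qed
      then show "AE z in lborel \<Otimes>\<^sub>M lborel. norm (case z of (x, s) \<Rightarrow> indicator {0..h} s *\<^sub>R (u x * ?d (x - s *\<^sub>R b)))
         \<le> norm (M *\<^sub>R (\<lambda>(x, s). indicator (cball 0 (R + h)) x *\<^sub>R indicator {0..h} s *\<^sub>R u (x + s *\<^sub>R 0)) z)"
        by (intro AE_I2) (simp only: split_beta scaleR_zero_right add_0_right bd)
    qed measurable
    have int2: "integrable (lborel \<Otimes>\<^sub>M lborel) (\<lambda>(x, s). indicator {0..h} s *\<^sub>R (g (x + s *\<^sub>R b) * \<phi> x))"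
    proof (rule Bochner_Integration.integrable_bound)
      show "integrable (lborel \<Otimes>\<^sub>M lborel)
          (\<lambda>z. M *\<^sub>R (\<lambda>(x, s). indicator (cball 0 R) x *\<^sub>R indicator {0..h} s *\<^sub>R g (x + s *\<^sub>R b)) z)"
        by (intro integrable_scaleR_right integrable_segments g h b1)
      have bd: "norm (indicator {0..h} s *\<^sub>R (g (x + s *\<^sub>R b) * \<phi> x))
         \<le> norm (M *\<^sub>R indicator (cball 0 R) x *\<^sub>R indicator {0..h} s *\<^sub>R g (x + s *\<^sub>R b))" for x s
        using M R(2)[of x]
        by (cases "norm x < R") (auto simp: norm_mult mult.commute[of "norm (g _)"] mult_right_mono indicator_def)
      then show "AE z in lborel \<Otimes>\<^sub>M lborel. norm (case z of (x, s) \<Rightarrow> indicator {0..h} s *\<^sub>R (g (x + s *\<^sub>R b) * \<phi> x))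
         \<le> norm (M *\<^sub>R (\<lambda>(x, s). indicator (cball 0 R) x *\<^sub>R indicator {0..h} s *\<^sub>R g (x + s *\<^sub>R b)) z)"
        by (intro AE_I2) (simp only: split_beta scaleR_zero_right add_0_right bd)
    qed measurable
    have "(LINT x|lborel. (u (x + h *\<^sub>R b) - u x) * \<phi> x)
       = (LINT x|lborel. u (x + h *\<^sub>R b) * \<phi> (x + h *\<^sub>R b - h *\<^sub>R b)) - (LINT x|lborel. u x * \<phi> x)"
      by (simp add: left_diff_distrib integrable_test_function locally_integrable_translate u \<phi>)
    also have "(LINT x|lborel. u (x + h *\<^sub>R b) * \<phi> (x + h *\<^sub>R b - h *\<^sub>R b)) = (LINT x|lborel. u x * \<phi> (x - h *\<^sub>R b))"
      by (rule integral_lborel_translate[of "\<lambda>x. u x * \<phi> (x - h *\<^sub>R b)"]) measurable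
    also have "(LINT x|lborel. u x * \<phi> (x - h *\<^sub>R b)) - (LINT x|lborel. u x * \<phi> x)
       = (LINT x|lborel. u x * (\<phi> (x - h *\<^sub>R b) - \<phi> x))"
      by (simp add: right_diff_distrib integrable_test_function test_function_translate u \<phi>)
    also have "\<dots> = - (LINT x|lborel. LINT s|lborel. indicator {0..h} s *\<^sub>R (u x * ?d (x - s *\<^sub>R b)))"
      by (simp add: test_function_segment[OF \<phi> b h] flip: integral_mult_right_zero mult_scaleR_right)
    also have "\<dots> = - (LINT s|lborel. LINT x|lborel. indicator {0..h} s *\<^sub>R (u x * ?d (x - s *\<^sub>R b)))"
      using lborel_pair.Fubini_integral[OF int1] by simp
    also have "\<dots> = (LINT s|lborel. LINT x|lborel. indicator {0..h} s *\<^sub>R (g (x + s *\<^sub>R b) * \<phi> x))"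
    proof -
      have "- (LINT x|lborel. u x * ?d (x - s *\<^sub>R b)) = (LINT x|lborel. g (x + s *\<^sub>R b) * \<phi> x)" for s
      proof -
        have "- (LINT x|lborel. u x * ?d (x - s *\<^sub>R b)) = (LINT x|lborel. g x * \<phi> (x - s *\<^sub>R b))"
          using bspec[OF wp[unfolded has_weak_partial_def] test_function_translate(1)[OF \<phi>, of "s *\<^sub>R b"]]
          by (simp add: test_function_translate(2)[OF \<phi>])
        also have "\<dots> = (LINT x|lborel. g (x + s *\<^sub>R b) * \<phi> (x + s *\<^sub>R b - s *\<^sub>R b))"
          by (rule integral_lborel_translate[of "\<lambda>x. g x * \<phi> (x - s *\<^sub>R b)", symmetric]) measurable
        finally show ?thesis by simp
      qed
      then show ?thesis by (simp flip: Bochner_Integration.integral_minus scaleR_minus_right)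
    qed
    also have "\<dots> = (LINT x|lborel. LINT s|lborel. indicator {0..h} s *\<^sub>R (g (x + s *\<^sub>R b) * \<phi> x))"
      using lborel_pair.Fubini_integral[OF int2] by simp
    also have "\<dots> = (LINT x|lborel. segment_integral h b g x * \<phi> x)"
      by (simp add: segment_integral_def flip: integral_mult_left_zero mult_scaleR_left)
    finally show "(LINT x|lborel. ?f x * \<phi> x) = 0"
      using locally_integrable_segment_integral[OF g b1 h] locally_integrable_translate[OF u] u
      by (simp add: left_diff_distrib integrable_test_function locally_integrable_diff \<phi>)
  qed
  then show ?thesis by eventually_elim simp
qed

section \<open>Continuity of translations and the chain rule\<close>

abbreviation L1_modulus :: "('a::euclidean_space \<Rightarrow> complex) \<Rightarrow> 'a \<Rightarrow> real" where
  "L1_modulus f a \<equiv> LINT x|lborel. norm (f (x + a) - f x)"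

text \<open>The error \<open>f - g\<close> enters once translated and once not, hence the factor
  2.\<close>

lemma L1_modulus_le:
  assumes f: "integrable lborel f" and g: "integrable lborel g"
  shows "L1_modulus f a \<le> L1_modulus g a + 2 * (LINT x|lborel. norm (f x - g x))"
proof -
  note int = integrable_lborel_translate[OF f, of a] integrable_lborel_translate[OF g, of a] f g
  have d: "integrable lborel (\<lambda>x. f x - g x)" using f g by simp
  have [measurable]: "f \<in> borel_measurable borel" "g \<in> borel_measurable borel" using f g by auto
  have "L1_modulus f a \<le> (LINT x|lborel. norm (g (x + a) - g x)
     + (norm (f (x + a) - g (x + a)) + norm (f x - g x)))"
  proof (rule integral_mono)
    fix x
    have "f (x + a) - f x = (g (x + a) - g x) + ((f (x + a) - g (x + a)) - (f x - g x))" by simp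
    then show "norm (f (x + a) - f x) \<le> norm (g (x + a) - g x) + (norm (f (x + a) - g (x + a)) + norm (f x - g x))"
      by (metis (no_types, lifting) norm_triangle_ineq norm_triangle_ineq4 add_left_mono order_trans)
  qed (use int in auto)
  also have "\<dots> = L1_modulus g a + ((LINT x|lborel. norm (f (x + a) - g (x + a))) + (LINT x|lborel. norm (f x - g x)))"
    using int by simp
  also have "(LINT x|lborel. norm (f (x + a) - g (x + a))) = (LINT x|lborel. norm (f x - g x))"
    by (rule integral_lborel_translate[of "\<lambda>x. norm (f x - g x)"]) measurable
  finally show ?thesis by simp
qed

lemma L1_modulus_approx:
  assumes f: "integrable lborel f"
    and approx: "\<And>e. e > 0 \<Longrightarrow> \<exists>g. integrable lborel g \<and> (LINT x|lborel. norm (f x - g x)) < e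
                  \<and> (L1_modulus g \<longlongrightarrow> 0) (at 0)"
  shows "(L1_modulus f \<longlongrightarrow> 0) (at 0)"
proof (rule tendstoI)
  fix e :: real assume "e > 0"
  then obtain g where g: "integrable lborel g" "(LINT x|lborel. norm (f x - g x)) < e / 4"
     "(L1_modulus g \<longlongrightarrow> 0) (at 0)"
    using approx[of "e / 4"] by auto
  have "\<forall>\<^sub>F a in at 0. dist (L1_modulus g a) 0 < e / 2"
    using g(3) \<open>e > 0\<close> by (intro tendstoD) auto
  then show "\<forall>\<^sub>F a in at 0. dist (L1_modulus f a) 0 < e"
  proof eventually_elim
    case (elim a)
    then show ?case
      using L1_modulus_le[OF f g(1), of a] g(2) by (simp add: dist_real_def)
  qed
qed

text \<open>The modulus is twice the measure of U minus twice the measure of the overlap of U with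
  its translate. The overlap converges to U by dominated convergence: a point of U stays in the open
  set U under small shifts, and other points contribute nothing.\<close>

lemma L1_modulus_open:
  fixes U :: "'a::euclidean_space set"
  assumes U: "open U" "emeasure lborel U < \<infinity>"
  shows "(L1_modulus (indicator U) \<longlongrightarrow> 0) (at 0)"
  unfolding tendsto_at_iff_sequentially
proof (intro allI impI)
  fix X :: "nat \<Rightarrow> 'a" assume X: "X \<longlonglongrightarrow> 0"
  have [measurable]: "U \<in> sets borel" using U by auto
  have int: "integrable lborel (indicat_real U)" using U by (simp add: integrable_indicator_iff)
  have int': "integrable lborel (\<lambda>x. indicat_real U (x + a))" for a
    using integrable_lborel_translate[OF int] .
  have int2: "integrable lborel (\<lambda>x. indicat_real U x * indicator U (x + a))" for a
    by (rule Bochner_Integration.integrable_bound[OF int]) (auto simp: indicator_def)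
  have m: "(LINT x|lborel. indicat_real U (x + a)) = measure lborel U" for a
    using integral_lborel_translate[of "indicat_real U" a] by simp
  have "L1_modulus (indicator U) a
      = (LINT x|lborel. indicat_real U (x + a) + indicat_real U x - 2 * (indicat_real U x * indicator U (x + a)))" for a
    by (intro Bochner_Integration.integral_cong) (auto simp: indicator_def)
  then have eq: "L1_modulus (indicator U) a
      = 2 * measure lborel U - 2 * (LINT x|lborel. indicat_real U x * indicator U (x + a))" for a
    using int int' int2 m m[of 0] by simp
  have "(\<lambda>k. LINT x|lborel. indicat_real U x * indicator U (x + X k)) \<longlonglongrightarrow> (LINT x|lborel. indicat_real U x)"
  proof (rule integral_dominated_convergence[OF _ _ int])
    show "AE x in lborel. (\<lambda>k. indicat_real U x * indicat_real U (x + X k)) \<longlonglongrightarrow> indicat_real U x"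
    proof (rule AE_I2)
      fix x
      have *: "(\<lambda>k. x + X k) \<longlonglongrightarrow> x" using tendsto_add[OF tendsto_const X, of x] by simp
      show "(\<lambda>k. indicat_real U x * indicat_real U (x + X k)) \<longlonglongrightarrow> indicat_real U x"
      proof (cases "x \<in> U")
        case True
        then have "\<forall>\<^sub>F k in sequentially. x + X k \<in> U"
          using topological_tendstoD[OF * U(1)] by simp
        then have "\<forall>\<^sub>F k in sequentially. indicat_real U x * indicat_real U (x + X k) = indicat_real U x"
          by eventually_elim (use True in simp)
        then show ?thesis by (rule tendsto_eventually)
      qed simp
    qed
  qed (auto simp: indicator_def)
  from tendsto_diff[OF tendsto_const[of "2 * measure lborel U"] tendsto_mult_left[OF this, of 2]]
  show "(L1_modulus (indicator U) \<circ> X) \<longlonglongrightarrow> 0"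
    by (simp add: o_def eq)
qed

text \<open>Outer regularity reduces measurable sets to open ones, so no approximation by continuous
  functions enters; sums and limits of simple functions do the rest.\<close>

lemma L1_modulus_tendsto_0:
  fixes f :: "'a::euclidean_space \<Rightarrow> complex"
  assumes "integrable lborel f"
  shows "(L1_modulus f \<longlongrightarrow> 0) (at 0)"
  using assms
proof (induction rule: integrable_induct)
  case (base A c)
  have A[measurable]: "A \<in> sets borel" using base by simp
  have intA: "integrable lborel (\<lambda>x. indicator A x *\<^sub>R c)" using base by (intro integrable_scaleR_left) (simp add: integrable_indicator_iff)
  show ?case
  proof (rule L1_modulus_approx[OF intA])
    fix e :: real assume e: "e > 0"
    \<comment> \<open>Adding 1 keeps the quotient meaningful for \<open>c = 0\<close> and makes the
      final inequality strict.\<close>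
    define e' where "e' = e / (norm c + 1)"
    have "e' > 0" using e by (simp add: e'_def add_nonneg_pos)
    from outer_regular_lborel[OF A this]
    obtain U where U: "open U" "A \<subseteq> U" "emeasure lborel (U - A) < e'" by blast
    have [measurable]: "U \<in> sets borel" using U by auto
    have "emeasure lborel U = emeasure lborel A + emeasure lborel (U - A)"
      using plus_emeasure[of A lborel "U - A"] U A by (simp add: Un_absorb1)
    also have "\<dots> < \<infinity>" using base U by (auto simp: less_top order.strict_trans)
    finally have Ufin: "emeasure lborel U < \<infinity>" .
    let ?g = "\<lambda>x. indicator U x *\<^sub>R c"
    have "integrable lborel ?g"
      using Ufin by (intro integrable_scaleR_left) (simp add: integrable_indicator_iff)
    moreover have "(LINT x|lborel. norm (indicator A x *\<^sub>R c - ?g x)) < e"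
    proof -
      have "(LINT x|lborel. norm (indicator A x *\<^sub>R c - ?g x)) = (LINT x|lborel. indicator (U - A) x * norm c)"
        using U(2) by (intro Bochner_Integration.integral_cong) (auto simp: indicator_def)
      also have "\<dots> = measure lborel (U - A) * norm c" by simp
      also have "\<dots> \<le> e' * norm c"
        using U(3) \<open>e' > 0\<close> by (intro mult_right_mono) (auto simp: measure_def enn2real_leI less_imp_le)
      also have "\<dots> < e" using e by (simp add: e'_def divide_simps add_nonneg_pos)
      finally show ?thesis .
    qed
    moreover have "(L1_modulus ?g \<longlongrightarrow> 0) (at 0)"
    proof -
      have "L1_modulus ?g a = L1_modulus (indicator U) a * norm c" for a
      proof -
        have "L1_modulus ?g a = (LINT x|lborel. norm (indicator U (x + a) - indicator U x :: complex) * norm c)"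
          by (intro Bochner_Integration.integral_cong) (auto simp: indicator_def)
        then show ?thesis by simp
      qed
      then show ?thesis
        using tendsto_mult_left_zero[OF L1_modulus_open[OF U(1) Ufin], of "norm c"] by simp
    qed
    ultimately show "\<exists>g. integrable lborel g \<and> (LINT x|lborel. norm (indicator A x *\<^sub>R c - g x)) < e
                  \<and> (L1_modulus g \<longlongrightarrow> 0) (at 0)" by blast
  qed
next
  case (add f g)
  show ?case
  proof (rule tendsto_sandwich[OF _ _ tendsto_const])
    show "((\<lambda>a. L1_modulus f a + L1_modulus g a) \<longlongrightarrow> 0) (at 0)"
      using tendsto_add[OF add(3,4)] by simp
    note int = add(1,2) integrable_lborel_translate[OF add(1)] integrable_lborel_translate[OF add(2)]
    show "\<forall>\<^sub>F a in at 0. L1_modulus (\<lambda>x. f x + g x) a \<le> L1_modulus f a + L1_modulus g a"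
    proof (intro always_eventually allI)
      fix a
      have "L1_modulus (\<lambda>x. f x + g x) a \<le> (LINT x|lborel. norm (f (x + a) - f x) + norm (g (x + a) - g x))"
        using int by (intro integral_mono) (auto simp: norm_diff_triangle_ineq)
      then show "L1_modulus (\<lambda>x. f x + g x) a \<le> L1_modulus f a + L1_modulus g a"
        using int by simp
    qed
  qed auto
next
  case (lim f s)
  show ?case
  proof (rule L1_modulus_approx[OF lim(4)])
    fix e :: real assume e: "e > 0"
    have "(\<lambda>i. LINT x|lborel. norm (f x - s i x)) \<longlonglongrightarrow> (LINT x|(lborel::'a measure). 0)"
    proof (rule integral_dominated_convergence)
      \<comment> \<open>The approximants of \<open>integrable_induct\<close> satisfy norm (s i x) <=
        2 norm (f x), so the error is at most three times norm (f x).\<close>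
      show "integrable lborel (\<lambda>x. 3 * norm (f x))" using lim(4) by simp
      show "AE x in lborel. norm (norm (f x - s i x)) \<le> 3 * norm (f x)" for i
      proof (rule AE_I2)
        fix x
        show "norm (norm (f x - s i x)) \<le> 3 * norm (f x)"
          using lim(3)[of x i] norm_triangle_ineq4[of "f x" "s i x"] by simp
      qed
      show "AE x in lborel. (\<lambda>i. norm (f x - s i x)) \<longlonglongrightarrow> 0"
      proof (rule AE_I2)
        fix x :: 'a
        show "(\<lambda>i. norm (f x - s i x)) \<longlonglongrightarrow> 0"
          using tendsto_norm[OF tendsto_diff[OF tendsto_const[of "f x"] lim(2)[of x]]] by simp
      qed
    qed (use lim in auto)
    then have "\<forall>\<^sub>F i in sequentially. (LINT x|lborel. norm (f x - s i x)) < e"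
      using e by (intro order_tendstoD(2)) auto
    then obtain i where "(LINT x|lborel. norm (f x - s i x)) < e"
      using eventually_happens by force
    then show "\<exists>g. integrable lborel g \<and> (LINT x|lborel. norm (f x - g x)) < e \<and> (L1_modulus g \<longlongrightarrow> 0) (at 0)"
      using lim by blast
  qed
qed

section \<open>Difference quotients and the chain rule\<close>

lemma difference_quotient_tendsto:
  fixes f :: "real \<Rightarrow> 'b::real_normed_vector"
  assumes "(f has_vector_derivative D) (at 0)"
  shows "(\<lambda>k. real (Suc k) *\<^sub>R (f (inverse (real (Suc k))) - f 0)) \<longlonglongrightarrow> D"
proof -
  have "((\<lambda>h. norm (f (0 + h) - f 0 - h *\<^sub>R D) / norm h) \<longlongrightarrow> 0) (at 0)"
    using assms unfolding has_vector_derivative_def has_derivative_at by blast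
  moreover have "filterlim (\<lambda>k. inverse (real (Suc k))) (at 0) sequentially"
    using LIMSEQ_inverse_real_of_nat by (intro filterlim_atI) auto
  ultimately have "(\<lambda>k. norm (f (0 + inverse (real (Suc k))) - f 0 - inverse (real (Suc k)) *\<^sub>R D)
      / norm (inverse (real (Suc k)))) \<longlonglongrightarrow> 0"
    by (rule filterlim_compose)
  also have "(\<lambda>k. norm (f (0 + inverse (real (Suc k))) - f 0 - inverse (real (Suc k)) *\<^sub>R D)
      / norm (inverse (real (Suc k))))
      = (\<lambda>k. norm (real (Suc k) *\<^sub>R (f (inverse (real (Suc k))) - f 0) - D))"
  proof
    fix k
    let ?c = "real (Suc k)"
    have c: "?c > 0" by simp
    then have "norm (?c *\<^sub>R (f (inverse ?c) - f 0) - D) = norm (?c *\<^sub>R (f (0 + inverse ?c) - f 0 - inverse ?c *\<^sub>R D))"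
      by (simp only: scaleR_right_diff_distrib scaleR_scaleR add_0_left) simp
    also have "\<dots> = norm (f (0 + inverse ?c) - f 0 - inverse ?c *\<^sub>R D) / norm (inverse ?c)"
      unfolding norm_scaleR using c by (simp only: abs_inverse divide_inverse inverse_inverse_eq real_norm_def mult.commute)
    finally show "norm (f (0 + inverse ?c) - f 0 - inverse ?c *\<^sub>R D) / norm (inverse ?c)
      = norm (?c *\<^sub>R (f (inverse ?c) - f 0) - D)" by (rule sym)
  qed
  finally show ?thesis
    by (rule LIM_zero_cancel[OF tendsto_norm_zero_cancel])
qed

lemma directional_derivative_tendsto:
  fixes F :: "'a::real_normed_vector \<Rightarrow> 'b::real_normed_vector"
  assumes "(F has_derivative D) (at z)"
  shows "(\<lambda>k. real (Suc k) *\<^sub>R (F (z + inverse (real (Suc k)) *\<^sub>R v) - F z)) \<longlonglongrightarrow> D v"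
proof -
  have "((\<lambda>t. F (z + t *\<^sub>R v)) has_derivative (\<lambda>t. D (t *\<^sub>R v))) (at 0)"
    by (rule has_derivative_compose[of "\<lambda>t. z + t *\<^sub>R v" "\<lambda>t. t *\<^sub>R v" 0 UNIV])
       (use assms in \<open>auto intro!: derivative_eq_intros\<close>)
  then have "((\<lambda>t. F (z + t *\<^sub>R v)) has_vector_derivative D v) (at 0)"
    using linear_scale[OF has_derivative_linear[OF assms]] by (simp add: has_vector_derivative_def)
  from difference_quotient_tendsto[OF this] show ?thesis by simp
qed

lemma locally_integrable_bound:
  assumes f: "locally_integrable f" and [measurable]: "g \<in> borel_measurable borel"
    and le: "\<And>x. norm (g x) \<le> C * norm (f x)"
  shows "locally_integrable g"
  unfolding locally_integrable_def
proof safe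
  fix R
  show "integrable lborel (\<lambda>x. indicator (cball 0 R) x *\<^sub>R g x)"
  proof (rule Bochner_Integration.integrable_bound)
    show "integrable lborel (\<lambda>x. C *\<^sub>R (indicator (cball 0 R) x *\<^sub>R f x))"
      by (intro integrable_scaleR_right locally_integrable_integrable f)
    have "norm (indicator (cball 0 R) x *\<^sub>R g x) \<le> norm (C *\<^sub>R (indicator (cball 0 R) x *\<^sub>R f x))" for x
      using le[of x] order_trans[OF le[of x] mult_right_mono[OF abs_ge_self norm_ge_zero]]
      by (simp add: indicator_def)
    then show "AE x in lborel. norm (indicator (cball 0 R) x *\<^sub>R g x) \<le> norm (C *\<^sub>R (indicator (cball 0 R) x *\<^sub>R f x))"
      by (intro AE_I2)
  qed measurable
qed measurable

text \<open>By the segment formula the difference quotient is an average of translates of the weak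
  derivative, so continuity of translations in \<open>L\<^sup>1\<close> gives strong convergence.\<close>

lemma difference_quotient_L1:
  assumes u: "locally_integrable u" and g: "locally_integrable g" and b: "b \<in> Basis"
    and wp: "has_weak_partial b u g"
  shows "(\<lambda>k. \<integral>\<^sup>+x. indicator (cball 0 R) x * ennreal (norm
      (real (Suc k) *\<^sub>R (u (x + inverse (real (Suc k)) *\<^sub>R b) - u x) - g x)) \<partial>lborel) \<longlonglongrightarrow> 0"
proof -
  note [measurable] = locally_integrable_measurable[OF u] locally_integrable_measurable[OF g]
  have b1: "norm b = 1" using b by simp
  \<comment> \<open>Segments of length at most 1 starting in the ball of radius \<open>R\<close>
    stay in the larger ball, where \<open>g'\<close> equals \<open>g\<close>; unlike
    \<open>g\<close>, it is globally integrable.\<close>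
  define g' where "g' x = indicator (cball 0 (R + 1)) x *\<^sub>R g x" for x
  have g': "integrable lborel g'"
    unfolding g'_def by (rule locally_integrable_integrable[OF g])
  have [measurable]: "g' \<in> borel_measurable borel" unfolding g'_def by measurable
  have "\<forall>\<^sub>F k in sequentially. (\<integral>\<^sup>+x. indicator (cball 0 R) x * ennreal (norm
      (real (Suc k) *\<^sub>R (u (x + inverse (real (Suc k)) *\<^sub>R b) - u x) - g x)) \<partial>lborel) \<le> ennreal e"
    if e: "e > 0" for e
  proof -
    have "\<forall>\<^sub>F a in at 0. dist (L1_modulus g' a) 0 < e"
      using L1_modulus_tendsto_0[OF g'] e by (intro tendstoD) auto
    then obtain d where d: "d > 0" "\<And>a. a \<noteq> 0 \<Longrightarrow> norm a < d \<Longrightarrow> L1_modulus g' a < e"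
      unfolding eventually_at by (auto simp: dist_real_def)
    have "\<forall>\<^sub>F k in sequentially. inverse (real (Suc k)) < d"
      using LIMSEQ_inverse_real_of_nat d(1) by (rule order_tendstoD(2))
    then show ?thesis
    proof eventually_elim
      case (elim k)
      define h where "h = inverse (real (Suc k))"
      have h: "h \<ge> 0" "h < d" "h \<le> 1" "real (Suc k) * h = 1"
        using elim by (auto simp: h_def divide_simps)
      have "AE x in lborel. indicator (cball 0 R) x * ennreal (norm (real (Suc k) *\<^sub>R (u (x + h *\<^sub>R b) - u x) - g x))
        \<le> (\<integral>\<^sup>+s. indicator {0..h} s * ennreal (real (Suc k) * norm (g' (x + s *\<^sub>R b) - g' x)) \<partial>lborel)"
        using weak_partial_segment[OF u g b wp h(1)] AE_integrable_segment[OF g order_eq_refl[OF b1] h(1)]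
      proof eventually_elim
        case (elim x)
        show ?case
        proof (cases "x \<in> cball 0 R")
          case True
          have nb: "norm (x + s *\<^sub>R b) \<le> R + 1" if "s \<in> {0..h}" for s
            using norm_triangle_ineq[of x "s *\<^sub>R b"] that h b1 True by simp
          have i1: "integrable lborel (\<lambda>s. indicator {0..h} s *\<^sub>R g (x + s *\<^sub>R b))" by fact
          have i2: "integrable lborel (\<lambda>s. indicator {0..h} s *\<^sub>R g x)"
            using h by (intro integrable_scaleR_left) (simp add: integrable_indicator_iff)
          have "segment_integral h b g x - h *\<^sub>R g x
             = (LINT s|lborel. indicator {0..h} s *\<^sub>R g (x + s *\<^sub>R b) - indicator {0..h} s *\<^sub>R g x)"
            using i1 i2 h by (simp add: segment_integral_def)
          also have "\<dots> = (LINT s|lborel. indicator {0..h} s *\<^sub>R (g' (x + s *\<^sub>R b) - g' x))"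
            using nb True by (intro Bochner_Integration.integral_cong) (auto simp: g'_def indicator_def)
          finally have **: "segment_integral h b g x - h *\<^sub>R g x
             = (LINT s|lborel. indicator {0..h} s *\<^sub>R (g' (x + s *\<^sub>R b) - g' x))" .
          have *: "real (Suc k) *\<^sub>R (u (x + h *\<^sub>R b) - u x) - g x
             = (LINT s|lborel. real (Suc k) *\<^sub>R (indicator {0..h} s *\<^sub>R (g' (x + s *\<^sub>R b) - g' x)))"
          proof -
            have "real (Suc k) *\<^sub>R (segment_integral h b g x - h *\<^sub>R g x)
               = real (Suc k) *\<^sub>R segment_integral h b g x - (real (Suc k) * h) *\<^sub>R g x"
              by (simp only: scaleR_right_diff_distrib scaleR_scaleR)
            then show ?thesis
              by (simp only: h(4) scaleR_one elim(1) integral_scaleR_right **)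
          qed
          have "integrable lborel (\<lambda>s. indicator {0..h} s *\<^sub>R (g' (x + s *\<^sub>R b) - g' x))
             \<longleftrightarrow> integrable lborel (\<lambda>s. indicator {0..h} s *\<^sub>R g (x + s *\<^sub>R b) - indicator {0..h} s *\<^sub>R g x)"
            using nb True by (intro Bochner_Integration.integrable_cong) (auto simp: g'_def indicator_def)
          then have "integrable lborel (\<lambda>s. real (Suc k) *\<^sub>R (indicator {0..h} s *\<^sub>R (g' (x + s *\<^sub>R b) - g' x)))"
            using i1 i2 by (intro integrable_scaleR_right) (simp only: Bochner_Integration.integrable_diff)
          from integral_norm_bound_ennreal[OF this]
          have "ennreal (norm (real (Suc k) *\<^sub>R (u (x + h *\<^sub>R b) - u x) - g x))
             \<le> (\<integral>\<^sup>+s. ennreal (norm (real (Suc k) *\<^sub>R (indicator {0..h} s *\<^sub>R (g' (x + s *\<^sub>R b) - g' x)))) \<partial>lborel)"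
            by (simp only: *)
          also have "\<dots> = (\<integral>\<^sup>+s. indicator {0..h} s * ennreal (real (Suc k) * norm (g' (x + s *\<^sub>R b) - g' x)) \<partial>lborel)"
            by (intro nn_integral_cong) (simp add: indicator_def)
          finally show ?thesis using True by simp
        qed simp
      qed
      then have "(\<integral>\<^sup>+x. indicator (cball 0 R) x * ennreal (norm (real (Suc k) *\<^sub>R (u (x + h *\<^sub>R b) - u x) - g x)) \<partial>lborel)
        \<le> (\<integral>\<^sup>+x. \<integral>\<^sup>+s. indicator {0..h} s * ennreal (real (Suc k) * norm (g' (x + s *\<^sub>R b) - g' x)) \<partial>lborel \<partial>lborel)"
        by (rule nn_integral_mono_AE)
      \<comment> \<open>After the exchange the inner integral is \<open>Suc k\<close> times the
        modulus of \<open>g'\<close> at \<open>s *\<^sub>R b\<close>, hence at most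
        \<open>Suc k * e\<close>; the outer one multiplies by \<open>h = 1 / Suc k\<close>.\<close>
      also have "\<dots> = (\<integral>\<^sup>+s. \<integral>\<^sup>+x. indicator {0..h} s * ennreal (real (Suc k) * norm (g' (x + s *\<^sub>R b) - g' x)) \<partial>lborel \<partial>lborel)"
        by (rule lborel_pair.Fubini'[symmetric]) measurable
      also have "\<dots> \<le> (\<integral>\<^sup>+s. indicator {0..h} s * ennreal (real (Suc k) * e) \<partial>lborel)"
      proof (rule nn_integral_mono)
        fix s
        have int: "integrable lborel (\<lambda>x. g' (x + s *\<^sub>R b) - g' x)"
          using g' integrable_lborel_translate[OF g'] by simp
        have "(\<integral>\<^sup>+x. ennreal (real (Suc k) * norm (g' (x + s *\<^sub>R b) - g' x)) \<partial>lborel)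
            = ennreal (real (Suc k) * L1_modulus g' (s *\<^sub>R b))"
          by (subst nn_integral_eq_integral) (use int in auto)
        moreover have "L1_modulus g' (s *\<^sub>R b) \<le> e" if "s \<in> {0..h}"
        \<comment> \<open>The filter \<open>at 0\<close> says nothing about the shift zero, where
          the modulus vanishes.\<close>
        proof (cases "s = 0")
          case False
          moreover have "b \<noteq> 0" using b1 by auto
          moreover have "norm (s *\<^sub>R b) < d" using that h b1 by simp
          ultimately show ?thesis using d(2)[of "s *\<^sub>R b"] by simp
        qed (use e in simp)
        ultimately show "(\<integral>\<^sup>+x. indicator {0..h} s * ennreal (real (Suc k) * norm (g' (x + s *\<^sub>R b) - g' x)) \<partial>lborel)
           \<le> indicator {0..h} s * ennreal (real (Suc k) * e)"
          by (auto simp: indicator_def intro!: ennreal_leI mult_left_mono)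
      qed
      also have "\<dots> = ennreal (real (Suc k) * e) * ennreal h"
        using h by (subst nn_integral_multc) (auto simp: mult.commute)
      also have "\<dots> = ennreal e"
        using h e by (subst ennreal_mult[symmetric]) (auto simp: mult_ac)
      finally show ?case unfolding h_def .
    qed
  qed
  note bound = this
  show ?thesis
  proof (rule order_tendstoI)
    fix a :: ennreal assume "0 < a"
    then obtain c where c: "0 < c" "c < a" using dense by blast
    then obtain e where e: "c = ennreal e" by (cases c) (auto simp: top_unique)
    with c have "e > 0" by (simp add: ennreal_less_zero_iff)
    from bound[OF this] show "\<forall>\<^sub>F k in sequentially. (\<integral>\<^sup>+x. indicator (cball 0 R) x * ennreal (norm
      (real (Suc k) *\<^sub>R (u (x + inverse (real (Suc k)) *\<^sub>R b) - u x) - g x)) \<partial>lborel) < a"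
      by eventually_elim (use c e in auto)
  qed simp
qed

text \<open>The difference quotient of \<open>F \<circ> u\<close> differs from \<open>(F (u + h g) - F u) / h\<close> by at most \<open>L\<close> times the
  \<open>L\<^sup>1\<close> error of the difference quotient of \<open>u\<close>, so pointwise differentiability of \<open>F\<close> suffices.\<close>

lemma chain_rule_weak_partial:
  fixes F :: "complex \<Rightarrow> complex"
  assumes u: "locally_integrable u" and g: "locally_integrable g" and b: "b \<in> Basis"
    and wp: "has_weak_partial b u g"
    and lip: "\<And>z w. norm (F z - F w) \<le> L * norm (z - w)" and F0: "F 0 = 0"
    and der: "\<And>z. (F has_derivative D z) (at z)"
  shows "locally_integrable (\<lambda>x. F (u x))" and "locally_integrable (\<lambda>x. D (u x) (g x))"
    and "has_weak_partial b (\<lambda>x. F (u x)) (\<lambda>x. D (u x) (g x))"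
proof -
  note [measurable] = locally_integrable_measurable[OF u] locally_integrable_measurable[OF g]
  have "continuous_on UNIV F"
    by (intro continuous_at_imp_continuous_on ballI has_derivative_continuous[OF der])
  then have [measurable]: "F \<in> borel_measurable borel" by (rule borel_measurable_continuous_onI)
  define q where "q k z v = real (Suc k) *\<^sub>R (F (z + inverse (real (Suc k)) *\<^sub>R v) - F z)" for k z v
  have [measurable]: "(\<lambda>x. q k (u x) (g x)) \<in> borel_measurable borel" for k unfolding q_def by measurable
  have q_lim: "(\<lambda>k. q k z v) \<longlonglongrightarrow> D z v" for z v
    unfolding q_def by (rule directional_derivative_tendsto[OF der])
  have q_le: "norm (q k z v) \<le> L * norm v" for k z v
  proof -
    have "norm (q k z v) \<le> real (Suc k) * (L * norm (inverse (real (Suc k)) *\<^sub>R v))"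
      unfolding q_def norm_scaleR using lip[of "z + inverse (real (Suc k)) *\<^sub>R v" z] by (simp add: mult_left_mono)
    then show ?thesis by (simp add: divide_simps)
  qed
  have D_le: "norm (D z v) \<le> L * norm v" for z v
    by (rule LIMSEQ_le_const2[OF tendsto_norm[OF q_lim]]) (use q_le in blast)
  \<comment> \<open>Measurability in \<open>x\<close> is inherited from the quotients
    \<open>q\<close>, whose pointwise limit this is.\<close>
  have D_meas[measurable]: "(\<lambda>x. D (u x) (g x)) \<in> borel_measurable borel"
    by (rule borel_measurable_LIMSEQ_metric[of "\<lambda>k x. q k (u x) (g x)"]) (use q_lim in measurable)
  show Fu: "locally_integrable (\<lambda>x. F (u x))"
    using lip[of _ 0] F0 by (intro locally_integrable_bound[OF u, where C = L]) auto
  show Dg: "locally_integrable (\<lambda>x. D (u x) (g x))"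
    using D_le by (intro locally_integrable_bound[OF g, where C = L]) auto
  show "has_weak_partial b (\<lambda>x. F (u x)) (\<lambda>x. D (u x) (g x))"
    unfolding has_weak_partial_def
  proof
    fix \<phi> :: "'a \<Rightarrow> complex" assume \<phi>: "\<phi> \<in> test_functions"
    let ?d = "partial_deriv b \<phi>"
    let ?h = "\<lambda>k. inverse (real (Suc k))"
    let ?\<Delta> = "\<lambda>k x. real (Suc k) *\<^sub>R (\<phi> (x - ?h k *\<^sub>R b) - \<phi> x)"
    have d: "?d \<in> test_functions" using test_function_partial_deriv[OF \<phi> b] .
    note [measurable] = test_function_measurable[OF \<phi>] test_function_measurable[OF d]
    obtain R where R: "R > 0" "\<And>x. norm x \<ge> R \<Longrightarrow> \<phi> x = 0"
      using test_function_support[OF \<phi>] by blast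
    obtain M where M: "M > 0" "\<And>x. norm (?d x) \<le> M"
      using test_function_bounded[OF d] by blast
    obtain M' where M': "M' > 0" "\<And>x. norm (\<phi> x) \<le> M'"
      using test_function_bounded[OF \<phi>] by blast
    let ?E = "\<lambda>k. \<integral>\<^sup>+x. indicator (cball 0 R) x * ennreal (norm
        (real (Suc k) *\<^sub>R (u (x + ?h k *\<^sub>R b) - u x) - g x)) \<partial>lborel"
    \<comment> \<open>\<open>I k\<close> has two limits: with the quotient moved onto \<phi> it
      tends to the left side of the claim up to sign, and by comparison with the \<open>J k\<close>
      below it tends to the integral of \<open>D (u x) (g x) * \<phi> x\<close>.\<close>
    define I where "I k = (LINT x|lborel. real (Suc k) *\<^sub>R (F (u (x + ?h k *\<^sub>R b)) - F (u x)) * \<phi> x)" for k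
    have I_eq: "I k = (LINT x|lborel. F (u x) * (?\<Delta> k x))" for k
    proof -
      note int = integrable_test_function[OF Fu \<phi>] integrable_test_function[OF locally_integrable_translate[OF Fu] \<phi>]
        integrable_test_function[OF Fu test_function_translate(1)[OF \<phi>]]
      have "(LINT x|lborel. F (u (x + ?h k *\<^sub>R b)) * \<phi> (x + ?h k *\<^sub>R b - ?h k *\<^sub>R b))
          = (LINT x|lborel. F (u x) * \<phi> (x - ?h k *\<^sub>R b))"
        by (rule integral_lborel_translate[of "\<lambda>x. F (u x) * \<phi> (x - ?h k *\<^sub>R b)"]) measurable
      then have "(LINT x|lborel. (F (u (x + ?h k *\<^sub>R b)) - F (u x)) * \<phi> x)
         = (LINT x|lborel. F (u x) * (\<phi> (x - ?h k *\<^sub>R b) - \<phi> x))"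
        using int by (simp add: left_diff_distrib right_diff_distrib)
      then show ?thesis
        unfolding I_def by (simp only: mult_scaleR_left mult_scaleR_right integral_scaleR_right)
    qed
    have lim1: "I \<longlonglongrightarrow> (LINT x|lborel. F (u x) * - ?d x)"
      unfolding I_eq[abs_def]
    proof (rule integral_dominated_convergence)
      \<comment> \<open>Shifts are at most 1 in length, so outside the ball of radius
        \<open>R + 1\<close> both \<phi> and its translate vanish.\<close>
      show "integrable lborel (\<lambda>x. M * norm (indicator (cball 0 (R + 1)) x *\<^sub>R F (u x)))"
        by (intro integrable_mult_right integrable_norm locally_integrable_integrable Fu)
      show "AE x in lborel. (\<lambda>k. F (u x) * (?\<Delta> k x)) \<longlonglongrightarrow> F (u x) * - ?d x"
      proof (intro AE_I2 tendsto_mult_left)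
        fix x
        from difference_quotient_tendsto[OF test_function_has_vector_derivative[OF \<phi>, of x b 0 UNIV]]
        show "(\<lambda>k. real (Suc k) *\<^sub>R (\<phi> (x - ?h k *\<^sub>R b) - \<phi> x)) \<longlonglongrightarrow> - ?d x" by simp
      qed
      show "AE x in lborel. norm (F (u x) * (?\<Delta> k x))
          \<le> M * norm (indicator (cball 0 (R + 1)) x *\<^sub>R F (u x))" for k
      proof (rule AE_I2)
        fix x
        have hk: "?h k \<ge> 0" "?h k \<le> 1" by (auto simp: divide_simps)
        show "norm (F (u x) * (?\<Delta> k x))
          \<le> M * norm (indicator (cball 0 (R + 1)) x *\<^sub>R F (u x))"
        proof (cases "norm x \<le> R + 1")
          case True
          have "norm (\<phi> (x - ?h k *\<^sub>R b) - \<phi> x) \<le> (LINT s|lborel. indicator {0..?h k} s *\<^sub>R M)"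
          proof -
            have "norm (\<phi> (x - ?h k *\<^sub>R b) - \<phi> x) = norm (LINT s|lborel. indicator {0..?h k} s *\<^sub>R ?d (x - s *\<^sub>R b))"
              by (simp only: test_function_segment[OF \<phi> b hk(1)] norm_minus_cancel)
            also have "\<dots> \<le> (LINT s|lborel. norm (indicator {0..?h k} s *\<^sub>R ?d (x - s *\<^sub>R b)))"
              by (rule integral_norm_bound)
            also have "\<dots> \<le> (LINT s|lborel. indicator {0..?h k} s *\<^sub>R M)"
            proof (rule integral_mono')
              show "integrable lborel (\<lambda>s. indicator {0..?h k} s *\<^sub>R M)"
                by (intro integrable_scaleR_left) (simp add: integrable_indicator_iff)
            qed (use M in \<open>auto simp: indicator_def less_imp_le\<close>)
            finally show ?thesis .
          qed
          also have "\<dots> = ?h k * M" using hk by simp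
          finally have "real (Suc k) * norm (\<phi> (x - ?h k *\<^sub>R b) - \<phi> x) \<le> real (Suc k) * (?h k * M)"
            by (intro mult_left_mono) auto
          also have "\<dots> = M" by (simp add: divide_simps)
          finally have "norm (?\<Delta> k x) \<le> M" by simp
          then have "norm (F (u x)) * norm (?\<Delta> k x) \<le> norm (F (u x)) * M"
            by (intro mult_left_mono) auto
          with True show ?thesis by (simp add: norm_mult mult_ac)
        next
          case False
          have "norm x \<le> norm (x - ?h k *\<^sub>R b) + ?h k * norm b"
            using norm_triangle_ineq[of "x - ?h k *\<^sub>R b" "?h k *\<^sub>R b"] hk by simp
          also have "?h k * norm b \<le> 1" using hk b by simp
          finally have "norm (x - ?h k *\<^sub>R b) \<ge> R" using False by simp
          with False R(2)[of "x - ?h k *\<^sub>R b"] R(2)[of x] show ?thesis by simp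
        qed
      qed
    qed measurable
    define J where "J k = (LINT x|lborel. q k (u x) (g x) * \<phi> x)" for k
    have intJ: "integrable lborel (\<lambda>x. q k (u x) (g x) * \<phi> x)" for k
      using q_le by (intro integrable_test_function[OF _ \<phi>] locally_integrable_bound[OF g, where C = L]) auto
    have lim2: "J \<longlonglongrightarrow> (LINT x|lborel. D (u x) (g x) * \<phi> x)"
      unfolding J_def[abs_def]
    proof (rule integral_dominated_convergence)
      show "integrable lborel (\<lambda>x. L * norm (g x * \<phi> x))"
        by (intro integrable_mult_right integrable_norm integrable_test_function g \<phi>)
      show "AE x in lborel. norm (q k (u x) (g x) * \<phi> x) \<le> L * norm (g x * \<phi> x)" for k
        using q_le by (intro AE_I2) (simp add: norm_mult mult_right_mono mult.assoc[symmetric])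
      show "AE x in lborel. (\<lambda>k. q k (u x) (g x) * \<phi> x) \<longlonglongrightarrow> D (u x) (g x) * \<phi> x"
        by (intro AE_I2 tendsto_mult_right q_lim)
    qed measurable
    have "(\<lambda>k. I k - J k) \<longlonglongrightarrow> 0"
    proof -
      have bound: "ennreal (norm (I k - J k)) \<le> ennreal (L * M') * ?E k" for k
      proof -
        let ?A = "\<lambda>x. real (Suc k) *\<^sub>R (F (u (x + ?h k *\<^sub>R b)) - F (u x)) * \<phi> x"
        have "integrable lborel (\<lambda>x. (F (u (x + ?h k *\<^sub>R b)) - F (u x)) * \<phi> x)"
          by (intro integrable_test_function locally_integrable_diff locally_integrable_translate[OF Fu] Fu \<phi>)
        then have intI: "integrable lborel ?A"
          unfolding mult_scaleR_left by (rule integrable_scaleR_right)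
        have "I k - J k = (LINT x|lborel. ?A x - q k (u x) (g x) * \<phi> x)"
          unfolding I_def J_def using intI intJ by (subst Bochner_Integration.integral_diff) auto
        then have "ennreal (norm (I k - J k)) \<le> (\<integral>\<^sup>+x. ennreal (norm (?A x - q k (u x) (g x) * \<phi> x)) \<partial>lborel)"
          using integral_norm_bound_ennreal[OF Bochner_Integration.integrable_diff[OF intI intJ]] by simp
        also have "\<dots> \<le> (\<integral>\<^sup>+x. ennreal (L * M') * (indicator (cball 0 R) x * ennreal (norm
          (real (Suc k) *\<^sub>R (u (x + ?h k *\<^sub>R b) - u x) - g x))) \<partial>lborel)"
        proof (rule nn_integral_mono)
          fix x
          let ?v = "u (x + ?h k *\<^sub>R b)"
          let ?B = "real (Suc k) *\<^sub>R (?v - u x) - g x"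
          show "ennreal (norm (?A x - q k (u x) (g x) * \<phi> x)) \<le> ennreal (L * M') * (indicator (cball 0 R) x * ennreal (norm ?B))"
          proof (cases "norm x \<le> R")
            case True
            have L: "L \<ge> 0" using order_trans[OF norm_ge_zero lip[of 1 0]] by simp
            have "?A x - q k (u x) (g x) * \<phi> x = real (Suc k) *\<^sub>R (F ?v - F (u x + ?h k *\<^sub>R g x)) * \<phi> x"
              by (simp add: q_def algebra_simps)
            also have "norm \<dots> \<le> (real (Suc k) * (L * norm (?v - (u x + ?h k *\<^sub>R g x)))) * M'"
              unfolding norm_mult norm_scaleR using lip M' L by (intro mult_mono) (auto intro!: mult_nonneg_nonneg)
            also have "real (Suc k) * (L * norm (?v - (u x + ?h k *\<^sub>R g x))) = L * norm (real (Suc k) *\<^sub>R (?v - (u x + ?h k *\<^sub>R g x)))"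
              by (simp only: norm_scaleR) simp
            also have "real (Suc k) *\<^sub>R (?v - (u x + ?h k *\<^sub>R g x)) = ?B"
              by (simp add: scaleR_right_diff_distrib scaleR_add_right)
            finally have "norm (?A x - q k (u x) (g x) * \<phi> x) \<le> (L * M') * norm ?B" by (simp add: mult_ac)
            then show ?thesis
              using True L M' by (simp add: ennreal_mult[symmetric] ennreal_leI)
          next
            case False
            then show ?thesis using R(2)[of x] by simp
          qed
        qed
        finally show ?thesis by (subst (asm) nn_integral_cmult) measurable
      qed
      have "(\<lambda>k. ennreal (L * M') * ?E k) \<longlonglongrightarrow> ennreal (L * M') * 0"
        by (intro tendsto_mult_ennreal tendsto_const difference_quotient_L1 u g b wp) simp
      then have lim0: "(\<lambda>k. ennreal (L * M') * ?E k) \<longlonglongrightarrow> ennreal 0"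
        by (simp only: mult_zero_right ennreal_0)
      have "(\<lambda>k. ennreal (norm (I k - J k))) \<longlonglongrightarrow> ennreal 0"
      proof (rule tendsto_sandwich[OF _ _ tendsto_const lim0])
        show "\<forall>\<^sub>F k in sequentially. ennreal (norm (I k - J k)) \<le> ennreal (L * M') * ?E k"
          by (intro always_eventually allI bound)
      qed simp
      then show ?thesis
        by (subst (asm) tendsto_ennreal_iff[OF always_eventually[OF allI[OF norm_ge_zero]] order_refl])
           (rule tendsto_norm_zero_cancel)
    qed
    from tendsto_diff[OF lim1 this] have "J \<longlonglongrightarrow> (LINT x|lborel. F (u x) * - ?d x)" by simp
    from LIMSEQ_unique[OF this lim2]
    have "- (LINT x|lborel. F (u x) * ?d x) = (LINT x|lborel. D (u x) (g x) * \<phi> x)" by simp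
    then show "(LINT x|lborel. F (u x) * ?d x) = - (LINT x|lborel. D (u x) (g x) * \<phi> x)"
      by (metis add.inverse_inverse)
  qed
qed

section \<open>Gagliardo's inequality\<close>

text \<open>Polya's proof of the inequality of arithmetic and geometric means: 1 + t <= exp t at t =
  y i / a - 1, where a is the mean, and these t add up to zero.\<close>

lemma prod_le_mean_power:
  fixes y :: "'i \<Rightarrow> real"
  assumes "finite S" "S \<noteq> {}" "\<And>i. i \<in> S \<Longrightarrow> y i \<ge> 0"
  shows "(\<Prod>i\<in>S. y i) \<le> ((\<Sum>i\<in>S. y i) / card S) ^ card S"
proof (cases "(\<Sum>i\<in>S. y i) = 0")
  case True
  then have "\<forall>i\<in>S. y i = 0" using assms by (simp add: sum_nonneg_eq_0_iff)
  then show ?thesis using assms True by (auto simp: prod_zero_iff)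
next
  case False
  define a where "a = (\<Sum>i\<in>S. y i) / card S"
  have c: "card S > 0" using assms by (simp add: card_gt_0_iff)
  have "(\<Sum>i\<in>S. y i) > 0" using False sum_nonneg[of S y, OF assms(3)] by linarith
  then have a: "a > 0" using c by (simp add: a_def)
  have "(\<Prod>i\<in>S. y i / a) \<le> (\<Prod>i\<in>S. exp (y i / a - 1))"
  proof (rule prod_mono)
    fix i assume "i \<in> S"
    then show "0 \<le> y i / a \<and> y i / a \<le> exp (y i / a - 1)"
      using assms(3) a exp_ge_add_one_self[of "y i / a - 1"] by auto
  qed
  also have "\<dots> = exp ((\<Sum>i\<in>S. y i) / a - card S)"
    using assms by (simp add: exp_sum[symmetric] sum_subtractf sum_divide_distrib)
  also have "(\<Sum>i\<in>S. y i) / a = card S" using False c by (simp add: a_def)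
  finally have "(\<Prod>i\<in>S. y i) / a ^ card S \<le> 1" by (simp add: prod_dividef)
  then show ?thesis using a by (simp add: a_def[symmetric] divide_le_eq)
qed

lemma prod_mono_ennreal:
  fixes f g :: "'i \<Rightarrow> ennreal"
  shows "(\<And>i. i \<in> S \<Longrightarrow> f i \<le> g i) \<Longrightarrow> (\<Prod>i\<in>S. f i) \<le> (\<Prod>i\<in>S. g i)"
  by (induction S rule: infinite_finite_induct) (auto intro: mult_mono)

text \<open>Normalise each \<open>h i\<close> by its integral, bound \<open>F\<close> pointwise by
  the arithmetic mean of the normalised functions times the geometric mean of the integrals, and
  integrate.\<close>

lemma nn_integral_prod_le_aux:
  fixes F :: "'a \<Rightarrow> ennreal" and h :: "'i \<Rightarrow> 'a \<Rightarrow> ennreal"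
  assumes S: "finite S" "S \<noteq> {}"
    and [measurable]: "F \<in> borel_measurable M" "\<And>i. i \<in> S \<Longrightarrow> h i \<in> borel_measurable M"
    and le: "\<And>x. F x ^ card S \<le> (\<Prod>i\<in>S. h i x)"
  shows "(\<integral>\<^sup>+x. F x \<partial>M) ^ card S \<le> (\<Prod>i\<in>S. \<integral>\<^sup>+x. h i x \<partial>M)"
proof -
  define m where "m = card S"
  have m: "m > 0" using S by (simp add: m_def card_gt_0_iff)
  define A where "A i = (\<integral>\<^sup>+x. h i x \<partial>M)" for i
  \<comment> \<open>The zero case comes first because \<open>0 * top = 0\<close> in
    \<open>ennreal\<close>: an infinite integral makes the product infinite only if no other one
    vanishes.\<close>
  consider "\<exists>i\<in>S. A i = 0" | "\<forall>i\<in>S. A i \<noteq> 0" "\<exists>i\<in>S. A i = top" | "\<forall>i\<in>S. A i \<noteq> 0 \<and> A i \<noteq> top" by blast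
  then show ?thesis
  proof cases
    case 1
    then obtain i where i: "i \<in> S" "A i = 0" by blast
    then have "AE x in M. h i x = 0" by (simp add: A_def nn_integral_0_iff_AE)
    then have "AE x in M. F x = 0"
    proof eventually_elim
      case (elim x)
      then have "(\<Prod>i\<in>S. h i x) = 0" using S i by auto
      with le[of x] have "F x ^ m \<le> 0" by (simp only: m_def)
      then show ?case using m by simp
    qed
    then have "(\<integral>\<^sup>+x. F x \<partial>M) = 0" by (simp add: nn_integral_0_iff_AE)
    then show ?thesis using m by (simp add: m_def power_0_left)
  next
    case 2
    then obtain i where i: "i \<in> S" "A i = top" by blast
    have "(\<Prod>i\<in>S. A i) = A i * (\<Prod>i\<in>S - {i}. A i)" using S i by (simp add: prod.remove)
    also have "\<dots> = top" using 2 i S by (simp add: ennreal_top_mult)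
    finally show ?thesis by (simp add: A_def)
  next
    case 3
    define a where "a i = enn2real (A i)" for i
    have a: "A i = ennreal (a i)" "a i > 0" if "i \<in> S" for i
      using 3 that by (auto simp: a_def less_top enn2real_positive_iff zero_less_iff_neq_zero)
    \<comment> \<open>The geometric mean of the integrals. The weights \<open>P / (m * a i)\<close>
      are chosen so that every summand has integral \<open>P / m\<close>.\<close>
    define P where "P = root m (\<Prod>i\<in>S. a i)"
    have prod_pos: "(\<Prod>i\<in>S. a i) > 0" using a by (intro prod_pos) auto
    have P: "P > 0" "P ^ m = (\<Prod>i\<in>S. a i)"
      using m prod_pos by (auto simp: P_def real_root_gt_zero)
    have coeff: "P / (m * a i) > 0" if "i \<in> S" for i using P a m that by auto
    have pw: "F x \<le> (\<Sum>i\<in>S. ennreal (P / (m * a i)) * h i x)" for x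
    proof (cases "\<exists>i\<in>S. h i x = top")
      case True
      then obtain i where i: "i \<in> S" "h i x = top" by blast
      then have "ennreal (P / (m * a i)) * h i x = top"
        using P m a[OF i(1)] by (simp add: ennreal_mult_top)
      then have "(\<Sum>i\<in>S. ennreal (P / (m * a i)) * h i x) = top" using i S by (simp add: sum.remove)
      then show ?thesis by simp
    next
      case False
      define y where "y i = enn2real (h i x)" for i
      have y: "h i x = ennreal (y i)" "y i \<ge> 0" if "i \<in> S" for i
        using False that by (auto simp: y_def less_top)
      have prod: "(\<Prod>i\<in>S. h i x) = ennreal (\<Prod>i\<in>S. y i)"
        using y by (simp add: prod_ennreal)
      have "F x ^ m < top"
        using le[of x] unfolding prod m_def by (rule le_less_trans) simp
      then have "F x < top" using m by (simp add: power_less_top_ennreal)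
      then obtain f where f: "F x = ennreal f" "f \<ge> 0" by (cases "F x") auto
      have "f ^ m \<le> (\<Prod>i\<in>S. y i)"
        using le[of x] y unfolding prod f(1) m_def[symmetric]
        by (simp add: ennreal_power f(2) prod_nonneg)
      also have "\<dots> = P ^ m * (\<Prod>i\<in>S. y i / a i)"
        using prod_pos by (simp add: P(2) prod_dividef)
      also have "\<dots> \<le> P ^ m * ((\<Sum>i\<in>S. y i / a i) / m) ^ m"
      proof (rule mult_left_mono)
        show "(\<Prod>i\<in>S. y i / a i) \<le> ((\<Sum>i\<in>S. y i / a i) / m) ^ m"
          unfolding m_def by (rule prod_le_mean_power[OF S]) (simp add: y(2) a(2) less_imp_le)
        show "0 \<le> P ^ m" using P(1) by simp
      qed
      also have "\<dots> = (\<Sum>i\<in>S. P / (m * a i) * y i) ^ m"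
        by (simp add: power_mult_distrib[symmetric] sum_distrib_left sum_divide_distrib mult_ac)
      finally have "f \<le> (\<Sum>i\<in>S. P / (m * a i) * y i)"
        using m coeff y by (intro power_le_imp_le_base[of f "m - 1"] sum_nonneg mult_nonneg_nonneg) (auto intro: less_imp_le)
      then have "F x \<le> ennreal (\<Sum>i\<in>S. P / (m * a i) * y i)" by (simp add: f(1) ennreal_leI)
      also have "\<dots> = (\<Sum>i\<in>S. ennreal (P / (m * a i)) * h i x)"
      proof -
        have "ennreal (P / (m * a i)) * h i x = ennreal (P / (m * a i) * y i)" if "i \<in> S" for i
          unfolding y(1)[OF that] by (rule ennreal_mult[symmetric]) (use coeff y that in \<open>auto intro: less_imp_le\<close>)
        then have "(\<Sum>i\<in>S. ennreal (P / (m * a i)) * h i x) = (\<Sum>i\<in>S. ennreal (P / (m * a i) * y i))"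
          by (rule sum.cong[OF refl])
        also have "\<dots> = ennreal (\<Sum>i\<in>S. P / (m * a i) * y i)"
        proof (rule sum_ennreal)
          fix i assume "i \<in> S"
          with coeff y show "0 \<le> P / (m * a i) * y i" by (intro mult_nonneg_nonneg) (auto intro: less_imp_le)
        qed
        finally show ?thesis by (rule sym)
      qed
      finally show ?thesis .
    qed
    have "(\<integral>\<^sup>+x. F x \<partial>M) \<le> (\<integral>\<^sup>+x. (\<Sum>i\<in>S. ennreal (P / (m * a i)) * h i x) \<partial>M)"
      by (intro nn_integral_mono pw)
    also have "\<dots> = (\<Sum>i\<in>S. ennreal (P / (m * a i)) * A i)"
      by (simp add: nn_integral_sum nn_integral_cmult A_def)
    also have "\<dots> = (\<Sum>i\<in>S. ennreal (P / m))"
    proof (rule sum.cong)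
      fix i assume i: "i \<in> S"
      have "ennreal (P / (m * a i)) * ennreal (a i) = ennreal (P / (m * a i) * a i)"
        using coeff[OF i] a[OF i] by (subst ennreal_mult) auto
      also have "P / (m * a i) * a i = P / m" using a(2)[OF i] by simp
      finally show "ennreal (P / (m * a i)) * A i = ennreal (P / m)" by (simp add: a(1)[OF i])
    qed simp
    also have "\<dots> = ennreal P"
      using P m by (subst sum_ennreal) (auto simp: m_def)
    finally have "(\<integral>\<^sup>+x. F x \<partial>M) ^ m \<le> ennreal P ^ m" by (intro power_mono) auto
    also have "\<dots> = (\<Prod>i\<in>S. A i)"
      using P a by (simp add: ennreal_power prod_ennreal[symmetric] less_imp_le)
    finally show ?thesis by (simp add: A_def m_def)
  qed
qed

text \<open>Hoelder's inequality for \<open>card S\<close> functions with equal exponents, in a form that needs no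
  roots of extended reals.\<close>

lemma nn_integral_prod_le:
  fixes F :: "'a \<Rightarrow> ennreal" and h :: "'i \<Rightarrow> 'a \<Rightarrow> ennreal"
  assumes S: "finite S" "S \<noteq> {}"
    and [measurable]: "F \<in> borel_measurable M" "\<And>i. i \<in> S \<Longrightarrow> h i \<in> borel_measurable M"
    and le: "\<And>x. F x ^ card S \<le> c * (\<Prod>i\<in>S. h i x)"
  shows "(\<integral>\<^sup>+x. F x \<partial>M) ^ card S \<le> c * (\<Prod>i\<in>S. \<integral>\<^sup>+x. h i x \<partial>M)"
proof -
  obtain j where j: "j \<in> S" using S by blast
  \<comment> \<open>The constant is absorbed into one factor, chosen arbitrarily; this also covers
    \<open>c = top\<close>.\<close>
  define h' where "h' i x = (if i = j then c * h i x else h i x)" for i x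
  have split: "(\<Prod>i\<in>S. if i = j then c * f i else f i) = c * (\<Prod>i\<in>S. f i)" for f :: "'i \<Rightarrow> ennreal"
  proof -
    have "(\<Prod>i\<in>S - {j}. if i = j then c * f i else f i) = (\<Prod>i\<in>S - {j}. f i)"
      by (rule prod.cong) auto
    then show ?thesis using S j by (simp add: prod.remove mult.assoc)
  qed
  have "(\<integral>\<^sup>+x. F x \<partial>M) ^ card S \<le> (\<Prod>i\<in>S. \<integral>\<^sup>+x. h' i x \<partial>M)"
  proof (rule nn_integral_prod_le_aux[OF S])
    show "h' i \<in> borel_measurable M" if "i \<in> S" for i
      using that unfolding h'_def by (cases "i = j") auto
    show "F x ^ card S \<le> (\<Prod>i\<in>S. h' i x)" for x
      using le[of x] by (simp add: h'_def split)
  qed measurable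
  also have "(\<Prod>i\<in>S. \<integral>\<^sup>+x. h' i x \<partial>M) = (\<Prod>i\<in>S. if i = j then c * (\<integral>\<^sup>+x. h i x \<partial>M) else (\<integral>\<^sup>+x. h i x \<partial>M))"
    by (rule prod.cong) (auto simp: h'_def nn_integral_cmult)
  finally show ?thesis by (simp add: split)
qed

text \<open>The integral of \<open>G\<close> over the affine subspace through \<open>x\<close> in
  the directions \<open>J\<close>. Keeping the full point \<open>x\<close> as argument leaves all
  intermediate functions on the same space; that the result is constant along \<open>J\<close> is
  \<open>integrate_out_shift\<close>.\<close>

definition integrate_out :: "'a::euclidean_space set \<Rightarrow> ('a \<Rightarrow> ennreal) \<Rightarrow> 'a \<Rightarrow> ennreal" where
  "integrate_out J G x = (\<integral>\<^sup>+t. G (x + (\<Sum>j\<in>J. t j *\<^sub>R j)) \<partial>(\<Pi>\<^sub>M j\<in>J. lborel))"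

interpretation lborel_product: product_sigma_finite "\<lambda>_. lborel :: real measure"
  by standard

lemma integrate_out_empty [simp]: "integrate_out {} G = G"
  by (rule ext) (simp add: integrate_out_def PiM_empty nn_integral_count_space_finite)

lemma integrate_out_measurable [measurable]:
  assumes J: "finite J" and [measurable]: "G \<in> borel_measurable borel"
  shows "integrate_out J G \<in> borel_measurable borel"
proof -
  interpret finite_product_sigma_finite "\<lambda>_. lborel :: real measure" J
    by standard (rule J)
  show ?thesis unfolding integrate_out_def by measurable
qed

lemma integrate_out_insert:
  assumes J: "finite J" "j \<notin> J" and [measurable]: "G \<in> borel_measurable borel"
  shows "integrate_out (insert j J) G x = (\<integral>\<^sup>+s. integrate_out J G (x + s *\<^sub>R j) \<partial>lborel)"
proof -
  have "integrate_out (insert j J) G x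
    = (\<integral>\<^sup>+s. \<integral>\<^sup>+t. G (x + (\<Sum>i\<in>insert j J. (t(j := s)) i *\<^sub>R i)) \<partial>(\<Pi>\<^sub>M j\<in>J. lborel) \<partial>lborel)"
    unfolding integrate_out_def by (rule lborel_product.product_nn_integral_insert_rev[OF J]) measurable
  also have "(\<lambda>s t. x + (\<Sum>i\<in>insert j J. (t(j := s)) i *\<^sub>R i)) = (\<lambda>s t. (x + s *\<^sub>R j) + (\<Sum>i\<in>J. t i *\<^sub>R i))"
  proof (intro ext)
    fix s t
    have "(\<Sum>i\<in>J. (t(j := s)) i *\<^sub>R i) = (\<Sum>i\<in>J. t i *\<^sub>R i)" using J by (intro sum.cong) auto
    then show "x + (\<Sum>i\<in>insert j J. (t(j := s)) i *\<^sub>R i) = (x + s *\<^sub>R j) + (\<Sum>i\<in>J. t i *\<^sub>R i)"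
      using J by (simp add: add.assoc)
  qed
  finally show ?thesis by (simp add: integrate_out_def fun_eq_iff)
qed

text \<open>Peeling off the integral in direction \<open>j\<close> leaves a one-dimensional integral
  over the whole line, which a shift does not change.\<close>

lemma integrate_out_shift:
  assumes J: "finite J" "j \<in> J" and G[measurable]: "G \<in> borel_measurable borel"
  shows "integrate_out J G (x + s *\<^sub>R j) = integrate_out J G x"
proof -
  have fin: "finite (J - {j})" using J by simp
  note [measurable] = integrate_out_measurable[OF fin G]
  have eq: "integrate_out J G y = (\<integral>\<^sup>+t. integrate_out (J - {j}) G (y + t *\<^sub>R j) \<partial>lborel)" for y
    using integrate_out_insert[OF fin _ G, of j y] J by (simp add: insert_absorb)
  show ?thesis
    using nn_integral_lborel_translate[of "\<lambda>t. integrate_out (J - {j}) G (x + t *\<^sub>R j)" s]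
    by (simp add: eq scaleR_add_left add_ac)
qed

lemma integrate_out_Basis:
  fixes G :: "'a::euclidean_space \<Rightarrow> ennreal"
  assumes [measurable]: "G \<in> borel_measurable borel"
  shows "integrate_out Basis G x = (\<integral>\<^sup>+y. G y \<partial>lborel)"
proof -
  have "integrate_out Basis G x = (\<integral>\<^sup>+y. G (y + x) \<partial>lborel)"
    unfolding integrate_out_def by (subst (2) lborel_eq) (simp add: nn_integral_distr add.commute)
  then show ?thesis by (simp add: nn_integral_lborel_translate)
qed

text \<open>Gagliardo's argument: the coordinates are integrated out one at a time; in each step the one
  factor not depending on the current coordinate is pulled out and Hoelder is applied to the other
  \<open>DIM('a) - 1\<close> factors.\<close>

lemma Gagliardo_induction:
  fixes F :: "'a::euclidean_space \<Rightarrow> ennreal" and G :: "'a \<Rightarrow> 'a \<Rightarrow> ennreal"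
  assumes n: "DIM('a) \<ge> 2" and F[measurable]: "F \<in> borel_measurable borel"
    and G: "\<And>b. b \<in> Basis \<Longrightarrow> G b \<in> borel_measurable borel"
    and le: "\<And>x. F x ^ (DIM('a) - 1) \<le> (\<Prod>b\<in>Basis. integrate_out {b} (G b) x)"
    and J: "finite J" "J \<subseteq> Basis"
  shows "integrate_out J F x ^ (DIM('a) - 1)
     \<le> (\<Prod>i\<in>J. integrate_out J (G i) x) * (\<Prod>i\<in>Basis - J. integrate_out (insert i J) (G i) x)"
  using J
proof (induction J arbitrary: x rule: finite_induct)
  case empty
  then show ?case using le by simp
next
  case (insert j J)
  have j: "j \<in> Basis" "j \<notin> J" and JB: "J \<subseteq> Basis" using insert by auto
  define S where "S = Basis - {j}"
  have S: "finite S" "card S = DIM('a) - 1" "S \<noteq> {}"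
  proof -
    show "finite S" "card S = DIM('a) - 1" using j by (auto simp: S_def)
    then show "S \<noteq> {}" using n by auto
  qed
  have SJ: "S = J \<union> (Basis - insert j J)" "J \<inter> (Basis - insert j J) = {}"
    using j JB by (auto simp: S_def)
  have split: "(\<Prod>i\<in>S. if i \<in> J then p i else q i) = (\<Prod>i\<in>J. p i) * (\<Prod>i\<in>Basis - insert j J. q i)"
    for p q :: "'a \<Rightarrow> ennreal"
    unfolding SJ(1) by (subst prod.union_disjoint) (use insert SJ(2) in \<open>auto intro!: arg_cong2[where f = times] prod.cong\<close>)
  \<comment> \<open>These are the factors that vary along \<open>j\<close>, both those with
    \<open>i\<close> already integrated and those with \<open>i\<close> still to come. The remaining
    factor, for \<open>i = j\<close>, has been integrated along \<open>j\<close> and is the constant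
    \<open>c\<close> below.\<close>
  define h where "h i s = (if i \<in> J then integrate_out J (G i) (x + s *\<^sub>R j) else integrate_out (insert i J) (G i) (x + s *\<^sub>R j))" for i s
  define c where "c = integrate_out (insert j J) (G j) x"
  have SB: "i \<in> Basis" if "i \<in> S" for i using that by (simp add: S_def)
  have "(\<integral>\<^sup>+s. integrate_out J F (x + s *\<^sub>R j) \<partial>lborel) ^ card S \<le> c * (\<Prod>i\<in>S. \<integral>\<^sup>+s. h i s \<partial>lborel)"
  proof (rule nn_integral_prod_le)
    note [measurable] = integrate_out_measurable[OF insert(1) F]
    show "(\<lambda>s. integrate_out J F (x + s *\<^sub>R j)) \<in> borel_measurable lborel" by measurable
    show "h i \<in> borel_measurable lborel" if "i \<in> S" for i
    proof -
      have "finite (insert i J)" using insert by simp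
      note [measurable] = integrate_out_measurable[OF this G[OF SB[OF that]]] integrate_out_measurable[OF insert(1) G[OF SB[OF that]]]
      show ?thesis unfolding h_def by (cases "i \<in> J") (simp_all, measurable)
    qed
    fix s
    have "integrate_out J F (x + s *\<^sub>R j) ^ (DIM('a) - 1)
     \<le> (\<Prod>i\<in>J. integrate_out J (G i) (x + s *\<^sub>R j)) * (\<Prod>i\<in>Basis - J. integrate_out (insert i J) (G i) (x + s *\<^sub>R j))"
      by (rule insert.IH[OF JB])
    also have "(\<Prod>i\<in>Basis - J. integrate_out (insert i J) (G i) (x + s *\<^sub>R j))
       = integrate_out (insert j J) (G j) (x + s *\<^sub>R j) * (\<Prod>i\<in>Basis - insert j J. integrate_out (insert i J) (G i) (x + s *\<^sub>R j))"
      using j by (subst prod.remove[of _ j]) (auto simp: Diff_insert2[symmetric] Diff_insert[symmetric] intro!: prod.cong)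
    also have "integrate_out (insert j J) (G j) (x + s *\<^sub>R j) = c"
      unfolding c_def using insert G[OF j(1)] by (intro integrate_out_shift) auto
    finally show "integrate_out J F (x + s *\<^sub>R j) ^ card S \<le> c * (\<Prod>i\<in>S. h i s)"
      unfolding h_def split S(2) by (simp add: mult_ac)
  qed (use S in auto)
  also have "(\<integral>\<^sup>+s. integrate_out J F (x + s *\<^sub>R j) \<partial>lborel) = integrate_out (insert j J) F x"
    using insert F by (simp add: integrate_out_insert)
  also have "(\<Prod>i\<in>S. \<integral>\<^sup>+s. h i s \<partial>lborel)
     = (\<Prod>i\<in>S. if i \<in> J then integrate_out (insert j J) (G i) x else integrate_out (insert i (insert j J)) (G i) x)"
  proof (rule prod.cong)
    fix i assume i: "i \<in> S"
    then have ij: "i \<noteq> j" by (simp add: S_def)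
    show "(\<integral>\<^sup>+s. h i s \<partial>lborel) = (if i \<in> J then integrate_out (insert j J) (G i) x else integrate_out (insert i (insert j J)) (G i) x)"
    proof (cases "i \<in> J")
      case True
      then show ?thesis using insert G[OF SB[OF i]] by (simp add: h_def integrate_out_insert)
    next
      case False
      then show ?thesis
        using insert G[OF SB[OF i]] ij integrate_out_insert[of "insert i J" j "G i" x]
        by (simp add: h_def insert_commute)
    qed
  qed simp
  finally show ?case
    using insert by (simp add: split S(2) c_def mult.assoc)
qed

lemma Gagliardo_inequality:
  fixes F :: "'a::euclidean_space \<Rightarrow> ennreal" and G :: "'a \<Rightarrow> 'a \<Rightarrow> ennreal"
  assumes n: "DIM('a) \<ge> 2" and F[measurable]: "F \<in> borel_measurable borel"
    and G: "\<And>b. b \<in> Basis \<Longrightarrow> G b \<in> borel_measurable borel"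
    and le: "\<And>x. F x ^ (DIM('a) - 1) \<le> (\<Prod>b\<in>Basis. \<integral>\<^sup>+s. G b (x + s *\<^sub>R b) \<partial>lborel)"
  shows "(\<integral>\<^sup>+x. F x \<partial>lborel) ^ (DIM('a) - 1) \<le> (\<Prod>b\<in>Basis. \<integral>\<^sup>+x. G b x \<partial>lborel)"
proof -
  have "integrate_out {b} (G b) x = (\<integral>\<^sup>+s. G b (x + s *\<^sub>R b) \<partial>lborel)" if "b \<in> Basis" for b x
    using integrate_out_insert[of "{}" b "G b" x] G[OF that] by simp
  then have "F x ^ (DIM('a) - 1) \<le> (\<Prod>b\<in>Basis. integrate_out {b} (G b) x)" for x
    using le[of x] by simp
  from Gagliardo_induction[OF n F G this, of Basis 0] show ?thesis
    using F G by (simp add: integrate_out_Basis)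
qed

text \<open>The segment formula over length N gives |w x| <= |w (x + N b)| + E x. The excess of |w|
  over E is therefore bounded by translates of |w|, and the square integral of w over a ball moving
  to infinity tends to zero. Square integrability thus replaces compact support.\<close>

lemma weak_partial_pointwise_bound:
  fixes w :: "'a::euclidean_space \<Rightarrow> complex"
  assumes w: "locally_integrable w" "integrable lborel (\<lambda>x. (norm (w x))\<^sup>2)"
    and g: "locally_integrable g" and b: "b \<in> Basis" and wp: "has_weak_partial b w g"
  shows "AE x in lborel. ennreal (norm (w x)) \<le> (\<integral>\<^sup>+s. ennreal (norm (g (x + s *\<^sub>R b))) \<partial>lborel)"
proof -
  note [measurable] = locally_integrable_measurable[OF w(1)] locally_integrable_measurable[OF g]
  define E where "E x = (\<integral>\<^sup>+s. ennreal (norm (g (x + s *\<^sub>R b))) \<partial>lborel)" for x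
  have [measurable]: "E \<in> borel_measurable borel" unfolding E_def by measurable
  \<comment> \<open>Subtraction in \<open>ennreal\<close> takes the positive part, and gives zero
    where \<open>E x\<close> is infinite.\<close>
  define p where "p x = ennreal (norm (w x)) - E x" for x
  have [measurable]: "p \<in> borel_measurable borel" unfolding p_def by measurable
  have p_le: "AE x in lborel. p x \<le> ennreal (norm (w (x + real N *\<^sub>R b)))" for N
    using weak_partial_segment[OF w(1) g b wp, of "real N", OF of_nat_0_le_iff]
  proof eventually_elim
    case (elim x)
    have "ennreal (norm (segment_integral (real N) b g x)) \<le> (\<integral>\<^sup>+s. ennreal (norm (indicator {0..real N} s *\<^sub>R g (x + s *\<^sub>R b))) \<partial>lborel)"
    proof (cases "integrable lborel (\<lambda>s. indicator {0..real N} s *\<^sub>R g (x + s *\<^sub>R b))")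
      case True
      then show ?thesis unfolding segment_integral_def by (rule integral_norm_bound_ennreal)
    qed (simp add: segment_integral_def not_integrable_integral_eq)
    also have "\<dots> \<le> E x"
      unfolding E_def by (intro nn_integral_mono) (simp add: indicator_def)
    finally have s: "ennreal (norm (segment_integral (real N) b g x)) \<le> E x" .
    have "w x = w (x + real N *\<^sub>R b) - segment_integral (real N) b g x" using elim by (simp add: algebra_simps)
    then have "norm (w x) \<le> norm (w (x + real N *\<^sub>R b)) + norm (segment_integral (real N) b g x)"
      by (metis norm_triangle_ineq4)
    then have "ennreal (norm (w x)) \<le> ennreal (norm (w (x + real N *\<^sub>R b))) + ennreal (norm (segment_integral (real N) b g x))"
      by (simp add: ennreal_plus[symmetric] ennreal_leI del: ennreal_plus)
    also have "\<dots> \<le> E x + ennreal (norm (w (x + real N *\<^sub>R b)))"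
      using s by (simp add: add.commute add_left_mono)
    finally show ?case
      unfolding p_def by (simp add: ennreal_minus_le_iff)
  qed
  have "AE x in lborel. indicator (cball 0 (real R)) x * p x ^ 2 = 0" for R :: nat
  proof -
    let ?K = "cball 0 (real R) :: 'a set"
    let ?f = "\<lambda>N x. indicator ?K (x - real N *\<^sub>R b) * ennreal ((norm (w x))\<^sup>2)"
    have "(\<lambda>N. \<integral>\<^sup>+x. ?f N x \<partial>lborel) \<longlonglongrightarrow> (\<integral>\<^sup>+x. 0 \<partial>(lborel :: 'a measure))"
    proof (rule nn_integral_dominated_convergence)
      show "AE x in lborel. ?f N x \<le> ennreal ((norm (w x))\<^sup>2)" for N by (simp add: indicator_def)
      show "(\<integral>\<^sup>+x. ennreal ((norm (w x))\<^sup>2) \<partial>lborel) < \<infinity>"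
        using w(2) by (simp add: integrable_iff_bounded)
      show "AE x in lborel. (\<lambda>N. ?f N x) \<longlonglongrightarrow> 0"
      proof (rule AE_I2)
        fix x
        have "\<forall>\<^sub>F N in sequentially. ?f N x = 0"
        proof (rule eventually_sequentiallyI)
          fix N assume N: "nat \<lceil>real R + norm x + 1\<rceil> \<le> N"
          then have "real R + norm x + 1 \<le> real N" by linarith
          moreover have "real N \<le> norm (x - real N *\<^sub>R b) + norm x"
            using norm_triangle_ineq4[of x "x - real N *\<^sub>R b"] b by simp
          ultimately show "?f N x = 0" by (simp add: indicator_def)
        qed
        then show "(\<lambda>N. ?f N x) \<longlonglongrightarrow> 0" by (rule tendsto_eventually)
      qed
    qed measurable
    then have lim: "(\<lambda>N. \<integral>\<^sup>+x. ?f N x \<partial>lborel) \<longlonglongrightarrow> 0" by simp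
    have "(\<integral>\<^sup>+x. indicator ?K x * p x ^ 2 \<partial>lborel) \<le> (\<integral>\<^sup>+x. ?f N x \<partial>lborel)" for N
    proof -
      have "(\<integral>\<^sup>+x. indicator ?K x * p x ^ 2 \<partial>lborel) \<le> (\<integral>\<^sup>+x. ?f N (x + real N *\<^sub>R b) \<partial>lborel)"
      proof (rule nn_integral_mono_AE)
        show "AE x in lborel. indicator ?K x * p x ^ 2 \<le> ?f N (x + real N *\<^sub>R b)"
          using p_le[of N]
        proof eventually_elim
          case (elim x)
          then have "p x ^ 2 \<le> ennreal ((norm (w (x + real N *\<^sub>R b)))\<^sup>2)"
            using power_mono[OF elim, of 2] by (simp add: ennreal_power)
          then show ?case by (simp add: mult_left_mono)
        qed
      qed
      also have "\<dots> = (\<integral>\<^sup>+x. ?f N x \<partial>lborel)"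
        by (rule nn_integral_lborel_translate[of "?f N"]) measurable
      finally show ?thesis .
    qed
    then have "(\<integral>\<^sup>+x. indicator ?K x * p x ^ 2 \<partial>lborel) \<le> 0"
      by (intro LIMSEQ_le_const[OF lim]) blast
    then show ?thesis by (simp add: nn_integral_0_iff_AE)
  qed
  then have "AE x in lborel. \<forall>R::nat. indicator (cball 0 (real R)) x * p x ^ 2 = 0"
    by (intro AE_all_countable[THEN iffD2] allI)
  then show ?thesis
  proof eventually_elim
    case (elim x)
    obtain R :: nat where "norm x \<le> real R" using real_arch_simple by blast
    with elim[rule_format, of R] have "p x = 0" by simp
    then show ?case by (simp add: p_def E_def diff_eq_0_iff_ennreal)
  qed
qed

text \<open>\<open>F\<close> stands for |w|^(n / (n - 1)). Prescribing it through integer powers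
  keeps fractional powers out of \<open>ennreal\<close>.\<close>

lemma Gagliardo_weak:
  fixes w :: "'a::euclidean_space \<Rightarrow> complex" and g :: "'a \<Rightarrow> 'a \<Rightarrow> complex"
  assumes n: "DIM('a) \<ge> 2"
    and w: "locally_integrable w" "integrable lborel (\<lambda>x. (norm (w x))\<^sup>2)"
    and g: "\<And>b. b \<in> Basis \<Longrightarrow> locally_integrable (g b)"
    and wp: "\<And>b. b \<in> Basis \<Longrightarrow> has_weak_partial b w (g b)"
    and F[measurable]: "F \<in> borel_measurable borel"
    and le: "\<And>x. F x ^ (DIM('a) - 1) \<le> ennreal (norm (w x)) ^ DIM('a)"
  shows "(\<integral>\<^sup>+x. F x \<partial>lborel) ^ (DIM('a) - 1) \<le> (\<Prod>b\<in>Basis. \<integral>\<^sup>+x. ennreal (norm (g b x)) \<partial>lborel)"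
proof -
  note [measurable] = locally_integrable_measurable[OF w(1)]
  have [measurable]: "g b \<in> borel_measurable borel" if "b \<in> Basis" for b
    using g[OF that] by (rule locally_integrable_measurable)
  define E where "E b x = (\<integral>\<^sup>+s. ennreal (norm (g b (x + s *\<^sub>R b))) \<partial>lborel)" for b x
  have E[measurable]: "E b \<in> borel_measurable borel" if "b \<in> Basis" for b
    using that unfolding E_def by measurable
  define Q where "Q x \<longleftrightarrow> (\<forall>b\<in>Basis. ennreal (norm (w x)) \<le> E b x)" for x
  have Q[measurable]: "Measurable.pred borel Q"
    unfolding Q_def by measurable
  have AE_Q: "AE x in lborel. Q x"
    unfolding Q_def E_def
    by (intro AE_finite_allI finite_Basis weak_partial_pointwise_bound[OF w g _ wp]) auto
  \<comment> \<open>\<open>Gagliardo_inequality\<close> wants its hypothesis at every point, while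
    the bound by line integrals holds almost everywhere; \<open>F\<close> is set to zero on the
    exceptional set.\<close>
  define F' where "F' x = (if Q x then F x else 0)" for x
  have [measurable]: "F' \<in> borel_measurable borel" unfolding F'_def by measurable
  have "(\<integral>\<^sup>+x. F' x \<partial>lborel) ^ (DIM('a) - 1) \<le> (\<Prod>b\<in>Basis. \<integral>\<^sup>+x. ennreal (norm (g b x)) \<partial>lborel)"
  proof (rule Gagliardo_inequality[OF n])
    show "(\<lambda>x. ennreal (norm (g b x))) \<in> borel_measurable borel" if "b \<in> Basis" for b
      using that by measurable
    fix x
    show "F' x ^ (DIM('a) - 1) \<le> (\<Prod>b\<in>Basis. \<integral>\<^sup>+s. ennreal (norm (g b (x + s *\<^sub>R b))) \<partial>lborel)"
    proof (cases "Q x")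
      case True
      have "F x ^ (DIM('a) - 1) \<le> (\<Prod>b\<in>(Basis::'a set). ennreal (norm (w x)))" using le[of x] by simp
      also have "\<dots> \<le> (\<Prod>b\<in>Basis. E b x)" using True by (intro prod_mono_ennreal) (simp add: Q_def)
      finally show ?thesis using True by (simp add: F'_def E_def)
    next
      case False
      then show ?thesis using n by (simp add: F'_def power_0_left)
    qed
  qed measurable
  also have "(\<integral>\<^sup>+x. F' x \<partial>lborel) = (\<integral>\<^sup>+x. F x \<partial>lborel)"
    by (intro nn_integral_cong_AE) (use AE_Q in eventually_elim, simp add: F'_def)
  finally show ?thesis .
qed

section \<open>Truncated powers and the Sobolev inequality\<close>

text \<open>As \<open>e \<rightarrow> 0\<close>, \<open>truncated_power e p z\<close> tends to \<open>z |z|\<^sup>2\<^sup>p\<close>; for fixed \<open>e\<close> it is Lipschitz.\<close>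

definition truncated_square :: "real \<Rightarrow> complex \<Rightarrow> real" where
  "truncated_square e z = (norm z)\<^sup>2 / (1 + e * (norm z)\<^sup>2)"

definition truncated_power :: "real \<Rightarrow> real \<Rightarrow> complex \<Rightarrow> complex" where
  "truncated_power e p z = (truncated_square e z powr p) *\<^sub>R z"

text \<open>At \<open>z = 0\<close> this is the zero map because \<open>0 powr p = 0\<close>.\<close>

definition truncated_power_deriv :: "real \<Rightarrow> real \<Rightarrow> complex \<Rightarrow> complex \<Rightarrow> complex" where
  "truncated_power_deriv e p z h = (truncated_square e z powr p) *\<^sub>R h
     + (2 * p * truncated_square e z powr (p - 1) / (1 + e * (norm z)\<^sup>2)\<^sup>2 * (z \<bullet> h)) *\<^sub>R z"

lemma truncated_square_0 [simp]: "truncated_square e 0 = 0"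
  by (simp add: truncated_square_def)

lemma truncated_square_measurable [measurable]:
  assumes [measurable]: "u \<in> borel_measurable M"
  shows "(\<lambda>x. truncated_square e (u x)) \<in> borel_measurable M"
  unfolding truncated_square_def by measurable

lemma truncated_power_measurable [measurable]:
  assumes [measurable]: "u \<in> borel_measurable M"
  shows "(\<lambda>x. truncated_power e p (u x)) \<in> borel_measurable M"
  unfolding truncated_power_def by measurable

lemma truncated_power_deriv_measurable [measurable]:
  assumes [measurable]: "u \<in> borel_measurable M" "g \<in> borel_measurable M"
  shows "(\<lambda>x. truncated_power_deriv e p (u x) (g x)) \<in> borel_measurable M"
  unfolding truncated_power_deriv_def by measurable

lemma truncated_power_0: "truncated_power e p 0 = 0"
  by (simp add: truncated_power_def)

lemma norm_truncated_power: "norm (truncated_power e p z) = truncated_square e z powr p * norm z"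
  by (simp add: truncated_power_def)

context
  fixes e :: real
  assumes e: "e > 0"
begin

lemma truncation_denominator_pos: "1 + e * (norm z)\<^sup>2 > 0"
  using e by (simp add: add_pos_nonneg)

lemma truncated_square_nonneg: "0 \<le> truncated_square e z"
  using truncation_denominator_pos[of z] by (simp add: truncated_square_def)

lemma truncated_square_pos: "z \<noteq> 0 \<Longrightarrow> 0 < truncated_square e z"
  using truncation_denominator_pos[of z] by (simp add: truncated_square_def)

lemma truncated_square_le_square: "truncated_square e z \<le> (norm z)\<^sup>2"
proof -
  have "(norm z)\<^sup>2 * 1 \<le> (norm z)\<^sup>2 * (1 + e * (norm z)\<^sup>2)"
    using e by (intro mult_left_mono) auto
  then show ?thesis
    using truncation_denominator_pos[of z] by (simp add: truncated_square_def divide_le_eq)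
qed

lemma truncated_square_le_inverse: "truncated_square e z \<le> 1 / e"
  unfolding truncated_square_def using e truncation_denominator_pos[of z] by (simp add: divide_simps)

lemma truncated_power_has_derivative:
  assumes p: "p > 0"
  shows "(truncated_power e p has_derivative truncated_power_deriv e p z) (at z)"
proof (cases "z = 0")
  case True
  have "(truncated_power e p has_derivative (\<lambda>_. 0)) (at 0)"
  proof (rule has_derivative_zero_at_zero)
    show "norm (truncated_power e p x) \<le> norm x * truncated_square e x powr p" for x
      by (simp add: truncated_power_def mult.commute)
    have "((\<lambda>x::complex. (norm x)\<^sup>2) \<longlongrightarrow> (norm (0::complex))\<^sup>2) (at 0)" by (intro tendsto_intros)
    then have "((\<lambda>x. truncated_square e x) \<longlongrightarrow> 0) (at 0)"
      by (intro tendsto_sandwich[of "\<lambda>_. 0" "truncated_square e" "at 0" "\<lambda>x. (norm x)\<^sup>2" 0])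
         (simp_all add: truncated_square_nonneg truncated_square_le_square)
    then show "((\<lambda>x. truncated_square e x powr p) \<longlongrightarrow> 0) (at 0)"
      by (rule tendsto_zero_powrI[OF _ tendsto_const]) (use p truncated_square_nonneg in auto)
  qed
  moreover have "truncated_power_deriv e p 0 = (\<lambda>_. 0)"
    by (simp add: truncated_power_deriv_def fun_eq_iff)
  ultimately show ?thesis using True by simp
next
  case False
  note d = truncation_denominator_pos[of z]
  have DERIV: "((\<lambda>a. a / (1 + e * a)) has_real_derivative 1 / (1 + e * a)\<^sup>2) (at a)" if "1 + e * a > 0" for a
    using that by (auto intro!: derivative_eq_intros simp: divide_simps power2_eq_square)
  have "((\<lambda>z. z \<bullet> z) has_derivative (\<lambda>h. 2 * (z \<bullet> h))) (at z)"
    by (auto intro!: derivative_eq_intros simp: inner_commute)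
  from has_derivative_compose[OF this DERIV[unfolded has_field_derivative_def]]
  have "((\<lambda>z. (z \<bullet> z) / (1 + e * (z \<bullet> z))) has_derivative
      (\<lambda>h. 2 * (z \<bullet> h) / (1 + e * (norm z)\<^sup>2)\<^sup>2)) (at z)"
    using d by (simp add: dot_square_norm)
  moreover have "truncated_square e = (\<lambda>z. (z \<bullet> z) / (1 + e * (z \<bullet> z)))"
    by (simp add: truncated_square_def fun_eq_iff power2_norm_eq_inner)
  ultimately have "(truncated_square e has_derivative (\<lambda>h. 2 * (z \<bullet> h) / (1 + e * (norm z)\<^sup>2)\<^sup>2)) (at z)" by simp
  from has_derivative_compose[OF this has_real_derivative_powr[OF truncated_square_pos[OF False], unfolded has_field_derivative_def]]
  have "((\<lambda>z. truncated_square e z powr p) has_derivative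
      (\<lambda>h. p * truncated_square e z powr (p - 1) * (2 * (z \<bullet> h) / (1 + e * (norm z)\<^sup>2)\<^sup>2))) (at z)" .
  from has_derivative_scaleR[OF this has_derivative_ident]
  show ?thesis
    unfolding truncated_power_def[abs_def] truncated_power_deriv_def[abs_def]
    by (rule has_derivative_eq_rhs) (auto simp: fun_eq_iff mult_ac)
qed

text \<open>One factor 1 / (1 + e |z|^2) combines with |z|^2 to \<open>truncated_square e z\<close>,
  the other is at most 1. The result is the same constant as without truncation, whatever
  \<open>e\<close> is.\<close>

lemma truncated_power_deriv_coeff:
  assumes p: "p > 0"
  shows "2 * p * truncated_square e z powr (p - 1) / (1 + e * (norm z)\<^sup>2)\<^sup>2 * (norm z)\<^sup>2
     \<le> 2 * p * truncated_square e z powr p"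
proof (cases "z = 0")
  case False
  let ?s = "truncated_square e z" and ?d = "1 + e * (norm z)\<^sup>2"
  have d: "?d \<ge> 1" using e by simp
  have s: "?s > 0" by (rule truncated_square_pos[OF False])
  have sp: "?s powr (p - 1) * ?s = ?s powr p" using s by (simp add: powr_diff)
  have "2 * p * ?s powr (p - 1) / ?d\<^sup>2 * (norm z)\<^sup>2 = 2 * p * (?s powr (p - 1) * ((norm z)\<^sup>2 / ?d)) / ?d"
    by (simp add: power2_eq_square)
  also have "\<dots> = 2 * p * ?s powr p / ?d"
    unfolding sp[symmetric] by (simp add: truncated_square_def)
  also have "\<dots> \<le> 2 * p * ?s powr p"
  proof -
    have "2 * p * ?s powr p * 1 \<le> 2 * p * ?s powr p * ?d"
      using p by (intro mult_left_mono d) simp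
    moreover have "?d > 0" using d by linarith
    ultimately show ?thesis by (simp only: divide_le_eq if_True mult_1_right)
  qed
  finally show ?thesis .
qed (use p in simp)

lemma norm_truncated_power_deriv_le:
  assumes p: "p > 0"
  shows "norm (truncated_power_deriv e p z h) \<le> (1 + 2 * p) * truncated_square e z powr p * norm h"
proof -
  let ?s = "truncated_square e z"
  let ?c = "2 * p * ?s powr (p - 1) / (1 + e * (norm z)\<^sup>2)\<^sup>2"
  have c: "?c \<ge> 0" using p by simp
  have "norm (truncated_power_deriv e p z h) \<le> ?s powr p * norm h + ?c * \<bar>z \<bullet> h\<bar> * norm z"
    unfolding truncated_power_deriv_def
    by (rule order_trans[OF norm_triangle_ineq]) (use p in \<open>simp add: abs_mult\<close>)
  also have "?c * \<bar>z \<bullet> h\<bar> * norm z \<le> ?c * (norm z * norm h) * norm z"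
    using c Cauchy_Schwarz_ineq2[of z h] by (intro mult_right_mono mult_left_mono) auto
  also have "\<dots> = (?c * (norm z)\<^sup>2) * norm h" by (simp add: power2_eq_square mult_ac)
  also have "\<dots> \<le> (2 * p * ?s powr p) * norm h"
    by (intro mult_right_mono truncated_power_deriv_coeff[OF p]) simp
  finally show ?thesis by (simp add: algebra_simps)
qed

text \<open>Differentiating the weight contributes a nonnegative multiple of (z \<bullet> h)^2,
  which is dropped. This is the coercivity that turns the tested equation into a weighted gradient
  bound.\<close>

lemma Re_mult_cnj_truncated_power_deriv:
  assumes p: "p > 0"
  shows "truncated_square e z powr p * (norm h)\<^sup>2 \<le> Re (h * cnj (truncated_power_deriv e p z h))"
proof -
  define s where "s = truncated_square e z powr p"
  define c where "c = 2 * p * truncated_square e z powr (p - 1) / (1 + e * (norm z)\<^sup>2)\<^sup>2"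
  have c: "c \<ge> 0" using p by (simp add: c_def)
  have "Re (h * cnj w) = h \<bullet> w" for w by (simp add: inner_complex_def)
  then have "Re (h * cnj (truncated_power_deriv e p z h)) = h \<bullet> (s *\<^sub>R h + (c * (z \<bullet> h)) *\<^sub>R z)"
    by (simp only: truncated_power_deriv_def s_def c_def)
  also have "\<dots> = s * (norm h)\<^sup>2 + c * (z \<bullet> h)\<^sup>2"
    by (simp add: inner_add_right dot_square_norm inner_commute[of h z] power2_eq_square[of "z \<bullet> h"])
  finally show ?thesis using c by (simp add: s_def)
qed

text \<open>The constant blows up as \<open>e\<close> tends to zero. It serves to place the
  truncations in H^1 and does not enter the estimates.\<close>

lemma truncated_power_lipschitz:
  assumes p: "p > 0"
  shows "norm (truncated_power e p z - truncated_power e p w) \<le> (1 + 2 * p) * (1 / e) powr p * norm (z - w)"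
proof (rule differentiable_bound[of UNIV _ "truncated_power_deriv e p"])
  show "(truncated_power e p has_derivative truncated_power_deriv e p x) (at x within UNIV)" for x
    by (rule truncated_power_has_derivative[OF p])
  show "onorm (truncated_power_deriv e p x) \<le> (1 + 2 * p) * (1 / e) powr p" for x
  proof (rule onorm_le)
    fix h :: complex
    have "truncated_square e x powr p \<le> (1 / e) powr p"
      using truncated_square_nonneg truncated_square_le_inverse p by (intro powr_mono2) auto
    then have "(1 + 2 * p) * truncated_square e x powr p * norm h \<le> (1 + 2 * p) * (1 / e) powr p * norm h"
      using p by (intro mult_right_mono mult_left_mono) auto
    with norm_truncated_power_deriv_le[OF p, of x h]
    show "norm (truncated_power_deriv e p x h) \<le> (1 + 2 * p) * (1 / e) powr p * norm h" by linarith
  qed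
qed auto

end

section \<open>Square integrable Borel functions and their truncated powers\<close>

definition square_integrable :: "('a::euclidean_space \<Rightarrow> complex) \<Rightarrow> bool" where
  "square_integrable u \<longleftrightarrow> u \<in> borel_measurable borel \<and> integrable lborel (\<lambda>x. (norm (u x))\<^sup>2)"

abbreviation square_integral :: "('a::euclidean_space \<Rightarrow> complex) \<Rightarrow> real" where
  "square_integral u \<equiv> LINT x|lborel. (norm (u x))\<^sup>2"

lemma square_integrable_measurable [measurable_dest]:
  "square_integrable u \<Longrightarrow> u \<in> borel_measurable borel"
  by (simp add: square_integrable_def)

lemma square_integrable_integrable: "square_integrable u \<Longrightarrow> integrable lborel (\<lambda>x. (norm (u x))\<^sup>2)"
  by (simp add: square_integrable_def)

lemma nn_integral_square_integral:
  assumes "square_integrable u"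
  shows "(\<integral>\<^sup>+x. ennreal ((norm (u x))\<^sup>2) \<partial>lborel) = ennreal (square_integral u)"
  using assms by (intro nn_integral_eq_integral) (auto simp: square_integrable_def)

lemma square_integrable_bound:
  assumes f: "square_integrable f" and [measurable]: "g \<in> borel_measurable borel"
    and le: "\<And>x. norm (g x) \<le> C * norm (f x)"
  shows "square_integrable g"
  unfolding square_integrable_def
proof safe
  show "integrable lborel (\<lambda>x. (norm (g x))\<^sup>2)"
  proof (rule Bochner_Integration.integrable_bound)
    show "integrable lborel (\<lambda>x. C\<^sup>2 * (norm (f x))\<^sup>2)"
      by (intro integrable_mult_right square_integrable_integrable f)
    show "AE x in lborel. norm ((norm (g x))\<^sup>2) \<le> norm (C\<^sup>2 * (norm (f x))\<^sup>2)"
      using power_mono[OF le norm_ge_zero, of _ 2] by (intro AE_I2) (simp add: power_mult_distrib)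
  qed measurable
qed measurable

lemma square_integrable_imp_locally_integrable:
  assumes "square_integrable f"
  shows "locally_integrable f"
  unfolding locally_integrable_def
proof safe
  note [measurable] = square_integrable_measurable[OF assms]
  show "f \<in> borel_measurable borel" by measurable
  fix R
  show "integrable lborel (\<lambda>x. indicator (cball 0 R) x *\<^sub>R f x)"
  proof (rule Bochner_Integration.integrable_bound)
    have "emeasure lborel (cball 0 R :: 'a set) < \<infinity>"
      by (rule emeasure_lborel_cball_finite)
    then show "integrable lborel (\<lambda>x. indicator (cball 0 R) x + (norm (f x))\<^sup>2)"
      by (intro Bochner_Integration.integrable_add square_integrable_integrable assms) (simp add: integrable_indicator_iff)
    have "norm (indicator (cball 0 R) x *\<^sub>R f x) \<le> norm (indicator (cball 0 R) x + (norm (f x))\<^sup>2)" for x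
    proof -
      have "2 * norm (f x) \<le> 1 + (norm (f x))\<^sup>2"
        using sum_squares_bound[of 1 "norm (f x)"] by simp
      moreover have "0 \<le> norm (f x)" by simp
      ultimately have "norm (f x) \<le> 1 + (norm (f x))\<^sup>2" by linarith
      then show ?thesis by (simp add: indicator_def)
    qed
    then show "AE x in lborel. norm (indicator (cball 0 R) x *\<^sub>R f x) \<le> norm (indicator (cball 0 R) x + (norm (f x))\<^sup>2)"
      by (intro AE_I2)
  qed measurable
qed

lemma nn_integral_mult_le_sqrt:
  assumes f: "square_integrable f" and g: "square_integrable g"
  shows "(\<integral>\<^sup>+x. ennreal (norm (f x) * norm (g x)) \<partial>lborel)
    \<le> ennreal (sqrt (square_integral f) * sqrt (square_integral g))"
proof -
  note [measurable] = square_integrable_measurable[OF f] square_integrable_measurable[OF g]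
  let ?I = "\<integral>\<^sup>+x. ennreal (norm (f x) * norm (g x)) \<partial>lborel"
  have "?I\<^sup>2 = (\<integral>\<^sup>+x. ennreal (norm (f x)) * ennreal (norm (g x)) \<partial>lborel)\<^sup>2"
    by (simp add: ennreal_mult)
  also have "\<dots> \<le> (\<integral>\<^sup>+x. (ennreal (norm (f x)))\<^sup>2 \<partial>lborel) * (\<integral>\<^sup>+x. (ennreal (norm (g x)))\<^sup>2 \<partial>lborel)"
    by (rule Cauchy_Schwarz_nn_integral) measurable
  also have "\<dots> = ennreal (square_integral f) * ennreal (square_integral g)"
    by (simp add: ennreal_power nn_integral_square_integral f g)
  finally have le: "?I\<^sup>2 \<le> ennreal (square_integral f * square_integral g)"
    by (simp add: ennreal_mult)
  then have "?I\<^sup>2 < top" using ennreal_less_top le_less_trans by blast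
  then have "?I < top" by (simp add: power_less_top_ennreal)
  then obtain r where r: "?I = ennreal r" "r \<ge> 0" by (cases ?I) auto
  from le have "r\<^sup>2 \<le> square_integral f * square_integral g"
    unfolding r(1) ennreal_power[OF r(2)] by (simp add: ennreal_le_iff)
  then have "r \<le> sqrt (square_integral f * square_integral g)" by (rule real_le_rsqrt)
  then show ?thesis unfolding r(1) by (simp add: ennreal_leI real_sqrt_mult)
qed

lemma truncated_power_chain_rule:
  assumes e: "e > 0" and p: "p > 0" and b: "b \<in> Basis"
    and u: "square_integrable u" and g: "square_integrable g" and wp: "has_weak_partial b u g"
  shows "square_integrable (\<lambda>x. truncated_power e p (u x))"
    and "square_integrable (\<lambda>x. truncated_power_deriv e p (u x) (g x))"
    and "has_weak_partial b (\<lambda>x. truncated_power e p (u x)) (\<lambda>x. truncated_power_deriv e p (u x) (g x))"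
proof -
  note [measurable] = square_integrable_measurable[OF u] square_integrable_measurable[OF g]
  let ?L = "(1 + 2 * p) * (1 / e) powr p"
  show "square_integrable (\<lambda>x. truncated_power e p (u x))"
    using truncated_power_lipschitz[OF e p, of _ 0]
    by (intro square_integrable_bound[OF u, where C = ?L]) (auto simp: truncated_power_0)
  show "square_integrable (\<lambda>x. truncated_power_deriv e p (u x) (g x))"
  proof (intro square_integrable_bound[OF g, where C = ?L])
    fix x
    have "truncated_square e (u x) powr p \<le> (1 / e) powr p"
      using truncated_square_nonneg[OF e] truncated_square_le_inverse[OF e] p by (intro powr_mono2) auto
    then have "(1 + 2 * p) * truncated_square e (u x) powr p * norm (g x) \<le> ?L * norm (g x)"
      using p by (intro mult_right_mono mult_left_mono) auto
    with norm_truncated_power_deriv_le[OF e p, of "u x" "g x"]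
    show "norm (truncated_power_deriv e p (u x) (g x)) \<le> ?L * norm (g x)" by linarith
  qed measurable
  show "has_weak_partial b (\<lambda>x. truncated_power e p (u x)) (\<lambda>x. truncated_power_deriv e p (u x) (g x))"
    by (rule chain_rule_weak_partial(3)[OF square_integrable_imp_locally_integrable[OF u]
        square_integrable_imp_locally_integrable[OF g] b wp truncated_power_lipschitz[OF e p]
        truncated_power_0 truncated_power_has_derivative[OF e p]])
qed

lemma square_powr: "x \<ge> 0 \<Longrightarrow> (x\<^sup>2) powr r = x powr (2 * r)" for x :: real
proof -
  assume "x \<ge> 0"
  then have "x\<^sup>2 = x powr 2" by simp
  then show ?thesis by (simp only: powr_powr)
qed

text \<open>Fatou's lemma along e = 1 / (k + 1). Here bounds that are uniform in \<open>e\<close>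
  pass from truncations to \<open>u\<close> itself.\<close>

lemma nn_integral_powr_le_of_truncated:
  assumes [measurable]: "u \<in> borel_measurable borel" and r: "r > 0"
    and le: "\<And>e. e > 0 \<Longrightarrow> (\<integral>\<^sup>+x. ennreal (truncated_square e (u x) powr r) \<partial>lborel) \<le> B"
  shows "(\<integral>\<^sup>+x. ennreal (norm (u x) powr (2 * r)) \<partial>lborel) \<le> B"
proof -
  let ?t = "\<lambda>k x. ennreal (truncated_square (inverse (real (Suc k))) (u x) powr r)"
  have "(\<lambda>k. ?t k x) \<longlonglongrightarrow> ennreal (norm (u x) powr (2 * r))" for x
  proof (rule tendsto_ennrealI)
    have "(\<lambda>k. truncated_square (inverse (real (Suc k))) (u x)) \<longlonglongrightarrow> (norm (u x))\<^sup>2 / (1 + 0 * (norm (u x))\<^sup>2)"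
      unfolding truncated_square_def by (intro tendsto_intros LIMSEQ_inverse_real_of_nat) auto
    then have "(\<lambda>k. truncated_square (inverse (real (Suc k))) (u x)) \<longlonglongrightarrow> (norm (u x))\<^sup>2" by simp
    then have "(\<lambda>k. truncated_square (inverse (real (Suc k))) (u x) powr r) \<longlonglongrightarrow> ((norm (u x))\<^sup>2) powr r"
      by (rule tendsto_powr2[OF _ tendsto_const _ r])
         (intro always_eventually allI truncated_square_nonneg, simp)
    also have "((norm (u x))\<^sup>2) powr r = norm (u x) powr (2 * r)"
      by (rule square_powr) simp
    finally show "(\<lambda>k. truncated_square (inverse (real (Suc k))) (u x) powr r) \<longlonglongrightarrow> norm (u x) powr (2 * r)" .
  qed
  then have "(\<integral>\<^sup>+x. ennreal (norm (u x) powr (2 * r)) \<partial>lborel) = (\<integral>\<^sup>+x. liminf (\<lambda>k. ?t k x) \<partial>lborel)"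
    by (intro nn_integral_cong) (metis lim_imp_Liminf sequentially_bot)
  also have "\<dots> \<le> liminf (\<lambda>k. \<integral>\<^sup>+x. ?t k x \<partial>lborel)"
    by (rule nn_integral_liminf) measurable
  also have "\<dots> \<le> liminf (\<lambda>k::nat. B)"
    by (intro Liminf_mono always_eventually allI le) simp
  finally show ?thesis by (simp add: Liminf_const)
qed

text \<open>Dividing by A^(n / 2) leaves A^((n - 2) / 2) <= K^n. The division is legitimate because
  \<open>A\<close> is a real number, that is, finite.\<close>

lemma le_powr_of_power_le:
  fixes A K :: real
  assumes n: "n \<ge> 3" and A: "A \<ge> 0" and K: "K \<ge> 0" and le: "A ^ (n - 1) \<le> (K * sqrt A) ^ n"
  shows "A \<le> K powr (2 * real n / (real n - 2))"
proof (cases "A = 0")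
  case False
  with A have A: "A > 0" by simp
  have "A powr (real n - 1) = A ^ (n - 1)"
    using A n by (simp add: powr_realpow[symmetric] of_nat_diff)
  also have "\<dots> \<le> K ^ n * (sqrt A) ^ n" using le by (simp add: power_mult_distrib)
  also have "(sqrt A) ^ n = A powr (n / 2)"
    using A by (simp add: powr_half_sqrt[symmetric] powr_realpow[symmetric] powr_powr)
  finally have le': "A powr (real n - 1) \<le> K ^ n * A powr (n / 2)" .
  have "A powr ((real n - 2) / 2) = A powr (real n - 1) / A powr (n / 2)"
    using A by (simp add: powr_diff[symmetric] field_simps)
  also have "\<dots> \<le> K ^ n" using le' A by (simp add: divide_le_eq)
  finally have 1: "A powr ((real n - 2) / 2) \<le> K ^ n" .
  have "K > 0"
  proof (rule ccontr)
    assume "\<not> K > 0"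
    then have "K = 0" using K by simp
    then have "A powr ((real n - 2) / 2) \<le> 0" using 1 n by (simp add: power_0_left)
    then show False using A by (simp add: not_le[symmetric])
  qed
  then have "A powr ((real n - 2) / 2) \<le> K powr n" using 1 by (simp add: powr_realpow)
  then have "(A powr ((real n - 2) / 2)) powr (2 / (real n - 2)) \<le> (K powr n) powr (2 / (real n - 2))"
    using n by (intro powr_mono2) auto
  then show ?thesis using n A by (simp add: powr_powr mult.commute of_nat_diff)
qed simp

definition gradient_integral :: "('a::euclidean_space \<Rightarrow> 'a \<Rightarrow> complex) \<Rightarrow> real" where
  "gradient_integral g = (\<Sum>b\<in>Basis. square_integral (g b))"

lemma gradient_integral_nonneg: "0 \<le> gradient_integral g"
  unfolding gradient_integral_def by (intro sum_nonneg) simp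

lemma square_integral_le_gradient_integral: "b \<in> Basis \<Longrightarrow> square_integral (g b) \<le> gradient_integral g"
  unfolding gradient_integral_def by (rule member_le_sum) auto

text \<open>Gagliardo's bound is applied to a truncation w of u |u|^(2 p). Its gradient is at most 1
  + 2 p times \<open>truncated_square e (u x) powr p\<close> times the gradient of u, so
  Cauchy-Schwarz brings back the square root of the integral A to be estimated;
  \<open>le_powr_of_power_le\<close> then solves for A.\<close>

lemma Sobolev_truncated:
  fixes u :: "'a::euclidean_space \<Rightarrow> complex" and g :: "'a \<Rightarrow> 'a \<Rightarrow> complex"
  defines "n \<equiv> DIM('a)"
  defines "p \<equiv> real n / (2 * (real n - 2))"
  assumes n: "DIM('a) \<ge> 3" and e: "e > 0"
    and u: "square_integrable u" and g: "\<And>b. b \<in> Basis \<Longrightarrow> square_integrable (g b)"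
    and wp: "\<And>b. b \<in> Basis \<Longrightarrow> has_weak_partial b u (g b)"
  shows "(\<integral>\<^sup>+x. ennreal (truncated_square e (u x) powr (2 * p)) \<partial>lborel)
    \<le> ennreal (((1 + 2 * p) * sqrt (gradient_integral g)) powr (2 * real n / (real n - 2)))"
proof -
  have n': "n \<ge> 3" "real n > 2" using n by (auto simp: n_def)
  have p: "p > 0" "2 * p > 1" using n' by (auto simp: p_def field_simps)
  note [measurable] = square_integrable_measurable[OF u] square_integrable_measurable[OF g]
  let ?a = "\<lambda>x. truncated_square e (u x)"
  have a0: "?a x \<ge> 0" for x by (rule truncated_square_nonneg[OF e])
  let ?r = "\<lambda>x. complex_of_real (?a x powr p)"
  have pow2: "(?a x powr p)\<^sup>2 = ?a x powr (2 * p)" for x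
    using powr_powr[of "?a x" p 2] by (simp add: mult.commute)
  have r: "square_integrable ?r"
    unfolding square_integrable_def
  proof safe
    show "?r \<in> borel_measurable borel" using e by measurable
    show "integrable lborel (\<lambda>x. (norm (?r x))\<^sup>2)"
    proof (rule Bochner_Integration.integrable_bound)
      show "integrable lborel (\<lambda>x. (1 / e) powr (2 * p - 1) * (norm (u x))\<^sup>2)"
        by (intro integrable_mult_right square_integrable_integrable u)
      have "(norm (?r x))\<^sup>2 \<le> (1 / e) powr (2 * p - 1) * (norm (u x))\<^sup>2" for x
      proof -
        \<comment> \<open>Finiteness of A for fixed \<open>e\<close>: since
          \<open>2 * p > 1\<close>, one factor \<open>?a x\<close> can be split off and compared
          with |u|^2, while the rest is bounded in terms of \<open>e\<close>.\<close>
        have "(norm (?r x))\<^sup>2 = ?a x powr (2 * p - 1) * ?a x"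
          using a0[of x] by (cases "?a x = 0") (auto simp: pow2 powr_diff)
        also have "\<dots> \<le> (1 / e) powr (2 * p - 1) * (norm (u x))\<^sup>2"
          using p a0[of x] truncated_square_le_inverse[OF e, of "u x"] truncated_square_le_square[OF e, of "u x"]
          by (intro mult_mono powr_mono2) auto
        finally show ?thesis .
      qed
      then show "AE x in lborel. norm ((norm (?r x))\<^sup>2) \<le> norm ((1 / e) powr (2 * p - 1) * (norm (u x))\<^sup>2)"
        by (intro AE_I2) (simp only: real_norm_def abs_of_nonneg zero_le_power2 mult_nonneg_nonneg powr_ge_zero)
      show "(\<lambda>x. (norm (?r x))\<^sup>2) \<in> borel_measurable lborel" using e by measurable
    qed
  qed
  define A where "A = square_integral ?r"
  have A0: "A \<ge> 0" by (simp add: A_def)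
  have A: "(\<integral>\<^sup>+x. ennreal (?a x powr (2 * p)) \<partial>lborel) = ennreal A"
    using nn_integral_square_integral[OF r] by (simp add: A_def pow2)
  let ?w = "\<lambda>x. truncated_power e p (u x)"
  let ?g = "\<lambda>b x. truncated_power_deriv e p (u x) (g b x)"
  \<comment> \<open>The chain rule is stated for one direction at a time, so an arbitrary one is
    fixed in order to use the conclusion about \<open>?w\<close>.\<close>
  have b0: "(SOME i. i \<in> Basis) \<in> (Basis :: 'a set)" by (rule SOME_Basis)
  have w: "square_integrable ?w"
    using truncated_power_chain_rule(1)[OF e p(1) b0 u g[OF b0] wp[OF b0]] .
  define K where "K = (1 + 2 * p) * sqrt (gradient_integral g)"
  have K0: "K \<ge> 0" using p by (simp add: K_def gradient_integral_nonneg)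
  have "(\<integral>\<^sup>+x. ennreal (?a x powr (2 * p)) \<partial>lborel) ^ (DIM('a) - 1) \<le> (\<Prod>b\<in>Basis. \<integral>\<^sup>+x. ennreal (norm (?g b x)) \<partial>lborel)"
  proof (rule Gagliardo_weak)
    show "DIM('a) \<ge> 2" using n by simp
    show "locally_integrable ?w" "integrable lborel (\<lambda>x. (norm (?w x))\<^sup>2)"
      using w square_integrable_imp_locally_integrable square_integrable_integrable by auto
    show "locally_integrable (?g b)" "has_weak_partial b ?w (?g b)" if "b \<in> Basis" for b
      using truncated_power_chain_rule[OF e p(1) that u g[OF that] wp[OF that]]
      by (auto intro: square_integrable_imp_locally_integrable)
    show "(\<lambda>x. ennreal (?a x powr (2 * p))) \<in> borel_measurable borel" using e by measurable
    fix x
    have "(?a x powr (2 * p)) ^ (n - 1) \<le> (norm (?w x)) ^ n"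
    proof (cases "?a x = 0")
      case True
      then show ?thesis using n' by (simp add: power_0_left)
    next
      case False
      then have pos: "?a x > 0" using a0[of x] by simp
      have "(?a x powr (2 * p)) ^ (n - 1) = ?a x powr (2 * p * (real n - 1))"
        using pos n' by (simp add: powr_realpow[symmetric] powr_powr of_nat_diff)
      \<comment> \<open>This equation determines \<open>p\<close>. The summand 1/2 is the factor |z|
        in \<open>truncated_power\<close>, bounded below by the square root of
        \<open>truncated_square e z\<close>.\<close>
      also have "2 * p * (real n - 1) = (p + 1 / 2) * n"
        using n' by (simp add: p_def field_simps)
      also have "?a x powr ((p + 1 / 2) * n) = (?a x powr p * sqrt (?a x)) ^ n"
        using pos by (simp add: powr_realpow[symmetric] powr_powr[symmetric] powr_add powr_half_sqrt)
      also have "\<dots> \<le> (?a x powr p * norm (u x)) ^ n"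
        using truncated_square_le_square[OF e, of "u x"] a0[of x]
        by (intro power_mono mult_left_mono real_le_lsqrt) auto
      finally show ?thesis by (simp add: norm_truncated_power)
    qed
    then show "ennreal (?a x powr (2 * p)) ^ (DIM('a) - 1) \<le> ennreal (norm (?w x)) ^ DIM('a)"
      by (simp add: ennreal_power n_def[symmetric] ennreal_leI)
  qed
  also have "\<dots> \<le> (\<Prod>b\<in>(Basis::'a set). ennreal (K * sqrt A))"
  proof (rule prod_mono_ennreal)
    fix b :: 'a assume b: "b \<in> Basis"
    note [measurable] = square_integrable_measurable[OF g[OF b]]
    have "(\<integral>\<^sup>+x. ennreal (norm (?g b x)) \<partial>lborel) \<le> (\<integral>\<^sup>+x. ennreal (1 + 2 * p) * ennreal (norm (?r x) * norm (g b x)) \<partial>lborel)"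
      using norm_truncated_power_deriv_le[OF e p(1)] p
      by (intro nn_integral_mono) (simp add: ennreal_mult[symmetric] ennreal_leI mult.assoc del: ennreal_plus)
    also have "\<dots> = ennreal (1 + 2 * p) * (\<integral>\<^sup>+x. ennreal (norm (?r x) * norm (g b x)) \<partial>lborel)"
      using e by (intro nn_integral_cmult) measurable
    also have "\<dots> \<le> ennreal (1 + 2 * p) * ennreal (sqrt A * sqrt (square_integral (g b)))"
      using nn_integral_mult_le_sqrt[OF r g[OF b]] by (intro mult_left_mono) (auto simp: A_def)
    also have "\<dots> = ennreal ((1 + 2 * p) * (sqrt A * sqrt (square_integral (g b))))"
      using p A0 by (subst ennreal_mult) auto
    also have "\<dots> \<le> ennreal (K * sqrt A)"
    proof (rule ennreal_leI)
      have "sqrt (square_integral (g b)) \<le> sqrt (gradient_integral g)"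
        by (intro real_sqrt_le_mono square_integral_le_gradient_integral[OF b, of g])
      then have "(1 + 2 * p) * sqrt A * sqrt (square_integral (g b)) \<le> (1 + 2 * p) * sqrt A * sqrt (gradient_integral g)"
        by (rule mult_left_mono) (use p A0 in simp)
      then show "(1 + 2 * p) * (sqrt A * sqrt (square_integral (g b))) \<le> K * sqrt A"
        by (simp only: K_def mult_ac)
    qed
    finally show "(\<integral>\<^sup>+x. ennreal (norm (?g b x)) \<partial>lborel) \<le> ennreal (K * sqrt A)" .
  qed
  finally have "A ^ (n - 1) \<le> (K * sqrt A) ^ n"
    unfolding A n_def[symmetric] using A0 K0 by (simp add: ennreal_power n_def[symmetric])
  then have "A \<le> K powr (2 * real n / (real n - 2))"
    by (rule le_powr_of_power_le[OF n'(1) A0 K0])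
  then show ?thesis unfolding A K_def by (rule ennreal_leI)
qed

text \<open>The bound of \<open>Sobolev_truncated\<close> is free of \<open>e\<close>; its constant
  \<open>1 + 2 * p\<close> becomes \<open>1 + n / (n - 2)\<close>.\<close>

theorem Sobolev_inequality:
  fixes u :: "'a::euclidean_space \<Rightarrow> complex" and g :: "'a \<Rightarrow> 'a \<Rightarrow> complex"
  defines "n \<equiv> real DIM('a)"
  assumes n: "DIM('a) \<ge> 3"
    and u: "square_integrable u" and g: "\<And>b. b \<in> Basis \<Longrightarrow> square_integrable (g b)"
    and wp: "\<And>b. b \<in> Basis \<Longrightarrow> has_weak_partial b u (g b)"
  shows "(\<integral>\<^sup>+x. ennreal (norm (u x) powr (2 * n / (n - 2))) \<partial>lborel)
    \<le> ennreal (((1 + n / (n - 2)) * sqrt (gradient_integral g)) powr (2 * n / (n - 2)))"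
proof -
  have n': "n \<ge> 3" using n by (simp add: n_def)
  have "(\<integral>\<^sup>+x. ennreal (norm (u x) powr (2 * (n / (n - 2)))) \<partial>lborel)
    \<le> ennreal (((1 + n / (n - 2)) * sqrt (gradient_integral g)) powr (2 * n / (n - 2)))"
  proof (rule nn_integral_powr_le_of_truncated)
    show "n / (n - 2) > 0" using n' by simp
    show "(\<integral>\<^sup>+x. ennreal (truncated_square e (u x) powr (n / (n - 2))) \<partial>lborel)
      \<le> ennreal (((1 + n / (n - 2)) * sqrt (gradient_integral g)) powr (2 * n / (n - 2)))" if "e > 0" for e
    proof -
      let ?q = "real DIM('a) / (2 * (real DIM('a) - 2))"
      have "2 * (a / (2 * b)) = a / b" for a b :: real by simp
      then have eq: "2 * ?q = n / (n - 2)" unfolding n_def .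
      have "(\<integral>\<^sup>+x. ennreal (truncated_square e (u x) powr (2 * ?q)) \<partial>lborel)
        \<le> ennreal (((1 + 2 * ?q) * sqrt (gradient_integral g)) powr (2 * n / (n - 2)))"
        unfolding n_def by (rule Sobolev_truncated[OF n that u]) (use g wp in auto)
      then show ?thesis by (simp only: eq)
    qed
  qed (rule square_integrable_measurable[OF u])
  then show ?thesis by simp
qed

section \<open>The elliptic estimate\<close>

lemma cnj_borel_measurable [measurable]: "cnj \<in> borel_measurable borel"
  by (intro borel_measurable_continuous_onI continuous_intros)

lemma integrable_mult_cnj:
  assumes f: "square_integrable f" and g: "square_integrable g"
  shows "integrable lborel (\<lambda>x. f x * cnj (g x))"
proof (rule integrableI_bounded)
  note [measurable] = square_integrable_measurable[OF f] square_integrable_measurable[OF g]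
  show "(\<lambda>x. f x * cnj (g x)) \<in> borel_measurable lborel" by measurable
  have "(\<integral>\<^sup>+x. ennreal (norm (f x * cnj (g x))) \<partial>lborel) = (\<integral>\<^sup>+x. ennreal (norm (f x) * norm (g x)) \<partial>lborel)"
    by (simp add: norm_mult)
  also have "\<dots> < \<infinity>" using nn_integral_mult_le_sqrt[OF f g] by (rule le_less_trans) simp
  finally show "(\<integral>\<^sup>+x. ennreal (norm (f x * cnj (g x))) \<partial>lborel) < \<infinity>" .
qed

lemma norm_integral_mult_cnj_le:
  assumes f: "square_integrable f" and g: "square_integrable g"
  shows "norm (LINT x|lborel. f x * cnj (g x)) \<le> sqrt (square_integral f) * sqrt (square_integral g)"
proof -
  have "ennreal (norm (LINT x|lborel. f x * cnj (g x))) \<le> (\<integral>\<^sup>+x. ennreal (norm (f x * cnj (g x))) \<partial>lborel)"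
    by (rule integral_norm_bound_ennreal[OF integrable_mult_cnj[OF f g]])
  also have "\<dots> = (\<integral>\<^sup>+x. ennreal (norm (f x) * norm (g x)) \<partial>lborel)"
    by (simp add: norm_mult)
  also have "\<dots> \<le> ennreal (sqrt (square_integral f) * sqrt (square_integral g))"
    by (rule nn_integral_mult_le_sqrt[OF f g])
  finally show ?thesis by (subst (asm) ennreal_le_iff) auto
qed

text \<open>On the right \<open>A\<close> carries the exponent n / (2 (n - 2)). It is below 1
  because n > 4, so dividing leaves a positive power of \<open>A\<close>.\<close>

lemma powr_sqrt_bootstrap:
  fixes A K L n :: real
  assumes n: "n > 4" and A: "A \<ge> 0" and K: "K \<ge> 0" and L: "L \<ge> 0"
    and le: "A \<le> (K * sqrt (L * sqrt A)) powr (2 * n / (n - 2))"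
  shows "A \<le> (K\<^sup>2 * L) powr (2 * n / (n - 4))"
proof (cases "A = 0")
  case False
  with A have A: "A > 0" by simp
  have "K * sqrt (L * sqrt A) = ((K\<^sup>2 * L) * A powr (1 / 2)) powr (1 / 2)"
    using K L A by (simp add: powr_half_sqrt real_sqrt_mult)
  then have "A \<le> (((K\<^sup>2 * L) * A powr (1 / 2)) powr (1 / 2)) powr (2 * n / (n - 2))"
    using le by simp
  also have "\<dots> = (K\<^sup>2 * L) powr (n / (n - 2)) * A powr (n / (2 * (n - 2)))"
  proof -
    have "((X * A powr (1 / 2)) powr (1 / 2)) powr (2 * n / (n - 2)) = X powr (n / (n - 2)) * A powr (n / (2 * (n - 2)))"
      if "X \<ge> 0" for X :: real
      using that by (simp add: powr_powr powr_mult)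
    then show ?thesis using L by simp
  qed
  finally have le': "A \<le> (K\<^sup>2 * L) powr (n / (n - 2)) * A powr (n / (2 * (n - 2)))" .
  have ex: "1 - n / (2 * (n - 2)) = (n - 4) / (2 * (n - 2))" using n by (simp add: field_simps)
  have "A powr ((n - 4) / (2 * (n - 2))) = A / A powr (n / (2 * (n - 2)))"
    using powr_diff[of A 1 "n / (2 * (n - 2))"] A unfolding ex by simp
  also have "\<dots> \<le> (K\<^sup>2 * L) powr (n / (n - 2))"
    using le' A by (simp add: divide_le_eq)
  finally have "(A powr ((n - 4) / (2 * (n - 2)))) powr (2 * (n - 2) / (n - 4))
      \<le> ((K\<^sup>2 * L) powr (n / (n - 2))) powr (2 * (n - 2) / (n - 4))"
    using n by (intro powr_mono2) auto
  moreover have "(n - 4) / (2 * (n - 2)) * (2 * (n - 2) / (n - 4)) = 1" "n / (n - 2) * (2 * (n - 2) / (n - 4)) = 2 * n / (n - 4)"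
    using n by (auto simp: divide_simps)
  ultimately show ?thesis using A by (simp only: powr_powr powr_one)
qed simp

text \<open>The equation \<open>(|V| - \<Delta>) u = f\<close> enters only through the energy inequality obtained by testing
  with truncations of \<open>u |u|\<^sup>2\<^sup>p\<close>, where the potential contributes a nonnegative term.\<close>

lemma elliptic_estimate:
  fixes u f :: "'a::euclidean_space \<Rightarrow> complex" and g :: "'a \<Rightarrow> 'a \<Rightarrow> complex"
  defines "n \<equiv> real DIM('a)"
  defines "K \<equiv> (1 + n / (n - 2)) * (1 + 2 / (n - 4))"
  assumes n: "DIM('a) > 4"
    and u: "square_integrable u" and f: "square_integrable f"
    and g: "\<And>b. b \<in> Basis \<Longrightarrow> square_integrable (g b)"
    and wp: "\<And>b. b \<in> Basis \<Longrightarrow> has_weak_partial b u (g b)"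
    and energy: "\<And>e p. e > 0 \<Longrightarrow> p > 0 \<Longrightarrow>
      (\<Sum>b\<in>Basis. LINT x|lborel. Re (g b x * cnj (truncated_power_deriv e p (u x) (g b x))))
        \<le> Re (LINT x|lborel. f x * cnj (truncated_power e p (u x)))"
  shows "(\<integral>\<^sup>+x. ennreal (norm (u x) powr (2 * n / (n - 4))) \<partial>lborel)
    \<le> ennreal ((K\<^sup>2 * sqrt (square_integral f)) powr (2 * n / (n - 4)))"
proof -
  have n': "n > 4" using n by (simp add: n_def)
  have "(\<integral>\<^sup>+x. ennreal (norm (u x) powr (2 * (n / (n - 4)))) \<partial>lborel)
    \<le> ennreal ((K\<^sup>2 * sqrt (square_integral f)) powr (2 * n / (n - 4)))"
  proof (rule nn_integral_powr_le_of_truncated)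
    fix e :: real assume e: "e > 0"
    \<comment> \<open>\<open>?v\<close>, with exponent \<beta>, is the test function;
      \<open>?w\<close>, with half of it, is the function in the Sobolev inequality, since squaring
      its gradient doubles the exponent of the weight.\<close>
    define \<beta> where "\<beta> = 2 / (n - 4)"
    define N where "N = 2 * n / (n - 2)"
    define C where "C = 1 + n / (n - 2)"
    have pos: "\<beta> > 0" "\<beta> / 2 > 0" "N > 2" "C > 0" using n' by (auto simp: \<beta>_def N_def C_def field_simps)
    let ?a = "\<lambda>x. truncated_square e (u x)"
    let ?w = "\<lambda>x. truncated_power e (\<beta> / 2) (u x)" and ?v = "\<lambda>x. truncated_power e \<beta> (u x)"
    define gw where "gw b x = truncated_power_deriv e (\<beta> / 2) (u x) (g b x)" for b x
    define gv where "gv b x = truncated_power_deriv e \<beta> (u x) (g b x)" for b x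
    have b0: "(SOME i. i \<in> Basis) \<in> (Basis :: 'a set)" by (rule SOME_Basis)
    have w: "square_integrable ?w" and v: "square_integrable ?v"
      using truncated_power_chain_rule(1)[OF e _ b0 u g[OF b0] wp[OF b0]] pos by auto
    have gw: "square_integrable (gw b)" "has_weak_partial b ?w (gw b)" if "b \<in> Basis" for b
      using truncated_power_chain_rule(2,3)[OF e pos(2) that u g[OF that] wp[OF that]] by (auto simp: gw_def[abs_def])
    have gv: "square_integrable (gv b)" if "b \<in> Basis" for b
      using truncated_power_chain_rule(2)[OF e pos(1) that u g[OF that] wp[OF that]] by (auto simp: gv_def[abs_def])
    have S: "(\<integral>\<^sup>+x. ennreal (norm (?w x) powr N) \<partial>lborel) \<le> ennreal ((C * sqrt (gradient_integral gw)) powr N)"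
      unfolding N_def C_def n_def using n by (intro Sobolev_inequality w gw) auto
    then have "(\<integral>\<^sup>+x. ennreal (norm (?w x) powr N) \<partial>lborel) < top" by (rule le_less_trans) simp
    \<comment> \<open>Finite because the truncation lies in H^1; \<open>powr_sqrt_bootstrap\<close>
      relies on it.\<close>
    then obtain A where A: "(\<integral>\<^sup>+x. ennreal (norm (?w x) powr N) \<partial>lborel) = ennreal A" "A \<ge> 0"
      by (cases "\<integral>\<^sup>+x. ennreal (norm (?w x) powr N) \<partial>lborel") auto
    have A1: "A \<le> (C * sqrt (gradient_integral gw)) powr N"
      using S unfolding A(1) by (subst (asm) ennreal_le_iff) auto
    \<comment> \<open>If \<open>?a x\<close> were the square of \<open>norm (u x)\<close>, both
      would be equalities, by the choice of \<beta> recorded in \<open>ex1\<close> and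
      \<open>ex2\<close>. Truncation makes \<open>?a x\<close> smaller, and the positive powers of
      it that are replaced by powers of \<open>norm (u x)\<close> only grow.\<close>
    have pw: "(norm (?v x))\<^sup>2 \<le> norm (?w x) powr N" "?a x powr (n / (n - 4)) \<le> norm (?w x) powr N" for x
    proof -
      let ?r = "norm (u x)"
      have "(norm (?v x))\<^sup>2 \<le> norm (?w x) powr N \<and> ?a x powr (n / (n - 4)) \<le> norm (?w x) powr N"
      proof (cases "u x = 0")
        case True
        then show ?thesis by (simp add: truncated_power_def)
      next
        case False
        then have r: "?r > 0" and a: "?a x > 0" using truncated_square_pos[OF e] by auto
        have le: "?a x \<le> ?r\<^sup>2" by (rule truncated_square_le_square[OF e])
        have ex1: "\<beta> / 2 * N + (N - 2) / 2 = 2 * \<beta>" and ex2: "\<beta> / 2 * N + N / 2 = n / (n - 4)"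
          using n' by (simp_all add: \<beta>_def N_def divide_simps) (simp_all add: algebra_simps)
        have w_eq: "norm (?w x) powr N = ?a x powr (\<beta> / 2 * N) * ?r powr N"
          using r a by (simp add: norm_truncated_power powr_mult powr_powr)
        have "(norm (?v x))\<^sup>2 = ?a x powr (\<beta> / 2 * N) * (?a x powr ((N - 2) / 2) * ?r\<^sup>2)"
        proof -
          have "(?a x powr \<beta>)\<^sup>2 = ?a x powr (2 * \<beta>)"
            using powr_powr[of "?a x" \<beta> 2] by (simp add: mult.commute)
          also have "\<dots> = ?a x powr (\<beta> / 2 * N) * ?a x powr ((N - 2) / 2)"
            by (simp only: powr_add[symmetric] ex1)
          finally show ?thesis by (simp add: norm_truncated_power power_mult_distrib)
        qed
        also have "\<dots> \<le> ?a x powr (\<beta> / 2 * N) * ((?r\<^sup>2) powr ((N - 2) / 2) * ?r\<^sup>2)"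
          using a le pos by (intro mult_left_mono mult_right_mono powr_mono2) auto
        also have "(?r\<^sup>2) powr ((N - 2) / 2) * ?r\<^sup>2 = ?r powr (N - 2) * ?r powr 2"
        proof -
          have "2 * (y / 2) = y" for y :: real by simp
          then have "(?r\<^sup>2) powr ((N - 2) / 2) = ?r powr (N - 2)"
            using square_powr[of ?r "(N - 2) / 2"] by (simp only: norm_ge_zero)
          then show ?thesis using r by simp
        qed
        also have "\<dots> = ?r powr N" by (simp only: powr_add[symmetric]) simp
        finally have 1: "(norm (?v x))\<^sup>2 \<le> norm (?w x) powr N" by (simp only: w_eq)
        have "?a x powr (n / (n - 4)) = ?a x powr (\<beta> / 2 * N) * ?a x powr (N / 2)"
          by (simp only: powr_add[symmetric] ex2)
        also have "\<dots> \<le> ?a x powr (\<beta> / 2 * N) * (?r\<^sup>2) powr (N / 2)"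
          using a le pos by (intro mult_left_mono powr_mono2) auto
        also have "(?r\<^sup>2) powr (N / 2) = ?r powr N" by (simp add: square_powr)
        finally have "?a x powr (n / (n - 4)) \<le> norm (?w x) powr N" by (simp only: w_eq)
        with 1 show ?thesis by simp
      qed
      then show "(norm (?v x))\<^sup>2 \<le> norm (?w x) powr N" "?a x powr (n / (n - 4)) \<le> norm (?w x) powr N" by auto
    qed
    have "ennreal (square_integral ?v) \<le> ennreal A"
      unfolding A(1)[symmetric] nn_integral_square_integral[OF v, symmetric]
      by (intro nn_integral_mono ennreal_leI pw)
    then have v_le: "square_integral ?v \<le> A" using A(2) by simp
    define F where "F = sqrt (square_integral f)"
    have F0: "F \<ge> 0" by (simp add: F_def)
    \<comment> \<open>The energy of \<open>?w\<close> is controlled by the pairing of the gradients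
      of \<open>u\<close> and \<open>?v\<close>: both compare with \<open>?a x powr \<beta>\<close>
      times the squared gradient of \<open>u\<close>.\<close>
    have "gradient_integral gw \<le> (\<Sum>b\<in>Basis. (1 + \<beta>)\<^sup>2 * (LINT x|lborel. Re (g b x * cnj (gv b x))))"
      unfolding gradient_integral_def
    proof (rule sum_mono)
      fix b :: 'a assume b: "b \<in> Basis"
      have int: "integrable lborel (\<lambda>x. Re (g b x * cnj (gv b x)))"
        by (intro integrable_Re integrable_mult_cnj g gv b)
      have "square_integral (gw b) \<le> (LINT x|lborel. (1 + \<beta>)\<^sup>2 * Re (g b x * cnj (gv b x)))"
      proof (rule integral_mono)
        show "integrable lborel (\<lambda>x. (norm (gw b x))\<^sup>2)" by (intro square_integrable_integrable gw b)
        show "integrable lborel (\<lambda>x. (1 + \<beta>)\<^sup>2 * Re (g b x * cnj (gv b x)))" using int by (rule integrable_mult_right)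
        fix x
        have "norm (gw b x) \<le> (1 + \<beta>) * ?a x powr (\<beta> / 2) * norm (g b x)"
          using norm_truncated_power_deriv_le[OF e pos(2)] by (simp add: gw_def)
        then have "(norm (gw b x))\<^sup>2 \<le> ((1 + \<beta>) * ?a x powr (\<beta> / 2) * norm (g b x))\<^sup>2"
          by (intro power_mono) auto
        also have "\<dots> = (1 + \<beta>)\<^sup>2 * (?a x powr \<beta> * (norm (g b x))\<^sup>2)"
          by (simp add: power_mult_distrib power2_eq_square[of "_ powr _"] powr_add[symmetric])
        also have "\<dots> \<le> (1 + \<beta>)\<^sup>2 * Re (g b x * cnj (gv b x))"
          unfolding gv_def by (intro mult_left_mono Re_mult_cnj_truncated_power_deriv[OF e pos(1)]) simp
        finally show "(norm (gw b x))\<^sup>2 \<le> (1 + \<beta>)\<^sup>2 * Re (g b x * cnj (gv b x))" .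
      qed
      then show "square_integral (gw b) \<le> (1 + \<beta>)\<^sup>2 * (LINT x|lborel. Re (g b x * cnj (gv b x)))" by simp
    qed
    also have "\<dots> \<le> (1 + \<beta>)\<^sup>2 * Re (LINT x|lborel. f x * cnj (?v x))"
      unfolding sum_distrib_left[symmetric] gv_def by (intro mult_left_mono energy[OF e pos(1)]) simp
    also have "\<dots> \<le> (1 + \<beta>)\<^sup>2 * (F * sqrt A)"
    proof (rule mult_left_mono)
      have "Re (LINT x|lborel. f x * cnj (?v x)) \<le> norm (LINT x|lborel. f x * cnj (?v x))" by (rule complex_Re_le_cmod)
      also have "\<dots> \<le> F * sqrt (square_integral ?v)"
        unfolding F_def by (rule norm_integral_mult_cnj_le[OF f v])
      also have "\<dots> \<le> F * sqrt A" using v_le F0 by (intro mult_left_mono) auto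
      finally show "Re (LINT x|lborel. f x * cnj (?v x)) \<le> F * sqrt A" .
    qed simp
    finally have "sqrt (gradient_integral gw) \<le> sqrt ((1 + \<beta>)\<^sup>2 * (F * sqrt A))" by (rule real_sqrt_le_mono)
    also have "\<dots> = (1 + \<beta>) * sqrt (F * sqrt A)" using pos(1) by (simp add: real_sqrt_mult)
    \<comment> \<open>\<open>K\<close> is the Sobolev constant \<open>C\<close> times the bound
      \<open>1 + \<beta>\<close> for the derivative of \<open>?w\<close>.\<close>
    finally have "C * sqrt (gradient_integral gw) \<le> K * sqrt (F * sqrt A)"
      using pos(4) by (simp add: K_def C_def[symmetric] \<beta>_def[symmetric] mult.assoc)
    then have "(C * sqrt (gradient_integral gw)) powr N \<le> (K * sqrt (F * sqrt A)) powr N"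
      using pos gradient_integral_nonneg[of gw] by (intro powr_mono2) auto
    with A1 have "A \<le> (K * sqrt (F * sqrt A)) powr N" by linarith
    moreover have "K \<ge> 0" using n' by (simp add: K_def)
    ultimately have "A \<le> (K\<^sup>2 * F) powr (2 * n / (n - 4))"
      unfolding N_def by (intro powr_sqrt_bootstrap n' A(2) F0)
    then have "ennreal A \<le> ennreal ((K\<^sup>2 * F) powr (2 * n / (n - 4)))" by (rule ennreal_leI)
    moreover have "(\<integral>\<^sup>+x. ennreal (?a x powr (n / (n - 4))) \<partial>lborel) \<le> ennreal A"
      unfolding A(1)[symmetric] by (intro nn_integral_mono ennreal_leI pw)
    ultimately show "(\<integral>\<^sup>+x. ennreal (?a x powr (n / (n - 4))) \<partial>lborel)
        \<le> ennreal ((K\<^sup>2 * sqrt (square_integral f)) powr (2 * n / (n - 4)))"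
      unfolding F_def by (rule order_trans[rotated])
  qed (use n' square_integrable_measurable[OF u] in auto)
  then show ?thesis by simp
qed

section \<open>Passage from Lebesgue to Borel functions\<close>

lemma lebesgue_measurable_ex_borel:
  fixes f :: "'a::euclidean_space \<Rightarrow> complex"
  assumes "f \<in> borel_measurable lebesgue"
  obtains f' where "f' \<in> borel_measurable borel" "AE x in lborel. f x = f' x"
proof -
  have "(\<lambda>x. Re (f x)) \<in> borel_measurable lebesgue" "(\<lambda>x. Im (f x)) \<in> borel_measurable lebesgue"
    using assms by simp_all
  from this[THEN completion_ex_borel_measurable_real]
  obtain r i where [measurable]: "r \<in> borel_measurable lborel" "i \<in> borel_measurable lborel"
    and AE: "AE x in lborel. Re (f x) = r x" "AE x in lborel. Im (f x) = i x"
    by blast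
  show ?thesis
  proof
    show "(\<lambda>x. Complex (r x) (i x)) \<in> borel_measurable borel"
      unfolding Complex_eq by measurable
    show "AE x in lborel. f x = Complex (r x) (i x)"
      using AE by eventually_elim (simp add: complex_eq_iff)
  qed
qed

lemma
  fixes f f' :: "'a::euclidean_space \<Rightarrow> 'b::{banach, second_countable_topology}"
  assumes f: "f \<in> borel_measurable lebesgue" and f': "f' \<in> borel_measurable borel"
    and AE: "AE x in lborel. f x = f' x"
  shows integral_lebesgue_eq_lborel: "(LINT x|lebesgue. f x) = (LINT x|lborel. f' x)"
    and integrable_lebesgue_eq_lborel: "integrable lebesgue f \<longleftrightarrow> integrable lborel f'"
proof -
  have f'_leb: "f' \<in> borel_measurable lebesgue"
    by (rule measurable_completion) (use f' in simp)
  have AE': "AE x in lebesgue. f x = f' x" using AE by (rule AE_completion)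
  have "(LINT x|lebesgue. f x) = (LINT x|lebesgue. f' x)"
    by (rule integral_cong_AE[OF f f'_leb AE'])
  also have "\<dots> = (LINT x|lborel. f' x)" using f' by (intro integral_completion) simp
  finally show "(LINT x|lebesgue. f x) = (LINT x|lborel. f' x)" .
  have "integrable lebesgue f \<longleftrightarrow> integrable lebesgue f'"
    by (rule integrable_cong_AE[OF f f'_leb AE'])
  also have "\<dots> \<longleftrightarrow> integrable lborel f'" using f' by (intro integrable_completion) simp
  finally show "integrable lebesgue f \<longleftrightarrow> integrable lborel f'" .
qed

lemma borel_imp_lebesgue_measurable:
  "f \<in> borel_measurable borel \<Longrightarrow> f \<in> borel_measurable lebesgue"
  by (rule measurable_completion) simp

lemma
  assumes u: "u \<in> borel_measurable lebesgue" and u': "u' \<in> borel_measurable borel"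
    and AE: "AE x in lborel. u x = u' x"
  shows Lp_2_iff: "u \<in> Lp 2 \<longleftrightarrow> square_integrable u'"
    and Lp_norm_2_eq: "Lp_norm 2 u = sqrt (square_integral u')"
proof -
  have m: "(\<lambda>x. norm (u x) powr 2) \<in> borel_measurable lebesgue" using u by measurable
  have m': "(\<lambda>x. (norm (u' x))\<^sup>2) \<in> borel_measurable borel" using u' by measurable
  have ae: "AE x in lborel. norm (u x) powr 2 = (norm (u' x))\<^sup>2"
    using AE by eventually_elim simp
  note eq = integral_lebesgue_eq_lborel[OF m m' ae]
  from integrable_lebesgue_eq_lborel[OF m m' ae] show "u \<in> Lp 2 \<longleftrightarrow> square_integrable u'"
    using u u' by (simp add: Lp_def square_integrable_def)
  show "Lp_norm 2 u = sqrt (square_integral u')"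
    unfolding Lp_norm_def eq by (simp add: powr_half_sqrt)
qed

lemma Lp_2_obtain_borel:
  assumes "u \<in> Lp 2"
  obtains u' where "square_integrable u'" "AE x in lborel. u x = u' x"
proof -
  have u: "u \<in> borel_measurable lebesgue" using assms by (simp add: Lp_def)
  obtain u' where u': "u' \<in> borel_measurable borel" "AE x in lborel. u x = u' x"
    using lebesgue_measurable_ex_borel[OF u] .
  from assms have "square_integrable u'" unfolding Lp_2_iff[OF u u'] .
  then show ?thesis using u'(2) by (rule that)
qed

lemma Lp_2_measurable: "u \<in> Lp 2 \<Longrightarrow> u \<in> borel_measurable lebesgue"
  by (simp add: Lp_def)

lemma square_integrable_imp_Lp_2:
  assumes "square_integrable u"
  shows "u \<in> Lp 2"
proof -
  note m = square_integrable_measurable[OF assms]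
  show ?thesis
    by (rule Lp_2_iff[OF borel_imp_lebesgue_measurable[OF m] m, THEN iffD2]) (use assms in simp_all)
qed

lemma is_weak_partial_iff:
  fixes u u' g g' :: "'a::euclidean_space \<Rightarrow> complex"
  assumes b: "b \<in> Basis"
    and u: "u \<in> borel_measurable lebesgue" "u' \<in> borel_measurable borel" "AE x in lborel. u x = u' x"
    and g: "g \<in> borel_measurable lebesgue" "g' \<in> borel_measurable borel" "AE x in lborel. g x = g' x"
  shows "is_weak_partial b u g \<longleftrightarrow> has_weak_partial b u' g'"
proof -
  have "(LINT x|lebesgue. u x * partial_deriv b \<phi> x) = (LINT x|lborel. u' x * partial_deriv b \<phi> x)"
    "(LINT x|lebesgue. g x * \<phi> x) = (LINT x|lborel. g' x * \<phi> x)" if \<phi>: "\<phi> \<in> test_functions" for \<phi> :: "'a \<Rightarrow> complex"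
  proof -
    note m = test_function_measurable[OF \<phi>] test_function_measurable[OF test_function_partial_deriv[OF \<phi> b]]
    note m' = m[THEN borel_imp_lebesgue_measurable]
    show "(LINT x|lebesgue. u x * partial_deriv b \<phi> x) = (LINT x|lborel. u' x * partial_deriv b \<phi> x)"
      by (rule integral_lebesgue_eq_lborel)
         (use u m m' in \<open>auto intro!: borel_measurable_times elim: eventually_mono\<close>)
    show "(LINT x|lebesgue. g x * \<phi> x) = (LINT x|lborel. g' x * \<phi> x)"
      by (rule integral_lebesgue_eq_lborel)
         (use g m m' in \<open>auto intro!: borel_measurable_times elim: eventually_mono\<close>)
  qed
  then show ?thesis by (simp add: is_weak_partial_def has_weak_partial_def)
qed

lemma weak_partial_unique:
  fixes g h u :: "'a::euclidean_space \<Rightarrow> complex"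
  assumes g: "locally_integrable g" and h: "locally_integrable h"
    and wp: "has_weak_partial b u g" "has_weak_partial b u h"
  shows "AE x in lborel. g x = h x"
proof -
  have "AE x in lborel. g x - h x = 0"
  proof (rule fundamental_lemma[OF locally_integrable_diff[OF g h]])
    fix \<phi> :: "'a \<Rightarrow> complex" assume \<phi>: "\<phi> \<in> test_functions"
    have "- (LINT x|lborel. g x * \<phi> x) = - (LINT x|lborel. h x * \<phi> x)"
      using bspec[OF wp(1)[unfolded has_weak_partial_def] \<phi>] bspec[OF wp(2)[unfolded has_weak_partial_def] \<phi>] by metis
    then show "(LINT x|lborel. (g x - h x) * \<phi> x) = 0"
      using integrable_test_function[OF g \<phi>] integrable_test_function[OF h \<phi>] by (simp add: left_diff_distrib)
  qed
  then show ?thesis by eventually_elim simp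
qed

lemma H1_weak_partial:
  assumes "u \<in> H1" "b \<in> Basis"
  shows "weak_partial b u \<in> Lp 2" "is_weak_partial b u (weak_partial b u)"
proof -
  have "\<exists>g. g \<in> Lp 2 \<and> is_weak_partial b u g" using assms by (auto simp: H1_def)
  then have "weak_partial b u \<in> Lp 2 \<and> is_weak_partial b u (weak_partial b u)"
    unfolding weak_partial_def by (rule someI_ex)
  then show "weak_partial b u \<in> Lp 2" "is_weak_partial b u (weak_partial b u)" by auto
qed

text \<open>Fixes Borel representatives of \<open>u\<close> and of all the partial derivatives
  picked by \<open>weak_partial\<close>, so that the results for \<open>lborel\<close> apply to them
  simultaneously.\<close>

lemma H1_obtain_borel:
  assumes u: "u \<in> H1"
  obtains u' g where "square_integrable u'" "AE x in lborel. u x = u' x"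
    "\<And>b. b \<in> Basis \<Longrightarrow> square_integrable (g b)"
    "\<And>b. b \<in> Basis \<Longrightarrow> AE x in lborel. weak_partial b u x = g b x"
    "\<And>b. b \<in> Basis \<Longrightarrow> has_weak_partial b u' (g b)"
proof -
  have u2: "u \<in> Lp 2" using u by (simp add: H1_def)
  obtain u' where u': "square_integrable u'" "AE x in lborel. u x = u' x"
    using Lp_2_obtain_borel[OF u2] .
  have "\<forall>b\<in>Basis. \<exists>g'. square_integrable g' \<and> (AE x in lborel. weak_partial b u x = g' x)"
    using H1_weak_partial(1)[OF u] Lp_2_obtain_borel by metis
  then obtain g where g: "\<forall>b\<in>Basis. square_integrable (g b) \<and> (AE x in lborel. weak_partial b u x = g b x)"
    unfolding bchoice_iff by blast
  have "has_weak_partial b u' (g b)" if b: "b \<in> Basis" for b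
    using is_weak_partial_iff[OF b Lp_2_measurable[OF u2] square_integrable_measurable[OF u'(1)] u'(2)
        Lp_2_measurable[OF H1_weak_partial(1)[OF u b]], of "g b"] g b H1_weak_partial(2)[OF u b]
    by (auto dest: square_integrable_measurable)
  with u' g show ?thesis using that by blast
qed

text \<open>\<open>weak_partial\<close> is an arbitrary choice; uniqueness identifies it almost
  everywhere with a derivative computed by other means, as is needed for the truncated test
  functions inserted into the form.\<close>

lemma
  assumes u: "square_integrable u" and g: "\<And>b. b \<in> Basis \<Longrightarrow> square_integrable (g b)"
    and wp: "\<And>b. b \<in> Basis \<Longrightarrow> has_weak_partial b u (g b)"
  shows square_integrable_imp_H1: "u \<in> H1"
    and weak_partial_eq: "b \<in> Basis \<Longrightarrow> AE x in lborel. weak_partial b u x = g b x"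
proof -
  note um = square_integrable_measurable[OF u]
  have iff: "is_weak_partial b u h \<longleftrightarrow> has_weak_partial b u h'"
    if "b \<in> Basis" "h \<in> borel_measurable lebesgue" "h' \<in> borel_measurable borel" "AE x in lborel. h x = h' x" for b h h'
    by (rule is_weak_partial_iff[OF that(1) borel_imp_lebesgue_measurable[OF um] um _ that(2,3,4)]) simp
  show H: "u \<in> H1"
    unfolding H1_def
  proof safe
    show "u \<in> Lp 2" using u by (rule square_integrable_imp_Lp_2)
    fix b :: 'a assume b: "b \<in> Basis"
    have "is_weak_partial b u (g b)"
      using iff[OF b _ square_integrable_measurable[OF g[OF b]]] wp[OF b]
        borel_imp_lebesgue_measurable[OF square_integrable_measurable[OF g[OF b]]] by simp
    then show "\<exists>g\<in>Lp 2. is_weak_partial b u g"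
      using square_integrable_imp_Lp_2[OF g[OF b]] by blast
  qed
  assume b: "b \<in> Basis"
  obtain h where h: "square_integrable h" "AE x in lborel. weak_partial b u x = h x"
    using Lp_2_obtain_borel[OF H1_weak_partial(1)[OF H b]] .
  have "has_weak_partial b u h"
    using iff[OF b Lp_2_measurable[OF H1_weak_partial(1)[OF H b]] square_integrable_measurable[OF h(1)] h(2)]
      H1_weak_partial(2)[OF H b] by simp
  then have "AE x in lborel. h x = g b x"
    using weak_partial_unique[OF square_integrable_imp_locally_integrable[OF h(1)]
        square_integrable_imp_locally_integrable[OF g[OF b]]] wp[OF b] by blast
  with h(2) show "AE x in lborel. weak_partial b u x = g b x" by eventually_elim simp
qed

section \<open>Test functions as elements of H^1\<close>

lemma integrable_test_function_alone:
  fixes \<phi> :: "'a::euclidean_space \<Rightarrow> complex"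
  assumes "\<phi> \<in> test_functions"
  shows "integrable lborel \<phi>"
proof -
  have "integrable lborel (\<lambda>x :: 'a. indicator (cball 0 R) x *\<^sub>R (1 :: complex))" for R
    using emeasure_lborel_cball_finite[of 0 R]
    by (intro integrable_scaleR_left) (simp add: integrable_indicator_iff)
  then have "locally_integrable (\<lambda>_ :: 'a. 1)"
    by (simp add: locally_integrable_def)
  from integrable_test_function[OF this assms] show ?thesis by simp
qed

text \<open>Integrate the fundamental theorem on unit segments over all starting points. One order
  of integration gives the integral of \<eta> minus that of a translate, which is zero; the other
  gives the integral of the derivative.\<close>

lemma integral_partial_deriv_eq_0:
  assumes \<eta>: "\<eta> \<in> test_functions" and b: "b \<in> Basis"
  shows "(LINT x|lborel. partial_deriv b \<eta> x) = 0"
proof -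
  let ?d = "partial_deriv b \<eta>"
  have d: "?d \<in> test_functions" by (rule test_function_partial_deriv[OF \<eta> b])
  note [measurable] = test_function_measurable[OF \<eta>] test_function_measurable[OF d]
  obtain R where R: "R > 0" "\<And>x. norm x \<ge> R \<Longrightarrow> ?d x = 0" using test_function_support[OF d] by blast
  \<comment> \<open>The indicator of the ball costs nothing and brings the integrand into the form
    of \<open>integrable_segments\<close>.\<close>
  have out: "indicator {0..1} s *\<^sub>R ?d (x - s *\<^sub>R b) = indicator (cball 0 (R + 1)) x *\<^sub>R indicator {0..1} s *\<^sub>R ?d (x + s *\<^sub>R (- b))" for x s
  proof (cases "norm x \<le> R + 1 \<or> s \<notin> {0..1}")
    case False
    then have "R \<le> norm (x - s *\<^sub>R b)"
      using norm_triangle_ineq[of "x - s *\<^sub>R b" "s *\<^sub>R b"] b by simp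
    then show ?thesis using R(2) by simp
  qed (auto simp: indicator_def)
  have "locally_integrable ?d"
    using integrable_test_function_alone[OF d] unfolding locally_integrable_def
    by (auto intro!: integrable_mult_indicator)
  then have "integrable (lborel \<Otimes>\<^sub>M lborel) (\<lambda>(x, s). indicator {0..1} s *\<^sub>R ?d (x - s *\<^sub>R b))"
    unfolding out by (rule integrable_segments) (use b in simp_all)
  from lborel_pair.Fubini_integral[OF this]
  have "(LINT s|lborel. LINT x|lborel. indicator {0..1} s *\<^sub>R ?d (x - s *\<^sub>R b))
     = (LINT x|lborel. LINT s|lborel. indicator {0..1} s *\<^sub>R ?d (x - s *\<^sub>R b))" by simp
  also have "\<dots> = (LINT x|lborel. \<eta> x - \<eta> (x - 1 *\<^sub>R b))"
  proof (rule Bochner_Integration.integral_cong)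
    fix x
    show "(LINT s|lborel. indicator {0..1} s *\<^sub>R ?d (x - s *\<^sub>R b)) = \<eta> x - \<eta> (x - 1 *\<^sub>R b)"
      using test_function_segment[OF \<eta> b, of 1 x] by (simp add: algebra_simps)
  qed simp
  also have "\<dots> = 0"
    using integrable_test_function_alone[OF \<eta>] integrable_test_function_alone[OF test_function_translate(1)[OF \<eta>]]
      integral_lborel_translate[of \<eta> "- b"] by simp
  finally have "(LINT s|lborel. indicator {0..1} s *\<^sub>R (LINT x|lborel. ?d (x - s *\<^sub>R b))) = 0" by simp
  moreover have "(LINT x|lborel. ?d (x - s *\<^sub>R b)) = (LINT x|lborel. ?d x)" for s
    using integral_lborel_translate[of ?d "- (s *\<^sub>R b)"] by simp
  ultimately show ?thesis by simp
qed

lemma test_function_mult: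
  assumes \<phi>: "\<phi> \<in> test_functions" and \<psi>: "\<psi> \<in> test_functions"
  shows "(\<lambda>x. \<phi> x * \<psi> x) \<in> test_functions"
    and "partial_deriv b (\<lambda>x. \<phi> x * \<psi> x) = (\<lambda>x. \<phi> x * partial_deriv b \<psi> x + partial_deriv b \<phi> x * \<psi> x)"
proof -
  obtain R where R: "\<And>x. norm x \<ge> R \<Longrightarrow> \<phi> x = 0" using test_function_support[OF \<phi>] by blast
  have "bounded {x. \<phi> x * \<psi> x \<noteq> 0}"
    unfolding bounded_iff
  proof (intro exI[of _ R] ballI)
    fix x assume "x \<in> {x. \<phi> x * \<psi> x \<noteq> 0}"
    then show "norm x \<le> R" using R[of x] by (cases "R \<le> norm x") auto
  qed
  then show "(\<lambda>x. \<phi> x * \<psi> x) \<in> test_functions"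
    using \<phi> \<psi> by (auto simp: test_functions_def intro!: Ck_mult)
  show "partial_deriv b (\<lambda>x. \<phi> x * \<psi> x) = (\<lambda>x. \<phi> x * partial_deriv b \<psi> x + partial_deriv b \<phi> x * \<psi> x)"
  proof
    fix x
    from partial_deriv_eq[OF has_derivative_mult[OF test_function_has_derivative[OF \<phi>] test_function_has_derivative[OF \<psi>]]]
    show "partial_deriv b (\<lambda>x. \<phi> x * \<psi> x) x = \<phi> x * partial_deriv b \<psi> x + partial_deriv b \<phi> x * \<psi> x"
      by (simp add: partial_deriv_def)
  qed
qed

text \<open>Integration by parts is \<open>integral_partial_deriv_eq_0\<close> for the product of
  two test functions.\<close>

lemma test_function_has_weak_partial:
  assumes \<phi>: "\<phi> \<in> test_functions" and b: "b \<in> Basis"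
  shows "has_weak_partial b \<phi> (partial_deriv b \<phi>)"
  unfolding has_weak_partial_def
proof
  fix \<psi> :: "'a \<Rightarrow> complex" assume \<psi>: "\<psi> \<in> test_functions"
  note d = test_function_partial_deriv[OF \<phi> b] test_function_partial_deriv[OF \<psi> b]
  have "integrable lborel (\<lambda>x. \<phi> x * partial_deriv b \<psi> x)" "integrable lborel (\<lambda>x. partial_deriv b \<phi> x * \<psi> x)"
    by (intro integrable_test_function_alone test_function_mult(1) \<phi> \<psi> d)+
  then have "(LINT x|lborel. \<phi> x * partial_deriv b \<psi> x) + (LINT x|lborel. partial_deriv b \<phi> x * \<psi> x) = 0"
    using integral_partial_deriv_eq_0[OF test_function_mult(1)[OF \<phi> \<psi>] b]
    by (simp add: test_function_mult(2)[OF \<phi> \<psi>])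
  then show "(LINT x|lborel. \<phi> x * partial_deriv b \<psi> x) = - (LINT x|lborel. partial_deriv b \<phi> x * \<psi> x)"
    by (simp add: add_eq_0_iff2)
qed

lemma test_function_square_integrable:
  assumes \<phi>: "\<phi> \<in> test_functions"
  shows "square_integrable \<phi>"
  unfolding square_integrable_def
proof safe
  note [measurable] = test_function_measurable[OF \<phi>]
  show "\<phi> \<in> borel_measurable borel" by measurable
  show "integrable lborel (\<lambda>x. (norm (\<phi> x))\<^sup>2)"
    using integrable_norm[OF integrable_test_function_alone[OF test_function_mult(1)[OF \<phi> \<phi>]]]
    by (simp add: norm_mult power2_eq_square)
qed

lemma test_function_H1: "\<phi> \<in> test_functions \<Longrightarrow> \<phi> \<in> H1"
  by (rule square_integrable_imp_H1[where g = "\<lambda>b. partial_deriv b \<phi>"])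
     (auto intro: test_function_square_integrable test_function_partial_deriv test_function_has_weak_partial)

text \<open>The conjugate disappears on real test functions, and those are enough for
  \<open>fundamental_lemma\<close>.\<close>

lemma H1_inner_unique:
  fixes f g :: "'a::euclidean_space \<Rightarrow> complex"
  assumes f: "square_integrable f" and g: "square_integrable g"
    and eq: "\<And>\<phi>. \<phi> \<in> test_functions \<Longrightarrow> (LINT x|lborel. f x * cnj (\<phi> x)) = (LINT x|lborel. g x * cnj (\<phi> x))"
  shows "AE x in lborel. f x = g x"
proof -
  note l = square_integrable_imp_locally_integrable[OF f] square_integrable_imp_locally_integrable[OF g]
  have "AE x in lborel. f x - g x = 0"
  proof (rule fundamental_lemma[OF locally_integrable_diff[OF l]])
    fix \<phi> :: "'a \<Rightarrow> complex" assume \<phi>: "\<phi> \<in> test_functions" and real: "\<And>x. \<phi> x \<in> \<real>"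
    have "cnj (\<phi> x) = \<phi> x" for x using real[of x] by (simp add: Reals_cnj_iff)
    then show "(LINT x|lborel. (f x - g x) * \<phi> x) = 0"
      using eq[OF \<phi>] integrable_test_function[OF l(1) \<phi>] integrable_test_function[OF l(2) \<phi>]
      by (simp add: left_diff_distrib)
  qed
  then show ?thesis by eventually_elim simp
qed

section \<open>The operator\<close>

text \<open>Young's inequality without its weights: both factors are at most powers of the larger of
  \<open>x powr a\<close> and \<open>y powr b\<close>, with exponents adding up to 1.\<close>

lemma powr_mult_powr_le:
  fixes x y :: real
  assumes x: "x \<ge> 0" and y: "y \<ge> 0" and pos: "a > 0" "b > 0" "s > 0" "t > 0" and eq: "s / a + t / b = 1"
  shows "x powr s * y powr t \<le> x powr a + y powr b"
proof -
  define M where "M = max (x powr a) (y powr b)"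
  have M: "M \<ge> 0" by (simp add: M_def le_max_iff_disj)
  have "x powr s = (x powr a) powr (s / a)" "y powr t = (y powr b) powr (t / b)"
    using pos by (simp_all add: powr_powr)
  then have "x powr s * y powr t \<le> M powr (s / a) * M powr (t / b)"
    using pos by (simp only:) (intro mult_mono powr_mono2, auto simp: M_def)
  also have "\<dots> = M" using M by (simp add: powr_add[symmetric] eq)
  also have "\<dots> \<le> x powr a + y powr b" by (simp add: M_def)
  finally show ?thesis .
qed

lemma Lp_subset_L1_loc:
  assumes p: "p \<ge> 1"
  shows "(Lp p :: ('a::euclidean_space \<Rightarrow> complex) set) \<subseteq> L1_loc"
proof
  fix V :: "'a \<Rightarrow> complex" assume V: "V \<in> Lp p"
  then have V_meas[measurable]: "V \<in> borel_measurable lebesgue" by (simp add: Lp_def)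
  have "set_integrable lebesgue K V" if K: "compact K" for K
    unfolding set_integrable_def
  proof (rule Bochner_Integration.integrable_bound)
    have Kl: "K \<in> lmeasurable" using K by (rule lmeasurable_compact)
    then have [measurable]: "K \<in> sets lebesgue" by blast
    have "integrable lebesgue (indicat_real K)"
      using Kl by (simp add: fmeasurable_def integrable_indicator_iff)
    then show "integrable lebesgue (\<lambda>x. indicat_real K x + norm (V x) powr p)"
      using V by (intro Bochner_Integration.integrable_add) (simp_all add: Lp_def)
    show "(\<lambda>x. indicat_real K x *\<^sub>R V x) \<in> borel_measurable lebesgue" by measurable
    have "norm (V x) \<le> 1 + norm (V x) powr p" for x
    proof (cases "norm (V x) \<le> 1")
      case False
      then have "norm (V x) powr 1 \<le> norm (V x) powr p" using p by (intro powr_mono) auto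
      then show ?thesis by simp
    qed (simp add: add_increasing2)
    then show "AE x in lebesgue. norm (indicat_real K x *\<^sub>R V x) \<le> norm (indicat_real K x + norm (V x) powr p)"
      by (intro AE_I2) (simp add: indicator_def)
  qed
  with V_meas show "V \<in> L1_loc" by (simp add: L1_loc_def)
qed

lemma Lp_obtain_borel:
  assumes V: "V \<in> Lp p"
  obtains V' \<nu> where "V' \<in> borel_measurable borel" "AE x in lborel. V x = V' x" "\<nu> \<ge> 0"
    "(\<integral>\<^sup>+x. ennreal (norm (V' x) powr p) \<partial>lborel) = ennreal \<nu>"
proof -
  have Vm: "V \<in> borel_measurable lebesgue" and Vi: "integrable lebesgue (\<lambda>x. norm (V x) powr p)"
    using V by (simp_all add: Lp_def)
  obtain V' where V': "V' \<in> borel_measurable borel" "AE x in lborel. V x = V' x"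
    using lebesgue_measurable_ex_borel[OF Vm] .
  have m: "(\<lambda>x. norm (V x) powr p) \<in> borel_measurable lebesgue" using Vm by measurable
  have m': "(\<lambda>x. norm (V' x) powr p) \<in> borel_measurable borel" using V'(1) by measurable
  have ae: "AE x in lborel. norm (V x) powr p = norm (V' x) powr p"
    using V'(2) by eventually_elim simp
  have "integrable lborel (\<lambda>x. norm (V' x) powr p)"
    using Vi unfolding integrable_lebesgue_eq_lborel[OF m m' ae] .
  then have "(\<integral>\<^sup>+x. ennreal (norm (V' x) powr p) \<partial>lborel) = ennreal (LINT x|lborel. norm (V' x) powr p)"
    by (intro nn_integral_eq_integral) auto
  with V' show ?thesis by (intro that[of V' "LINT x|lborel. norm (V' x) powr p"]) auto
qed

lemma integrable_lebesgue_mult_cnj: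
  assumes f: "f \<in> Lp 2" and g: "g \<in> Lp 2"
  shows "integrable lebesgue (\<lambda>x. f x * cnj (g x))"
proof -
  obtain f' where f': "square_integrable f'" "AE x in lborel. f x = f' x" using Lp_2_obtain_borel[OF f] .
  obtain g' where g': "square_integrable g'" "AE x in lborel. g x = g' x" using Lp_2_obtain_borel[OF g] .
  note [measurable] = Lp_2_measurable[OF f] Lp_2_measurable[OF g]
    square_integrable_measurable[OF f'(1)] square_integrable_measurable[OF g'(1)]
  have "(\<lambda>x. f x * cnj (g x)) \<in> borel_measurable lebesgue" by measurable
  moreover have "(\<lambda>x. f' x * cnj (g' x)) \<in> borel_measurable borel" by measurable
  moreover have "AE x in lborel. f x * cnj (g x) = f' x * cnj (g' x)"
    using f'(2) g'(2) by eventually_elim simp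
  ultimately show ?thesis
    using integrable_mult_cnj[OF f'(1) g'(1)] by (rule integrable_lebesgue_eq_lborel[THEN iffD2])
qed

lemma integral_lebesgue_mult_cnj:
  assumes f: "f \<in> borel_measurable lebesgue" "f' \<in> borel_measurable borel" "AE x in lborel. f x = f' x"
    and g: "g \<in> borel_measurable lebesgue" "g' \<in> borel_measurable borel" "AE x in lborel. g x = g' x"
  shows "(LINT x|lebesgue. f x * cnj (g x)) = (LINT x|lborel. f' x * cnj (g' x))"
proof (rule integral_lebesgue_eq_lborel)
  note [measurable] = f(1,2) g(1,2)
  show "(\<lambda>x. f x * cnj (g x)) \<in> borel_measurable lebesgue" by measurable
  show "(\<lambda>x. f' x * cnj (g' x)) \<in> borel_measurable borel" by measurable
  show "AE x in lborel. f x * cnj (g x) = f' x * cnj (g' x)"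
    using f(3) g(3) by eventually_elim simp
qed

section \<open>The form domain and the energy inequality\<close>

lemma form_domain_0: "form_domain (\<lambda>_. 0) = H1"
  by (simp add: form_domain_def Lp_def)

text \<open>|V| |u|^2 is integrable by Young's inequality with exponents n / 2 for V and 2 n / (n -
  2) for u, the latter supplied by Sobolev. The forms with and without the potential thus have the
  same domain, and truncated powers are admissible in both.\<close>

lemma form_domain_Lp:
  fixes V :: "'a::euclidean_space \<Rightarrow> complex"
  assumes n: "DIM('a) \<ge> 3" and V: "V \<in> Lp (real DIM('a) / 2)"
  shows "form_domain V = H1"
proof -
  define n where "n = real DIM('a)"
  have n': "n > 2" using assms(1) by (simp add: n_def)
  obtain V' \<nu> where V': "V' \<in> borel_measurable borel" "AE x in lborel. V x = V' x" "\<nu> \<ge> 0"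
    "(\<integral>\<^sup>+x. ennreal (norm (V' x) powr (n / 2)) \<partial>lborel) = ennreal \<nu>"
    using Lp_obtain_borel[OF V] unfolding n_def .
  have Vm: "V \<in> borel_measurable lebesgue" using V by (simp add: Lp_def)
  have "(\<lambda>x. complex_of_real (sqrt (norm (V x))) * u x) \<in> Lp 2" if u: "u \<in> H1" for u
  proof -
    obtain u' g where u': "square_integrable u'" "AE x in lborel. u x = u' x"
      and g: "\<And>b. b \<in> Basis \<Longrightarrow> square_integrable (g b)" "\<And>b. b \<in> Basis \<Longrightarrow> has_weak_partial b u' (g b)"
      using H1_obtain_borel[OF u] by metis
    have um: "u \<in> borel_measurable lebesgue" using u by (simp add: H1_def Lp_def)
    note [measurable] = V'(1) Vm um square_integrable_measurable[OF u'(1)]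
    have "(\<integral>\<^sup>+x. ennreal (norm (u' x) powr (2 * n / (n - 2))) \<partial>lborel) < top"
      using Sobolev_inequality[OF assms(1) u'(1) g] unfolding n_def by (rule le_less_trans) (simp_all add: g)
    then have fin: "(\<integral>\<^sup>+x. ennreal (norm (V' x) powr (n / 2)) + ennreal (norm (u' x) powr (2 * n / (n - 2))) \<partial>lborel) < top"
      by (subst nn_integral_add) (auto simp: V'(4))
    have le: "norm (V' x) * (norm (u' x))\<^sup>2 \<le> norm (V' x) powr (n / 2) + norm (u' x) powr (2 * n / (n - 2))" for x
      using powr_mult_powr_le[of "norm (V' x)" "norm (u' x)" "n / 2" "2 * n / (n - 2)" 1 2] n'
      by (simp add: diff_divide_distrib add_divide_distrib)
    have sq: "(norm (complex_of_real (sqrt (norm (V' x))) * u' x))\<^sup>2 = norm (V' x) * (norm (u' x))\<^sup>2" for x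
      by (simp add: norm_mult power_mult_distrib)
    have "square_integrable (\<lambda>x. complex_of_real (sqrt (norm (V' x))) * u' x)"
      unfolding square_integrable_def
    proof
      show "(\<lambda>x. complex_of_real (sqrt (norm (V' x))) * u' x) \<in> borel_measurable borel" by measurable
      show "integrable lborel (\<lambda>x. (norm (complex_of_real (sqrt (norm (V' x))) * u' x))\<^sup>2)"
      proof (rule integrableI_bounded)
        have "(\<integral>\<^sup>+x. ennreal (norm ((norm (complex_of_real (sqrt (norm (V' x))) * u' x))\<^sup>2)) \<partial>lborel)
          \<le> (\<integral>\<^sup>+x. ennreal (norm (V' x) powr (n / 2)) + ennreal (norm (u' x) powr (2 * n / (n - 2))) \<partial>lborel)"
          using le by (intro nn_integral_mono) (simp add: sq ennreal_plus[symmetric] ennreal_leI del: ennreal_plus)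
        also note fin
        finally show "(\<integral>\<^sup>+x. ennreal (norm ((norm (complex_of_real (sqrt (norm (V' x))) * u' x))\<^sup>2)) \<partial>lborel) < \<infinity>" by simp
      qed measurable
    qed
    moreover have ae: "AE x in lborel. complex_of_real (sqrt (norm (V x))) * u x = complex_of_real (sqrt (norm (V' x))) * u' x"
      using V'(2) u'(2) by eventually_elim simp
    moreover have m: "(\<lambda>x. complex_of_real (sqrt (norm (V x))) * u x) \<in> borel_measurable lebesgue" by measurable
    moreover have m': "(\<lambda>x. complex_of_real (sqrt (norm (V' x))) * u' x) \<in> borel_measurable borel" by measurable
    ultimately show ?thesis
      using Lp_2_iff[OF m m' ae] by blast
  qed
  then show ?thesis by (auto simp: form_domain_def)
qed

lemma integral_gradient_mult_cnj:
  fixes u v :: "'a::euclidean_space \<Rightarrow> complex"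
  assumes u: "u \<in> H1" and v: "v \<in> H1"
    and g: "\<And>b. b \<in> Basis \<Longrightarrow> square_integrable (g b)" "\<And>b. b \<in> Basis \<Longrightarrow> AE x in lborel. weak_partial b u x = g b x"
    and h: "\<And>b. b \<in> Basis \<Longrightarrow> square_integrable (h b)" "\<And>b. b \<in> Basis \<Longrightarrow> AE x in lborel. weak_partial b v x = h b x"
  shows "(LINT x|lebesgue. (\<Sum>b\<in>Basis. weak_partial b u x * cnj (weak_partial b v x)))
     = (\<Sum>b\<in>Basis. LINT x|lborel. g b x * cnj (h b x))"
proof -
  have "(LINT x|lebesgue. (\<Sum>b\<in>Basis. weak_partial b u x * cnj (weak_partial b v x)))
     = (\<Sum>b\<in>Basis. LINT x|lebesgue. weak_partial b u x * cnj (weak_partial b v x))"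
    by (intro Bochner_Integration.integral_sum integrable_lebesgue_mult_cnj H1_weak_partial(1) u v)
  also have "\<dots> = (\<Sum>b\<in>Basis. LINT x|lborel. g b x * cnj (h b x))"
  proof (rule sum.cong)
    fix b :: 'a assume b: "b \<in> Basis"
    show "(LINT x|lebesgue. weak_partial b u x * cnj (weak_partial b v x)) = (LINT x|lborel. g b x * cnj (h b x))"
      by (rule integral_lebesgue_mult_cnj[OF
          Lp_2_measurable[OF H1_weak_partial(1)[OF u b]] square_integrable_measurable[OF g(1)[OF b]] g(2)[OF b]
          Lp_2_measurable[OF H1_weak_partial(1)[OF v b]] square_integrable_measurable[OF h(1)[OF b]] h(2)[OF b]])
  qed simp
  finally show ?thesis .
qed

lemma schroedinger_energy:
  fixes V u f :: "'a::euclidean_space \<Rightarrow> complex"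
  assumes V: "V \<in> borel_measurable lebesgue" and dom: "form_domain V = H1"
    and gr: "schroedinger_graph V u f"
    and u': "square_integrable u'" "AE x in lborel. u x = u' x"
    and f': "square_integrable f'" "AE x in lborel. f x = f' x"
    and g: "\<And>b. b \<in> Basis \<Longrightarrow> square_integrable (g b)"
      "\<And>b. b \<in> Basis \<Longrightarrow> AE x in lborel. weak_partial b u x = g b x"
      "\<And>b. b \<in> Basis \<Longrightarrow> has_weak_partial b u' (g b)"
    and e: "e > 0" and p: "p > 0"
  shows "(\<Sum>b\<in>Basis. LINT x|lborel. Re (g b x * cnj (truncated_power_deriv e p (u' x) (g b x))))
        \<le> Re (LINT x|lborel. f' x * cnj (truncated_power e p (u' x)))"
proof -
  let ?v = "\<lambda>x. truncated_power e p (u' x)"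
  let ?h = "\<lambda>b x. truncated_power_deriv e p (u' x) (g b x)"
  have u: "u \<in> H1" and f: "f \<in> Lp 2" using gr dom by (auto simp: schroedinger_graph_def)
  have b0: "(SOME i. i \<in> Basis) \<in> (Basis :: 'a set)" by (rule SOME_Basis)
  have v: "square_integrable ?v"
    by (rule truncated_power_chain_rule(1)[OF e p b0 u'(1) g(1)[OF b0] g(3)[OF b0]])
  have h: "square_integrable (?h b)" "has_weak_partial b ?v (?h b)" if "b \<in> Basis" for b
    using truncated_power_chain_rule(2,3)[OF e p that u'(1) g(1)[OF that] g(3)[OF that]] by auto
  have vH: "?v \<in> H1" by (rule square_integrable_imp_H1[OF v h])
  have vh: "AE x in lborel. weak_partial b ?v x = ?h b x" if "b \<in> Basis" for b
    by (rule weak_partial_eq[OF v h that])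
  note vm = square_integrable_measurable[OF v]
  have um: "u \<in> borel_measurable lebesgue" using u by (simp add: H1_def Lp_def)
  note [measurable] = vm um square_integrable_measurable[OF u'(1)]
  obtain V' where V': "V' \<in> borel_measurable borel" "AE x in lborel. V x = V' x"
    using lebesgue_measurable_ex_borel[OF V] .
  note [measurable] = V'(1) V
  have "(LINT x|lebesgue. complex_of_real (norm (V x)) * u x * cnj (?v x))
    = (LINT x|lborel. complex_of_real (norm (V' x)) * u' x * cnj (?v x))"
  proof (rule integral_lebesgue_eq_lborel)
    have [measurable]: "?v \<in> borel_measurable lebesgue" by (rule borel_imp_lebesgue_measurable[OF vm])
    show "(\<lambda>x. complex_of_real (norm (V x)) * u x * cnj (?v x)) \<in> borel_measurable lebesgue" by measurable
    show "(\<lambda>x. complex_of_real (norm (V' x)) * u' x * cnj (?v x)) \<in> borel_measurable borel" by measurable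
    show "AE x in lborel. complex_of_real (norm (V x)) * u x * cnj (?v x) = complex_of_real (norm (V' x)) * u' x * cnj (?v x)"
      using V'(2) u'(2) by eventually_elim simp
  qed
  \<comment> \<open>The truncated power is a nonnegative weight times u, so its conjugate pairs with
    u to a nonnegative real.\<close>
  also have "\<dots> = (LINT x|lborel. complex_of_real (norm (V' x) * (truncated_square e (u' x) powr p * (norm (u' x))\<^sup>2)))"
    by (intro Bochner_Integration.integral_cong)
       (simp_all add: truncated_power_def scaleR_conv_of_real mult_ac
          complex_norm_square[unfolded of_real_power, symmetric])
  also have "\<dots> = complex_of_real (LINT x|lborel. norm (V' x) * (truncated_square e (u' x) powr p * (norm (u' x))\<^sup>2))"
    by (rule integral_complex_of_real)
  finally have "0 \<le> Re (LINT x|lebesgue. complex_of_real (norm (V x)) * u x * cnj (?v x))" by simp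
  moreover have "schroedinger_form V u ?v = (LINT x|lebesgue. f x * cnj (?v x))"
    using gr vH dom by (simp add: schroedinger_graph_def)
  moreover have "(LINT x|lebesgue. f x * cnj (?v x)) = (LINT x|lborel. f' x * cnj (?v x))"
    by (rule integral_lebesgue_mult_cnj[OF Lp_2_measurable[OF f] square_integrable_measurable[OF f'(1)] f'(2)
        borel_imp_lebesgue_measurable[OF vm] vm]) simp
  ultimately have "Re (\<Sum>b\<in>Basis. LINT x|lborel. g b x * cnj (?h b x)) \<le> Re (LINT x|lborel. f' x * cnj (?v x))"
    using integral_gradient_mult_cnj[OF u vH g(1,2) h(1) vh]
    by (simp add: schroedinger_form_def complex_eq_iff)
  moreover have "Re (\<Sum>b\<in>Basis. LINT x|lborel. g b x * cnj (?h b x))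
     = (\<Sum>b\<in>Basis. LINT x|lborel. Re (g b x * cnj (?h b x)))"
    unfolding Re_sum by (intro sum.cong refl integral_Re[symmetric] integrable_mult_cnj g(1) h(1))
  ultimately show ?thesis by simp
qed

text \<open>This is Hoelder with 4 / n + 2 / q = 1, done by Young's inequality after scaling u to
  norm at most 1 in L^q. \<open>P\<close> is fixed before \<open>u\<close> and \<open>f\<close>, as
  the supremum in \<open>W2_const\<close> demands.\<close>

lemma abs_mult_bound:
  fixes V :: "'a::euclidean_space \<Rightarrow> complex"
  assumes n: "DIM('a) > 4" and V: "V \<in> Lp (real DIM('a) / 2)"
  obtains P where "P \<ge> 0"
    "\<And>u f. schroedinger_graph V u f \<Longrightarrow> \<not> (AE x in lebesgue. u x = 0) \<Longrightarrow>
       abs_mult V u \<in> Lp 2 \<and> Lp_norm 2 (abs_mult V u) \<le> P * Lp_norm 2 f \<and> Lp_norm 2 f > 0"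
proof -
  define n where "n = real DIM('a)"
  have n': "n > 4" using assms(1) by (simp add: n_def)
  define q where "q = 2 * n / (n - 4)"
  have q: "q > 0" using n' by (simp add: q_def)
  obtain V' \<nu> where V': "V' \<in> borel_measurable borel" "AE x in lborel. V x = V' x" "\<nu> \<ge> 0"
    "(\<integral>\<^sup>+x. ennreal (norm (V' x) powr (n / 2)) \<partial>lborel) = ennreal \<nu>"
    using Lp_obtain_borel[OF V] unfolding n_def .
  have Vm: "V \<in> borel_measurable lebesgue" using V by (simp add: Lp_def)
  have dom: "form_domain V = H1" using assms by (intro form_domain_Lp) auto
  define K where "K = ((1 + n / (n - 2)) * (1 + 2 / (n - 4)))\<^sup>2"
  have "1 + n / (n - 2) > 0" "1 + 2 / (n - 4) > 0" using n' by (simp_all add: add_pos_pos)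
  then have K: "K > 0" unfolding K_def by (intro zero_less_power mult_pos_pos)
  show ?thesis
  \<comment> \<open>\<open>K\<close> is the constant of the elliptic estimate, and \<nu> is the
    integral of |V|^(n / 2); the summand 1 bounds the integral of the scaled |u|^q.\<close>
  proof (rule that[of "K * sqrt (\<nu> + 1)"])
    show "0 \<le> K * sqrt (\<nu> + 1)" using K V'(3) by simp
    fix u f assume gr: "schroedinger_graph V u f" and nz: "\<not> (AE x in lebesgue. u x = 0)"
    have u: "u \<in> H1" and f: "f \<in> Lp 2" using gr dom by (auto simp: schroedinger_graph_def)
    have um: "u \<in> borel_measurable lebesgue" using u by (simp add: H1_def Lp_def)
    obtain u' g where u': "square_integrable u'" "AE x in lborel. u x = u' x"
      and g: "\<And>b. b \<in> Basis \<Longrightarrow> square_integrable (g b)"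
        "\<And>b. b \<in> Basis \<Longrightarrow> AE x in lborel. weak_partial b u x = g b x"
        "\<And>b. b \<in> Basis \<Longrightarrow> has_weak_partial b u' (g b)"
      using H1_obtain_borel[OF u] by blast
    obtain f' where f': "square_integrable f'" "AE x in lborel. f x = f' x" using Lp_2_obtain_borel[OF f] .
    note [measurable] = V'(1) Vm um square_integrable_measurable[OF u'(1)]
    define F where "F = sqrt (square_integral f')"
    have F: "Lp_norm 2 f = F" "F \<ge> 0"
      unfolding F_def by (rule Lp_norm_2_eq[OF Lp_2_measurable[OF f] square_integrable_measurable[OF f'(1)] f'(2)], simp)
    have est: "(\<integral>\<^sup>+x. ennreal (norm (u' x) powr q) \<partial>lborel) \<le> ennreal ((K * F) powr q)"
      unfolding q_def n_def K_def F_def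
      by (rule elliptic_estimate[OF n u'(1) f'(1) g(1,3) schroedinger_energy[OF Vm dom gr u' f' g]])
    \<comment> \<open>Injectivity of the operator: the elliptic estimate with \<open>F = 0\<close>
      forces \<open>u\<close> to vanish almost everywhere.\<close>
    have "F \<noteq> 0"
    proof
      assume "F = 0"
      then have "(\<integral>\<^sup>+x. ennreal (norm (u' x) powr q) \<partial>lborel) = 0" using est q by simp
      then have "AE x in lborel. ennreal (norm (u' x) powr q) = 0" by (subst (asm) nn_integral_0_iff_AE) measurable
      then have "AE x in lborel. u x = 0"
        using u'(2) by eventually_elim simp
      then show False using nz by (simp add: AE_completion_iff)
    qed
    then have F_pos: "F > 0" using F(2) by simp
    \<comment> \<open>By \<open>est\<close>, the function u / c has norm at most 1 in L^q.\<close>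
    define c where "c = K * F"
    have c: "c > 0" using K F_pos by (simp add: c_def)
    let ?m = "abs_mult V' u'"
    have pw: "(norm (?m x))\<^sup>2 \<le> c\<^sup>2 * (norm (V' x) powr (n / 2) + norm (u' x) powr q / c powr q)" for x
    proof -
      have "(norm (V' x)) powr 2 * (norm (u' x) / c) powr 2 \<le> norm (V' x) powr (n / 2) + (norm (u' x) / c) powr q"
        using n' c q by (intro powr_mult_powr_le) (auto simp: q_def field_simps)
      then have "(norm (V' x))\<^sup>2 * ((norm (u' x))\<^sup>2 / c\<^sup>2) \<le> norm (V' x) powr (n / 2) + norm (u' x) powr q / c powr q"
        using c by (simp add: powr_divide power_divide)
      then have "c\<^sup>2 * ((norm (V' x))\<^sup>2 * ((norm (u' x))\<^sup>2 / c\<^sup>2)) \<le> c\<^sup>2 * (norm (V' x) powr (n / 2) + norm (u' x) powr q / c powr q)"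
        by (rule mult_left_mono) simp
      also have "c\<^sup>2 * ((norm (V' x))\<^sup>2 * ((norm (u' x))\<^sup>2 / c\<^sup>2)) = (norm (?m x))\<^sup>2"
        using c by (simp add: abs_mult_def norm_mult power_mult_distrib)
      finally show ?thesis .
    qed
    have mm[measurable]: "?m \<in> borel_measurable borel" unfolding abs_mult_def by measurable
    have "(\<integral>\<^sup>+x. ennreal ((norm (?m x))\<^sup>2) \<partial>lborel)
       \<le> (\<integral>\<^sup>+x. ennreal (c\<^sup>2) * (ennreal (norm (V' x) powr (n / 2)) + ennreal (1 / c powr q) * ennreal (norm (u' x) powr q)) \<partial>lborel)"
    proof (rule nn_integral_mono)
      fix x
      have "ennreal (c\<^sup>2) * (ennreal (norm (V' x) powr (n / 2)) + ennreal (1 / c powr q) * ennreal (norm (u' x) powr q))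
        = ennreal (c\<^sup>2 * (norm (V' x) powr (n / 2) + norm (u' x) powr q / c powr q))"
        by (simp add: ennreal_mult[symmetric] ennreal_plus[symmetric] del: ennreal_plus)
      then show "ennreal ((norm (?m x))\<^sup>2) \<le> ennreal (c\<^sup>2) * (ennreal (norm (V' x) powr (n / 2)) + ennreal (1 / c powr q) * ennreal (norm (u' x) powr q))"
        using pw[of x] by (simp add: ennreal_leI)
    qed
    also have "\<dots> = ennreal (c\<^sup>2) * (ennreal \<nu> + ennreal (1 / c powr q) * (\<integral>\<^sup>+x. ennreal (norm (u' x) powr q) \<partial>lborel))"
      by (simp add: nn_integral_cmult nn_integral_add V'(4))
    also have "\<dots> \<le> ennreal (c\<^sup>2) * (ennreal \<nu> + ennreal (1 / c powr q) * ennreal (c powr q))"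
      using est by (intro mult_left_mono add_left_mono) (auto simp: c_def)
    also have "\<dots> = ennreal (c\<^sup>2 * (\<nu> + 1))"
    proof -
      have "ennreal (1 / c powr q) * ennreal (c powr q) = ennreal 1"
        using c by (subst ennreal_mult[symmetric]) auto
      then show ?thesis using V'(3) by (simp add: ennreal_mult ennreal_plus[symmetric] del: ennreal_plus ennreal_1 flip: ennreal_1)
    qed
    finally have bound: "(\<integral>\<^sup>+x. ennreal ((norm (?m x))\<^sup>2) \<partial>lborel) \<le> ennreal (c\<^sup>2 * (\<nu> + 1))" .
    have m: "square_integrable ?m"
      unfolding square_integrable_def
    proof
      show "integrable lborel (\<lambda>x. (norm (?m x))\<^sup>2)"
      proof (rule integrableI_bounded)
        have "(\<integral>\<^sup>+x. ennreal ((norm (?m x))\<^sup>2) \<partial>lborel) < top" using bound by (rule le_less_trans) simp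
        then show "(\<integral>\<^sup>+x. ennreal (norm ((norm (?m x))\<^sup>2)) \<partial>lborel) < \<infinity>" by simp
      qed measurable
    qed measurable
    have "square_integral ?m \<le> c\<^sup>2 * (\<nu> + 1)"
      using bound V'(3) unfolding nn_integral_square_integral[OF m] by (subst (asm) ennreal_le_iff) auto
    then have "sqrt (square_integral ?m) \<le> sqrt (c\<^sup>2 * (\<nu> + 1))" by (rule real_sqrt_le_mono)
    then have norm_le: "sqrt (square_integral ?m) \<le> K * sqrt (\<nu> + 1) * F"
      using c by (simp add: real_sqrt_mult c_def mult_ac)
    have am: "abs_mult V u \<in> borel_measurable lebesgue" unfolding abs_mult_def by measurable
    have ae: "AE x in lborel. abs_mult V u x = ?m x"
      using V'(2) u'(2) by eventually_elim (simp add: abs_mult_def)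
    from Lp_2_iff[OF am mm ae] Lp_norm_2_eq[OF am mm ae] m norm_le
    show "abs_mult V u \<in> Lp 2 \<and> Lp_norm 2 (abs_mult V u) \<le> K * sqrt (\<nu> + 1) * Lp_norm 2 f \<and> Lp_norm 2 f > 0"
      by (simp add: F(1) F_pos)
  qed
qed

text \<open>Both forms have domain H^1, so moving the potential term to the right shows that
  \<open>f - abs_mult V u\<close> represents the Laplacian. The constant comes from |a - b|^2 <= 2
  |a|^2 + 2 |b|^2, integrated in place of the triangle inequality in L^2.\<close>

lemma neg_laplacian_bound:
  fixes V :: "'a::euclidean_space \<Rightarrow> complex"
  assumes dom: "form_domain V = H1" and gr: "schroedinger_graph V u f"
    and am: "abs_mult V u \<in> Lp 2" and P: "P \<ge> 0" and le: "Lp_norm 2 (abs_mult V u) \<le> P * Lp_norm 2 f"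
  shows "u \<in> neg_laplacian_domain \<and> Lp_norm 2 (neg_laplacian u) \<le> sqrt (2 + 2 * P\<^sup>2) * Lp_norm 2 f"
proof -
  have u: "u \<in> H1" and f: "f \<in> Lp 2" using gr dom by (auto simp: schroedinger_graph_def)
  obtain f' where f': "square_integrable f'" "AE x in lborel. f x = f' x" using Lp_2_obtain_borel[OF f] .
  obtain m where m: "square_integrable m" "AE x in lborel. abs_mult V u x = m x" using Lp_2_obtain_borel[OF am] .
  note [measurable] = square_integrable_measurable[OF f'(1)] square_integrable_measurable[OF m(1)]
    Lp_2_measurable[OF f] Lp_2_measurable[OF am]
  define w where "w x = f x - abs_mult V u x" for x
  define w' where "w' x = f' x - m x" for x
  have sum_int: "integrable lborel (\<lambda>x. 2 * (norm (f' x))\<^sup>2 + 2 * (norm (m x))\<^sup>2)"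
    by (intro Bochner_Integration.integrable_add integrable_mult_right square_integrable_integrable f'(1) m(1))
  have le_sum: "(norm (w' x))\<^sup>2 \<le> 2 * (norm (f' x))\<^sup>2 + 2 * (norm (m x))\<^sup>2" for x
  proof -
    have "(norm (w' x))\<^sup>2 \<le> (norm (f' x) + norm (m x))\<^sup>2"
      unfolding w'_def by (intro power_mono norm_triangle_ineq4) simp
    also have "\<dots> \<le> 2 * (norm (f' x))\<^sup>2 + 2 * (norm (m x))\<^sup>2"
      using sum_squares_bound[of "norm (f' x)" "norm (m x)"] by (simp add: power2_sum)
    finally show ?thesis .
  qed
  have w': "square_integrable w'"
    unfolding square_integrable_def
  proof
    show "w' \<in> borel_measurable borel" unfolding w'_def by measurable
    then show "integrable lborel (\<lambda>x. (norm (w' x))\<^sup>2)"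
      using le_sum by (intro Bochner_Integration.integrable_bound[OF sum_int]) auto
  qed
  have w_ae: "AE x in lborel. w x = w' x"
    using f'(2) m(2) by eventually_elim (simp add: w_def w'_def)
  have wm: "w \<in> borel_measurable lebesgue" unfolding w_def by measurable
  have w: "w \<in> Lp 2" using Lp_2_iff[OF wm square_integrable_measurable[OF w'] w_ae] w' by blast
  have form_eq: "schroedinger_form (\<lambda>_. 0) u v = (LINT x|lebesgue. w x * cnj (v x))" if v: "v \<in> H1" for v
  proof -
    have v2: "v \<in> Lp 2" using v by (simp add: H1_def)
    have "schroedinger_form V u v = (LINT x|lebesgue. f x * cnj (v x))"
      using gr v dom by (simp add: schroedinger_graph_def)
    moreover have "schroedinger_form V u v = schroedinger_form (\<lambda>_. 0) u v + (LINT x|lebesgue. abs_mult V u x * cnj (v x))"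
      by (simp add: schroedinger_form_def abs_mult_def)
    moreover have "(LINT x|lebesgue. w x * cnj (v x))
        = (LINT x|lebesgue. f x * cnj (v x)) - (LINT x|lebesgue. abs_mult V u x * cnj (v x))"
      unfolding w_def left_diff_distrib
      by (intro Bochner_Integration.integral_diff integrable_lebesgue_mult_cnj f am v2)
    ultimately show ?thesis by (metis add_diff_cancel_right')
  qed
  have gr0: "schroedinger_graph (\<lambda>_. 0) u w"
    using u w form_eq by (simp add: schroedinger_graph_def form_domain_0)
  then have "u \<in> neg_laplacian_domain" by (auto simp: schroedinger_domain_def)
  \<comment> \<open>\<open>neg_laplacian u\<close> is some element of the graph; below it is
    identified with \<open>w'\<close> by pairing both with test functions.\<close>
  moreover have grk: "schroedinger_graph (\<lambda>_. 0) u (neg_laplacian u)"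
    unfolding schroedinger_op_def by (rule someI[of "schroedinger_graph (\<lambda>_. 0) u", OF gr0])
  then have k: "neg_laplacian u \<in> Lp 2" by (simp add: schroedinger_graph_def)
  obtain k' where k': "square_integrable k'" "AE x in lborel. neg_laplacian u x = k' x" using Lp_2_obtain_borel[OF k] .
  have "AE x in lborel. k' x = w' x"
  proof (rule H1_inner_unique[OF k'(1) w'])
    fix \<phi> :: "'a \<Rightarrow> complex" assume \<phi>: "\<phi> \<in> test_functions"
    note pm = test_function_measurable[OF \<phi>]
    have H: "\<phi> \<in> H1" by (rule test_function_H1[OF \<phi>])
    have "(LINT x|lborel. k' x * cnj (\<phi> x)) = (LINT x|lebesgue. neg_laplacian u x * cnj (\<phi> x))"
      by (rule integral_lebesgue_mult_cnj[OF Lp_2_measurable[OF k] square_integrable_measurable[OF k'(1)] k'(2)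
          borel_imp_lebesgue_measurable[OF pm] pm, symmetric]) simp
    also have "\<dots> = schroedinger_form (\<lambda>_. 0) u \<phi>"
      using grk H by (simp add: schroedinger_graph_def form_domain_0)
    also have "\<dots> = (LINT x|lebesgue. w x * cnj (\<phi> x))" by (rule form_eq[OF H])
    also have "\<dots> = (LINT x|lborel. w' x * cnj (\<phi> x))"
      by (rule integral_lebesgue_mult_cnj[OF wm square_integrable_measurable[OF w'] w_ae
          borel_imp_lebesgue_measurable[OF pm] pm]) simp
    finally show "(LINT x|lborel. k' x * cnj (\<phi> x)) = (LINT x|lborel. w' x * cnj (\<phi> x))" .
  qed
  with k'(2) have "AE x in lborel. neg_laplacian u x = w' x" by eventually_elim simp
  from Lp_norm_2_eq[OF Lp_2_measurable[OF k] square_integrable_measurable[OF w'] this]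
  have "Lp_norm 2 (neg_laplacian u) = sqrt (square_integral w')" .
  moreover have "sqrt (square_integral w') \<le> sqrt (2 + 2 * P\<^sup>2) * Lp_norm 2 f"
  proof -
    have F: "Lp_norm 2 f = sqrt (square_integral f')"
      by (rule Lp_norm_2_eq[OF Lp_2_measurable[OF f] square_integrable_measurable[OF f'(1)] f'(2)])
    have M: "Lp_norm 2 (abs_mult V u) = sqrt (square_integral m)"
      by (rule Lp_norm_2_eq[OF Lp_2_measurable[OF am] square_integrable_measurable[OF m(1)] m(2)])
    have "(sqrt (square_integral m))\<^sup>2 \<le> (P * Lp_norm 2 f)\<^sup>2"
      using le unfolding M by (intro power_mono) auto
    then have "square_integral m \<le> P\<^sup>2 * square_integral f'" by (simp add: F power_mult_distrib)
    moreover have "square_integral w' \<le> 2 * square_integral f' + 2 * square_integral m"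
    proof -
      have "square_integral w' \<le> (LINT x|lborel. 2 * (norm (f' x))\<^sup>2 + 2 * (norm (m x))\<^sup>2)"
        by (intro integral_mono square_integrable_integrable w' sum_int le_sum)
      then show ?thesis using f'(1) m(1) by (simp add: square_integrable_def)
    qed
    ultimately have "square_integral w' \<le> (2 + 2 * P\<^sup>2) * square_integral f'" by (simp add: algebra_simps)
    then show ?thesis unfolding F real_sqrt_mult[symmetric] by (rule real_sqrt_le_mono)
  qed
  ultimately show ?thesis by simp
qed

theorem proposition5p3:
  assumes "CARD('n::finite) > 4"
  shows "(Lp (real CARD('n) / 2) :: (real ^ 'n \<Rightarrow> complex) set) \<subseteq> W2"
proof
  fix V :: "real ^ 'n \<Rightarrow> complex" assume "V \<in> Lp (real CARD('n) / 2)"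
  then have V: "V \<in> Lp (real DIM(real ^ 'n) / 2)" by simp
  have n: "DIM(real ^ 'n) > 4" using assms by simp
  have dom: "form_domain V = H1" using n V by (intro form_domain_Lp) auto
  obtain P where P: "P \<ge> 0"
    "\<And>u f. schroedinger_graph V u f \<Longrightarrow> \<not> (AE x in lebesgue. u x = 0) \<Longrightarrow>
       abs_mult V u \<in> Lp 2 \<and> Lp_norm 2 (abs_mult V u) \<le> P * Lp_norm 2 f \<and> Lp_norm 2 f > 0"
    using abs_mult_bound[OF n V] by blast
  \<comment> \<open>The bound adds the contributions of |V| u and of the Laplacian; it depends on
    \<open>V\<close> and the dimension, not on \<open>u\<close>.\<close>
  have "W2_const V \<le> ennreal (P + sqrt (2 + 2 * P\<^sup>2))"
    unfolding W2_const_def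
  proof (rule SUP_least)
    fix u assume "u \<in> {u \<in> schroedinger_domain V. \<not> (AE x in lebesgue. u x = 0)}"
    then have ex: "\<exists>f. schroedinger_graph V u f" and nz: "\<not> (AE x in lebesgue. u x = 0)"
      by (auto simp: schroedinger_domain_def)
    define f where "f = schroedinger_op V u"
    have gr: "schroedinger_graph V u f"
      unfolding f_def schroedinger_op_def by (rule someI_ex[OF ex])
    have am: "abs_mult V u \<in> Lp 2" "Lp_norm 2 (abs_mult V u) \<le> P * Lp_norm 2 f" and pos: "Lp_norm 2 f > 0"
      using P(2)[OF gr nz] by auto
    have lap: "u \<in> neg_laplacian_domain" "Lp_norm 2 (neg_laplacian u) \<le> sqrt (2 + 2 * P\<^sup>2) * Lp_norm 2 f"
      using neg_laplacian_bound[OF dom gr am(1) P(1) am(2)] by auto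
    have "u \<in> Lp 2" using gr dom by (simp add: schroedinger_graph_def H1_def)
    then have amd: "u \<in> abs_mult_domain V" using am(1) by (simp add: abs_mult_domain_def)
    have nonneg: "0 \<le> Lp_norm 2 w" for w :: "real ^ 'n \<Rightarrow> complex" by (simp add: Lp_norm_def)
    have "(ennreal (Lp_norm 2 (abs_mult V u)) + ennreal (Lp_norm 2 (neg_laplacian u))) / ennreal (Lp_norm 2 f)
       = ennreal ((Lp_norm 2 (abs_mult V u) + Lp_norm 2 (neg_laplacian u)) / Lp_norm 2 f)"
      using pos nonneg by (simp add: divide_ennreal ennreal_plus[symmetric] del: ennreal_plus)
    also have "\<dots> \<le> ennreal (P + sqrt (2 + 2 * P\<^sup>2))"
    proof (rule ennreal_leI)
      have "Lp_norm 2 (abs_mult V u) + Lp_norm 2 (neg_laplacian u) \<le> (P + sqrt (2 + 2 * P\<^sup>2)) * Lp_norm 2 f"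
        using am(2) lap(2) by (simp add: distrib_right)
      then show "(Lp_norm 2 (abs_mult V u) + Lp_norm 2 (neg_laplacian u)) / Lp_norm 2 f \<le> P + sqrt (2 + 2 * P\<^sup>2)"
        using pos by (simp add: divide_le_eq)
    qed
    finally show "((if u \<in> abs_mult_domain V then ennreal (Lp_norm 2 (abs_mult V u)) else \<infinity>)
         + (if u \<in> neg_laplacian_domain then ennreal (Lp_norm 2 (neg_laplacian u)) else \<infinity>))
        / ennreal (Lp_norm 2 (schroedinger_op V u)) \<le> ennreal (P + sqrt (2 + 2 * P\<^sup>2))"
      using amd lap(1) by (simp add: f_def)
  qed
  also have "\<dots> < \<infinity>" by simp
  finally have "W2_const V < \<infinity>" .
  moreover have "V \<in> L1_loc"
    using V n Lp_subset_L1_loc[of "real DIM(real ^ 'n) / 2"] by auto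
  ultimately show "V \<in> W2" by (simp add: W2_def)
qed

end
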